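(* Let $M$ be an orientable $3$-manifold, let $N=I\sqcup\dots\sqcup I$ be a finite disjoint union of closed arcs, let $n\in\mathbb N$, and let $L_1,L_2\colon (N,\partial N)\hookrightarrow (M,\partial M)$ be links. Then: (1) $L_1$ and $L_2$ are $n$-quasi-isotopic if and only if they can be joined by a generic PL homotopy $h_t$ such that for every $t$, each component of the image of $h_t$ is $(n-1)$-contractible in the complement in $M$ to the other components; (2) $L_1$ and $L_2$ are weakly $n$-quasi-isotopic if and only if they can be joined by a generic PL homotopy $h_t$ such that for every $t$, each component of the image of $h_t$ is $(n-1)$-split from the union of the other components. Here a "component of the image of $h_t$" means the image under $h_t$ of a component of $N$.
   Context: Everything is in the PL category. A link is a PL embedding $(N,\partial N)\hookrightarrow(M,\partial M)$, where $N$ is a compact $1$-manifold and $M$ an orientable $3$-manifold. A generic PL homotopy between links is a PL homotopy $h_t\colon(N,\partial N)\to(M,\partial M)$ in general position: all but finitely many levels are embeddings and each remaining (singular) level has precisely one double point. Let $k$ be a nonnegative integer. A PL map $f\colon(N,\partial N)\to(M,\partial M)$ with precisely one double point $x$ is a $k$-quasi-embedding (resp. a weak $k$-quasi-embedding) if there exist an arc $J_0\subset N$ with $\partial J_0=f^{-1}(x)$ and chains of subpolyhedra $\{x\}=P_0\subset\dots\subset P_k\subset M$ and $J_0\subset\dots\subset J_k\subset N$ such that: (i) $f^{-1}(P_i)\subset J_i$ for each $i\le k$; (ii) $P_i\cup f(J_i)\subset P_{i+1}$ for each $i<k$; (iii) the inclusion $P_i\cup f(J_i)\hookrightarrow P_{i+1}$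 is null-homotopic (resp. induces zero homomorphisms on reduced integral homology) for each $i<k$; (iv) $P_{i+1}$ is a compact PL $3$-manifold and $J_{i+1}$ is a closed arc for each $i<k$. Two links are (weakly) $k$-quasi-isotopic if they can be joined by a generic PL homotopy all of whose singular levels are (weak) $k$-quasi-embeddings. Let $r\ge -1$ be an integer. A compact subset $A$ of an orientable $3$-manifold $X$ is $r$-contractible in $X$ if there is a sequence of compact subpolyhedra $A\subset P_0\subset\dots\subset P_{r+1}\subset X$ such that each inclusion $P_i\subset P_{i+1}$ is null-homotopic. Compact subsets $A,B\subset M$ are $r$-split ($A$ is $r$-split from $B$) if there is a sequence of compact subpolyhedra $A\subset P_0\subset\dots\subset P_{r+1}\subset M\setminus B$ such that each inclusion $P_i\subset P_{i+1}$ is trivial on reduced integral homology groups. (So "$(-1)$-split" means "disjoint"; likewise being $(-1)$-contractible in the complement of the other components includes disjointness from them.) *)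

theory Defs
  imports "HOL-Analysis.Analysis" "HOL-Homology.Homology"
begin

section \<open>The PL category\<close>

text \<open>
  Polyhedra are subsets of Euclidean spaces that are locally finite unions of convex cells
  (not to be confused with the convex \<^const>\<open>polyhedron\<close> of the library). They need be neither
  closed nor compact: an open subset of a polyhedron is again a polyhedron. The compact ones are
  the finite unions of convex cells.
\<close>

definition polyhedral :: "'a::euclidean_space set \<Rightarrow> bool" where
  "polyhedral P \<longleftrightarrow>
     (\<forall>x\<in>P. \<exists>F U. finite F \<and> (\<forall>S\<in>F. polytope S) \<and>
        openin (top_of_set P) U \<and> x \<in> U \<and> U \<subseteq> \<Union>F \<and> \<Union>F \<subseteq> P)"

text \<open>
  For a continuous map, having a polyhedral graph is the same as being piecewise affine on some
  polyhedral neighbourhood of each point.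
\<close>

definition pl_map :: "'a::euclidean_space set \<Rightarrow> 'b::euclidean_space set \<Rightarrow> ('a \<Rightarrow> 'b) \<Rightarrow> bool" where
  "pl_map P Q f \<longleftrightarrow> polyhedral P \<and> polyhedral Q \<and> f ` P \<subseteq> Q \<and> continuous_on P f \<and>
     polyhedral ((\<lambda>x. (x, f x)) ` P)"

definition pl_homeomorphism ::
    "'a::euclidean_space set \<Rightarrow> 'b::euclidean_space set \<Rightarrow> ('a \<Rightarrow> 'b) \<Rightarrow> ('b \<Rightarrow> 'a) \<Rightarrow> bool" where
  "pl_homeomorphism P Q f g \<longleftrightarrow> homeomorphism P Q f g \<and> pl_map P Q f \<and> pl_map Q P g"

definition pl_embedding :: "'a::euclidean_space set \<Rightarrow> 'b::euclidean_space set \<Rightarrow> ('a \<Rightarrow> 'b) \<Rightarrow> bool" where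
  "pl_embedding P Q f \<longleftrightarrow> pl_map P Q f \<and> (\<exists>g. homeomorphism P (f ` P) f g)"

section \<open>PL manifolds\<close>

text \<open>
  The dimension of a manifold is that of the Euclidean space \<open>'e\<close> in which its charts take their
  values, and is passed as a type. A chart maps an open subset homeomorphically onto an open subset
  of \<open>'e\<close> or a relatively open subset of a closed half-space (any one, so that orientation does not
  restrict the charts at boundary points, in dimension one in particular).
\<close>

definition pl_chart ::
    "'a::euclidean_space set \<Rightarrow> 'a set \<Rightarrow> ('a \<Rightarrow> 'e::euclidean_space) \<Rightarrow> bool" where
  "pl_chart M U \<phi> \<longleftrightarrow> openin (top_of_set M) U \<and> (\<exists>\<psi>. pl_homeomorphism U (\<phi> ` U) \<phi> \<psi>) \<and>
     (open (\<phi> ` U) \<or> (\<exists>v. v \<noteq> 0 \<and> openin (top_of_set {y. 0 \<le> v \<bullet> y}) (\<phi> ` U)))"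

definition pl_manifold :: "'e::euclidean_space itself \<Rightarrow> 'a::euclidean_space set \<Rightarrow> bool" where
  "pl_manifold d M \<longleftrightarrow> polyhedral M \<and> (\<forall>x\<in>M. \<exists>U (\<phi> :: 'a \<Rightarrow> 'e). x \<in> U \<and> pl_chart M U \<phi>)"

definition pl_boundary :: "'e::euclidean_space itself \<Rightarrow> 'a::euclidean_space set \<Rightarrow> 'a set" where
  "pl_boundary d M =
     {x \<in> M. \<not> (\<exists>U (\<phi> :: 'a \<Rightarrow> 'e). x \<in> U \<and> pl_chart M U \<phi> \<and> open (\<phi> ` U))}"

text \<open>
  Orientability: there is an atlas whose transition maps preserve orientation. A PL homeomorphism
  between open subsets of Euclidean space is differentiable on a dense open set, and its local
  behaviour with respect to orientation is the sign of the determinant of the derivative there.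
\<close>

definition pl_orientable :: "(real^'n) itself \<Rightarrow> 'a::euclidean_space set \<Rightarrow> bool" where
  "pl_orientable d M \<longleftrightarrow>
     (\<exists>A :: ('a set \<times> ('a \<Rightarrow> real^'n)) set.
        (\<forall>(U, \<phi>)\<in>A. pl_chart M U \<phi>) \<and> M = (\<Union>(U, \<phi>)\<in>A. U) \<and>
        (\<forall>(U, \<phi>)\<in>A. \<forall>(V, \<psi>)\<in>A. \<forall>y \<in> interior (\<phi> ` (U \<inter> V)). \<forall>D.
           ((\<lambda>z. \<psi> (inv_into U \<phi> z)) has_derivative D) (at y) \<longrightarrow> 0 < det (matrix D)))"

abbreviation pl_3_manifold :: "'a::euclidean_space set \<Rightarrow> bool" where
  "pl_3_manifold \<equiv> pl_manifold TYPE(real^3)"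

definition orientable_pl_3_manifold :: "'a::euclidean_space set \<Rightarrow> bool" where
  "orientable_pl_3_manifold M \<longleftrightarrow> pl_3_manifold M \<and> pl_orientable TYPE(real^3) M"

abbreviation bd1 :: "'a::euclidean_space set \<Rightarrow> 'a set" where
  "bd1 \<equiv> pl_boundary TYPE(real)"

abbreviation bd3 :: "'a::euclidean_space set \<Rightarrow> 'a set" where
  "bd3 \<equiv> pl_boundary TYPE(real^3)"

definition pl_arc :: "'a::euclidean_space set \<Rightarrow> bool" where
  "pl_arc J \<longleftrightarrow> (\<exists>f g. pl_homeomorphism {0..1::real} J f g)"

definition finite_union_of_arcs :: "'a::euclidean_space set \<Rightarrow> bool" where
  "finite_union_of_arcs N \<longleftrightarrow> finite (components N) \<and> (\<forall>C\<in>components N. pl_arc C)"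

section \<open>Links and generic homotopies\<close>

definition pl_pair_map :: "'b::euclidean_space set \<Rightarrow> 'a::euclidean_space set \<Rightarrow> ('b \<Rightarrow> 'a) \<Rightarrow> bool" where
  "pl_pair_map N M f \<longleftrightarrow> pl_map N M f \<and> f ` bd1 N \<subseteq> bd3 M"

definition link :: "'b::euclidean_space set \<Rightarrow> 'a::euclidean_space set \<Rightarrow> ('b \<Rightarrow> 'a) \<Rightarrow> bool" where
  "link N M L \<longleftrightarrow> pl_pair_map N M L \<and> pl_embedding N M L"

definition single_double_point :: "'b set \<Rightarrow> ('b \<Rightarrow> 'a) \<Rightarrow> 'a \<Rightarrow> bool" where
  "single_double_point N f x \<longleftrightarrow> card {u \<in> N. f u = x} = 2 \<and>
     (\<forall>u\<in>N. \<forall>v\<in>N. f u = f v \<longrightarrow> f u \<noteq> x \<longrightarrow> u = v)"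

definition generic_pl_homotopy ::
    "'b::euclidean_space set \<Rightarrow> 'a::euclidean_space set \<Rightarrow> (real \<Rightarrow> 'b \<Rightarrow> 'a) \<Rightarrow> bool" where
  "generic_pl_homotopy N M h \<longleftrightarrow>
     pl_map (N \<times> {0..1}) M (\<lambda>(u, t). h t u) \<and>
     (\<forall>t\<in>{0..1}. h t ` bd1 N \<subseteq> bd3 M) \<and>
     finite {t \<in> {0..1}. \<not> link N M (h t)} \<and>
     (\<forall>t\<in>{0..1}. \<not> link N M (h t) \<longrightarrow> (\<exists>x. single_double_point N (h t) x))"

definition joins :: "'b set \<Rightarrow> (real \<Rightarrow> 'b \<Rightarrow> 'a) \<Rightarrow> ('b \<Rightarrow> 'a) \<Rightarrow> ('b \<Rightarrow> 'a) \<Rightarrow> bool" where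
  "joins N h L1 L2 \<longleftrightarrow> (\<forall>u\<in>N. h 0 u = L1 u \<and> h 1 u = L2 u)"

section \<open>Triviality of inclusions\<close>

definition null_homotopic_inclusion :: "'a::euclidean_space set \<Rightarrow> 'a set \<Rightarrow> bool" where
  "null_homotopic_inclusion P Q \<longleftrightarrow> P \<subseteq> Q \<and>
     (\<exists>c. homotopic_with_canon (\<lambda>_. True) P Q (\<lambda>x. x) (\<lambda>_. c))"

definition null_homologous_inclusion :: "'a::euclidean_space set \<Rightarrow> 'a set \<Rightarrow> bool" where
  "null_homologous_inclusion P Q \<longleftrightarrow> P \<subseteq> Q \<and>
     (\<forall>p. trivial_homomorphism
            (reduced_homology_group p (top_of_set P)) (reduced_homology_group p (top_of_set Q))
            (hom_induced p (top_of_set P) {} (top_of_set Q) {} (\<lambda>x. x)))"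

section \<open>Quasi-embeddings and quasi-isotopy\<close>

text \<open>
  The parameter \<open>triv\<close> is the condition on inclusions in clause (iii); it is instantiated by the
  two conditions above.
\<close>

definition gen_quasi_embedding ::
    "('a::euclidean_space set \<Rightarrow> 'a set \<Rightarrow> bool) \<Rightarrow> nat \<Rightarrow>
     'b::euclidean_space set \<Rightarrow> 'a set \<Rightarrow> ('b \<Rightarrow> 'a) \<Rightarrow> bool" where
  "gen_quasi_embedding triv k N M f \<longleftrightarrow> pl_pair_map N M f \<and>
     (\<exists>x. single_double_point N f x \<and>
       (\<exists>(P :: nat \<Rightarrow> 'a set) (J :: nat \<Rightarrow> 'b set).
          pl_arc (J 0) \<and> bd1 (J 0) = {u \<in> N. f u = x} \<and> P 0 = {x} \<and>
          (\<forall>i\<le>k. polyhedral (P i) \<and> P i \<subseteq> M \<and> polyhedral (J i) \<and> J i \<subseteq> N) \<and>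
          (\<forall>i<k. P i \<subseteq> P (Suc i) \<and> J i \<subseteq> J (Suc i)) \<and>
          (\<forall>i\<le>k. {u \<in> N. f u \<in> P i} \<subseteq> J i) \<and>
          (\<forall>i<k. P i \<union> f ` J i \<subseteq> P (Suc i)) \<and>
          (\<forall>i<k. triv (P i \<union> f ` J i) (P (Suc i))) \<and>
          (\<forall>i<k. compact (P (Suc i)) \<and> pl_3_manifold (P (Suc i)) \<and> pl_arc (J (Suc i)))))"

definition quasi_embedding ::
    "nat \<Rightarrow> 'b::euclidean_space set \<Rightarrow> 'a::euclidean_space set \<Rightarrow> ('b \<Rightarrow> 'a) \<Rightarrow> bool" where
  "quasi_embedding = gen_quasi_embedding null_homotopic_inclusion"

definition weak_quasi_embedding ::
    "nat \<Rightarrow> 'b::euclidean_space set \<Rightarrow> 'a::euclidean_space set \<Rightarrow> ('b \<Rightarrow> 'a) \<Rightarrow> bool" where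
  "weak_quasi_embedding = gen_quasi_embedding null_homologous_inclusion"

definition quasi_isotopic ::
    "nat \<Rightarrow> 'b::euclidean_space set \<Rightarrow> 'a::euclidean_space set \<Rightarrow> ('b \<Rightarrow> 'a) \<Rightarrow> ('b \<Rightarrow> 'a) \<Rightarrow> bool" where
  "quasi_isotopic k N M L1 L2 \<longleftrightarrow>
     (\<exists>h. generic_pl_homotopy N M h \<and> joins N h L1 L2 \<and>
        (\<forall>t\<in>{0..1}. \<not> link N M (h t) \<longrightarrow> quasi_embedding k N M (h t)))"

definition weakly_quasi_isotopic ::
    "nat \<Rightarrow> 'b::euclidean_space set \<Rightarrow> 'a::euclidean_space set \<Rightarrow> ('b \<Rightarrow> 'a) \<Rightarrow> ('b \<Rightarrow> 'a) \<Rightarrow> bool" where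
  "weakly_quasi_isotopic k N M L1 L2 \<longleftrightarrow>
     (\<exists>h. generic_pl_homotopy N M h \<and> joins N h L1 L2 \<and>
        (\<forall>t\<in>{0..1}. \<not> link N M (h t) \<longrightarrow> weak_quasi_embedding k N M (h t)))"

section \<open>Contractibility and splitness\<close>

text \<open>Meaningful for \<open>r \<ge> -1\<close>; the chains are indexed by \<open>0, \<dots>, r + 1\<close>.\<close>

definition r_contractible :: "int \<Rightarrow> 'a::euclidean_space set \<Rightarrow> 'a set \<Rightarrow> bool" where
  "r_contractible r A X \<longleftrightarrow> compact A \<and>
     (\<exists>P :: nat \<Rightarrow> 'a set. A \<subseteq> P 0 \<and>
        (\<forall>i \<le> nat (r + 1). compact (P i) \<and> polyhedral (P i) \<and> P i \<subseteq> X) \<and>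
        (\<forall>i < nat (r + 1). null_homotopic_inclusion (P i) (P (Suc i))))"

definition r_split :: "int \<Rightarrow> 'a::euclidean_space set \<Rightarrow> 'a set \<Rightarrow> 'a set \<Rightarrow> bool" where
  "r_split r M A B \<longleftrightarrow> compact A \<and> compact B \<and>
     (\<exists>P :: nat \<Rightarrow> 'a set. A \<subseteq> P 0 \<and>
        (\<forall>i \<le> nat (r + 1). compact (P i) \<and> polyhedral (P i) \<and> P i \<subseteq> M - B) \<and>
        (\<forall>i < nat (r + 1). null_homologous_inclusion (P i) (P (Suc i))))"

end

theory Submission
  imports Defs
begin

text \<open>
  The homotopy itself is the same on both sides of each equivalence; the conditions are compared
  level by level. At a level that is an embedding, every component of the image is an embedded
  arc, so it is contractible and the constant chain works. Let \<open>f\<close> be a singular level with double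
  point \<open>x\<close>.

  Suppose first that \<open>f\<close> is a quasi-embedding with chains \<open>P\<^sub>i\<close> and \<open>J\<^sub>i\<close>. The connected sets \<open>J\<^sub>i\<close>
  contain the arc \<open>J\<^sub>0\<close>, so they lie in one component \<open>C\<close> of \<open>N\<close>, and since \<open>P\<^sub>i\<close> meets the image
  of \<open>N\<close> only in \<open>f(J\<^sub>i)\<close>, the sets \<open>P\<^sub>i \<union> f(C)\<close> avoid the other components. The part of \<open>C\<close> outside
  \<open>J\<^sub>i\<close> consists of two embedded tails. Pulling them in deforms \<open>P\<^sub>i \<union> f(C)\<close> onto \<open>P\<^sub>i \<union> f(J\<^sub>i)\<close>
  (\<open>arc_tails_retract\<close>), whose inclusion into \<open>P\<^sub>i\<^sub>+\<^sub>1\<close> is trivial. So \<open>P\<^sub>i \<union> f(C)\<close> is the required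
  chain around \<open>f(C)\<close>.

  Conversely, let every component of the image be surrounded by a chain in the complement of the
  others. The images of different components are then disjoint, so both preimages of \<open>x\<close> lie in
  one component \<open>C\<close>; take for \<open>J\<^sub>0\<close> the subarc between them and \<open>J\<^sub>i = C\<close> afterwards. The members
  \<open>P\<^sub>i\<close> of the chain around \<open>f(C)\<close> are mere polyhedra, and \<open>3\<close>-manifolds are wanted. They are
  replaced by compact manifold neighbourhoods \<open>Q\<^sub>i\<close>, chosen for decreasing \<open>i\<close>, with \<open>Q\<^sub>i\<close> so close
  to \<open>P\<^sub>i\<close> that it is deformed into \<open>P\<^sub>i\<close> inside \<open>Q\<^sub>i\<^sub>+\<^sub>1\<close>; this is possible since compact polyhedra
  are Euclidean neighbourhood retracts. Up to homotopy the inclusion of \<open>Q\<^sub>i\<close> into \<open>Q\<^sub>i\<^sub>+\<^sub>1\<close> factors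
  through that of \<open>P\<^sub>i\<close> into \<open>P\<^sub>i\<^sub>+\<^sub>1\<close>, hence is trivial (\<open>triviality_manifold_chain\<close>).

  The arguments use only the behaviour of trivial inclusions under homotopy, which null-homotopic
  and null-homologous inclusions share, so \<open>triviality_condition\<close> covers both equivalences.

  The manifold neighbourhoods (\<open>compact_pl_manifold_nbhd\<close>) are sublevel sets of a PL function \<open>g\<close>,
  a distance from a finite net, at a generic level. In a chart, finitely many hyperplanes
  cut a neighbourhood into cells on which \<open>g\<close> is affine. Away from the finitely many values that \<open>g\<close>
  takes on the cells where it is constant, each point has a direction along which the whole local
  picture is translation invariant and \<open>g\<close> grows at unit speed (\<open>regular_direction\<close>). Sliding along
  this direction makes the level flat (\<open>straighten_level\<close>), so that the sublevel set looks like a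
  half-space, or like a quadrant times a Euclidean space where the level meets the boundary of the
  manifold; the quadrant is unfolded to a half-plane (\<open>corner_to_halfspace\<close>).
\<close>

section \<open>Piecewise affine maps\<close>

text \<open>
  The linear part is defined on the whole space, so that preimages of polytopes under \<open>f\<close> restricted
  to \<open>S\<close> are intersections of \<open>S\<close> with polyhedra.
\<close>
definition affine_map_on :: "('a::euclidean_space \<Rightarrow> 'b::euclidean_space) \<Rightarrow> 'a set \<Rightarrow> bool" where
  "affine_map_on f S \<longleftrightarrow> (\<exists>l c. linear l \<and> (\<forall>x\<in>S. f x = l x + c))"

definition polyhedral_nbhd :: "'a::euclidean_space set \<Rightarrow> 'a set set \<Rightarrow> 'a \<Rightarrow> bool" where
  "polyhedral_nbhd P F x \<longleftrightarrow>
     finite F \<and> (\<forall>S\<in>F. polytope S) \<and> \<Union>F \<subseteq> P \<and> (\<exists>e>0. P \<inter> ball x e \<subseteq> \<Union>F)"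

definition pl_on :: "'a::euclidean_space set \<Rightarrow> ('a \<Rightarrow> 'b::euclidean_space) \<Rightarrow> bool" where
  "pl_on P f \<longleftrightarrow> (\<forall>x\<in>P. \<exists>F. polyhedral_nbhd P F x \<and> (\<forall>S\<in>F. affine_map_on f S))"

lemma polyhedral_iff_nbhd: "polyhedral P \<longleftrightarrow> (\<forall>x\<in>P. \<exists>F. polyhedral_nbhd P F x)"
proof (intro iffI ballI)
  fix x assume "polyhedral P" "x \<in> P"
  then obtain F U where F: "finite F" "\<forall>S\<in>F. polytope S" "openin (top_of_set P) U" "x \<in> U"
      "U \<subseteq> \<Union>F" "\<Union>F \<subseteq> P"
    unfolding polyhedral_def by meson
  then obtain e where "e > 0" "ball x e \<inter> P \<subseteq> U"
    by (meson openin_contains_ball)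
  then have "polyhedral_nbhd P F x"
    unfolding polyhedral_nbhd_def using F by blast
  then show "\<exists>F. polyhedral_nbhd P F x" ..
next
  assume R: "\<forall>x\<in>P. \<exists>F. polyhedral_nbhd P F x"
  show "polyhedral P"
    unfolding polyhedral_def
  proof
    fix x assume x: "x \<in> P"
    then obtain F e where "finite F" "\<forall>S\<in>F. polytope S" "\<Union>F \<subseteq> P" "e > 0" "P \<inter> ball x e \<subseteq> \<Union>F"
      using R unfolding polyhedral_nbhd_def by meson
    then show "\<exists>F U. finite F \<and> (\<forall>S\<in>F. polytope S) \<and> openin (top_of_set P) U \<and> x \<in> U
        \<and> U \<subseteq> \<Union>F \<and> \<Union>F \<subseteq> P"
      using x by (intro exI[of _ F] exI[of _ "P \<inter> ball x e"]) (auto intro: openin_open_Int)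
  qed
qed

lemma affine_map_on_subset: "affine_map_on f S \<Longrightarrow> T \<subseteq> S \<Longrightarrow> affine_map_on f T"
  unfolding affine_map_on_def by blast

lemma affine_map_on_linear: "linear l \<Longrightarrow> affine_map_on (\<lambda>x. l x + c) S"
  unfolding affine_map_on_def by blast

lemma affine_map_on_compose:
  assumes "affine_map_on f S" "affine_map_on g T" "f ` S \<subseteq> T"
  shows "affine_map_on (\<lambda>x. g (f x)) S"
proof -
  obtain l c k d where lk: "linear l" "\<forall>x\<in>S. f x = l x + c" "linear k" "\<forall>x\<in>T. g x = k x + d"
    using assms unfolding affine_map_on_def by meson
  have "\<forall>x\<in>S. g (f x) = (k \<circ> l) x + (k c + d)"
    using lk assms(3) linear_add[OF lk(3)] by (auto simp: image_subset_iff)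
  moreover have "linear (k \<circ> l)"
    using lk linear_compose by blast
  ultimately show ?thesis
    unfolding affine_map_on_def by blast
qed

lemma affine_map_on_Pair:
  assumes "affine_map_on f S" "affine_map_on g S"
  shows "affine_map_on (\<lambda>x. (f x, g x)) S"
proof -
  obtain l c k d where lk: "linear l" "\<forall>x\<in>S. f x = l x + c" "linear k" "\<forall>x\<in>S. g x = k x + d"
    using assms unfolding affine_map_on_def by meson
  have "linear (\<lambda>x. (l x, k x))"
    using lk by (auto intro!: linearI simp: linear_add linear_cmul linear_scale)
  moreover have "\<forall>x\<in>S. (f x, g x) = (l x, k x) + (c, d)"
    using lk by auto
  ultimately show ?thesis
    unfolding affine_map_on_def by blast
qed

lemma affine_map_on_continuous: "affine_map_on f S \<Longrightarrow> continuous_on S f"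
  unfolding affine_map_on_def
  by (metis (no_types, lifting) continuous_on_add continuous_on_const continuous_on_cong
      linear_continuous_on linear_linear)

lemma polytope_affine_image:
  assumes "polytope S" "affine_map_on f S"
  shows "polytope (f ` S)"
proof -
  obtain l c where l: "linear l" "\<forall>x\<in>S. f x = l x + c"
    using assms unfolding affine_map_on_def by meson
  have "f ` S = (+) c ` l ` S"
    using l by (auto simp: image_image add.commute intro!: image_cong)
  then show ?thesis
    using polytope_linear_image[OF l(1) assms(1)] by (simp add: polytope_translation_eq)
qed

text \<open>
  The preimage of a half-space under an affine map is again a half-space (its normal vector is the
  image of the old one under the adjoint), or empty, or everything.
\<close>
lemma polytope_affine_preimage:
  assumes "polytope S" "affine_map_on f S" "polyhedron T"
  shows "polytope {x\<in>S. f x \<in> T}"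
proof -
  obtain l c where l: "linear l" "\<forall>x\<in>S. f x = l x + c"
    using assms unfolding affine_map_on_def by meson
  obtain F where F: "finite F" "T = \<Inter>F" "\<forall>h \<in> F. \<exists>a b. a \<noteq> 0 \<and> h = {x. a \<bullet> x \<le> b}"
    using assms(3) unfolding polyhedron_def by auto
  have 1: "polyhedron ((\<lambda>x. l x + c) -` h)" if hF: "h \<in> F" for h
  proof -
    obtain a b where h: "h = {x. a \<bullet> x \<le> b}"
      using F(3) hF by meson
    have "(\<lambda>x. l x + c) -` h = {x. adjoint l a \<bullet> x \<le> b - a \<bullet> c}"
      unfolding h by (auto simp: adjoint_clauses[OF l(1)] inner_add_right)
    then show ?thesis
      by (simp add: polyhedron_halfspace_le)
  qed
  have "polyhedron (\<Inter>((\<lambda>h. (\<lambda>x. l x + c) -` h) ` F))"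
    using F(1) 1 by (intro polyhedron_Inter) auto
  moreover have "{x\<in>S. f x \<in> T} = S \<inter> \<Inter>((\<lambda>h. (\<lambda>x. l x + c) -` h) ` F)"
    using l(2) F(2) by auto
  ultimately show ?thesis
    by (metis assms(1) polytope_Int_polyhedron)
qed

text \<open>
  A convex piece of a graph is the graph of an affine map. The point is to extend the map from the
  piece to the whole space: the projection is injective on the directions of the piece, because a
  small multiple of any direction can be added to a point of the relative interior without leaving
  the piece, and a linear left inverse of the projection gives the extension.
\<close>
lemma affine_map_on_fst_graph:
  fixes S :: "('a::euclidean_space \<times> 'b::euclidean_space) set"
  assumes "convex S" and graph: "\<And>s. s \<in> S \<Longrightarrow> snd s = f (fst s)"
  shows "affine_map_on f (fst ` S)"
proof (cases "S = {}")
  case True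
  then show ?thesis
    unfolding affine_map_on_def using linear_zero by auto
next
  case False
  then obtain s where s: "s \<in> rel_interior S"
    using rel_interior_eq_empty assms(1) by blast
  define V where "V = span ((\<lambda>x. -s + x) ` S)"
  have sS: "s \<in> S"
    using s rel_interior_subset by blast
  obtain e where e: "e > 0" "cball s e \<inter> affine hull S \<subseteq> S"
    using s by (auto simp: mem_rel_interior_cball)
  have hull: "s + v \<in> affine hull S" if "v \<in> V" for v
    using that affine_hull_span_gen[of s S] hull_inc[OF sS] unfolding V_def by auto
  have fst0: "v = 0" if v: "v \<in> V" "fst v = 0" for v
  proof (rule ccontr)
    assume "v \<noteq> 0"
    define w where "w = (e / norm v) *\<^sub>R v"
    have "w \<in> V"
      using v(1) unfolding w_def V_def by (simp add: span_mul)
    then have "s + w \<in> affine hull S" "s + w \<in> cball s e"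
      using hull e(1) \<open>v \<noteq> 0\<close> by (auto simp: w_def dist_norm)
    then have "s + w \<in> S"
      using e(2) by blast
    moreover have "fst (s + w) = fst s"
      using v by (simp add: w_def)
    ultimately have "s + w = s"
      using graph sS by (metis prod.expand)
    then show False
      using \<open>v \<noteq> 0\<close> e by (simp add: w_def)
  qed
  have "inj_on fst V"
    unfolding inj_on_def
  proof safe
    fix a b c d assume *: "(a, b) \<in> V" "(c, d) \<in> V" "fst (a, b) = fst (c, d)"
    have "(a, b) - (c, d) \<in> V"
      using *(1,2) unfolding V_def by (rule span_diff)
    then have "(a, b) - (c, d) = 0"
      using *(3) by (intro fst0) auto
    then show "a = c" "b = d" by (simp_all add: zero_prod_def)
  qed
  then obtain g where g: "linear g" "\<forall>v\<in>V. g (fst v) = v"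
    using real_vector.linear_exists_left_inverse_on[of fst V] linear_fst
    unfolding V_def linear_def by auto
  have "f x = (snd \<circ> g) x + (snd s - snd (g (fst s)))" if "x \<in> fst ` S" for x
  proof -
    from that obtain t where "x = fst t" "t \<in> S"
      by (rule imageE)
    then have t: "t \<in> S" "x = fst t" by auto
    have "t - s \<in> V"
      using t unfolding V_def by (intro span_base) auto
    then have "g (fst (t - s)) = t - s"
      using g by blast
    then have "g (fst t) - g (fst s) = t - s"
      by (simp add: linear_diff[OF g(1)])
    then have "snd (g (fst t)) - snd (g (fst s)) = snd t - snd s"
      by (metis snd_diff)
    then show ?thesis
      using graph[OF t(1)] t(2) by (simp add: algebra_simps)
  qed
  moreover have "linear (snd \<circ> g)"
    using g linear_compose linear_snd by blast
  ultimately show ?thesis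
    unfolding affine_map_on_def by blast
qed

text \<open>
  Common refinement of two covers by polytopes, for restricting PL maps and for working with two of
  them at once.
\<close>
lemma polyhedral_nbhd_Int:
  assumes "polyhedral_nbhd P F x" "polyhedral_nbhd Q G x"
  shows "polyhedral_nbhd (P \<inter> Q) ((\<lambda>(S, T). S \<inter> T) ` (F \<times> G)) x"
proof -
  obtain d e where de: "d > 0" "e > 0" "P \<inter> ball x d \<subseteq> \<Union>F" "Q \<inter> ball x e \<subseteq> \<Union>G"
    and FG: "finite F" "finite G" "\<forall>S\<in>F. polytope S" "\<forall>S\<in>G. polytope S" "\<Union>F \<subseteq> P" "\<Union>G \<subseteq> Q"
    using assms unfolding polyhedral_nbhd_def by meson
  have "P \<inter> Q \<inter> ball x (min d e) \<subseteq> \<Union>((\<lambda>(S, T). S \<inter> T) ` (F \<times> G))"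
  proof
    fix y assume "y \<in> P \<inter> Q \<inter> ball x (min d e)"
    then have "y \<in> \<Union>F" "y \<in> \<Union>G" using de by auto
    then show "y \<in> \<Union>((\<lambda>(S, T). S \<inter> T) ` (F \<times> G))" by auto
  qed
  moreover have "min d e > 0" using de by auto
  ultimately have "\<exists>e>0. P \<inter> Q \<inter> ball x e \<subseteq> \<Union>((\<lambda>(S, T). S \<inter> T) ` (F \<times> G))" by blast
  moreover have "\<forall>S\<in>(\<lambda>(S, T). S \<inter> T) ` (F \<times> G). polytope S"
    using FG(3,4) by (auto intro: polytope_Int)
  moreover have "\<Union>((\<lambda>(S, T). S \<inter> T) ` (F \<times> G)) \<subseteq> P \<inter> Q"
    using FG(5,6) by auto
  ultimately show ?thesis
    unfolding polyhedral_nbhd_def using FG(1,2) by blast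
qed

lemma polyhedral_Int: "polyhedral P \<Longrightarrow> polyhedral Q \<Longrightarrow> polyhedral (P \<inter> Q)"
  unfolding polyhedral_iff_nbhd by (meson IntD1 IntD2 polyhedral_nbhd_Int)

lemma pl_on_imp_polyhedral: "pl_on P f \<Longrightarrow> polyhedral P"
  unfolding pl_on_def polyhedral_iff_nbhd by blast

lemma pl_on_subset:
  assumes "pl_on P f" "polyhedral Q" "Q \<subseteq> P"
  shows "pl_on Q f"
  unfolding pl_on_def
proof
  fix x assume x: "x \<in> Q"
  then obtain F G where F: "polyhedral_nbhd P F x" "\<forall>S\<in>F. affine_map_on f S"
    and G: "polyhedral_nbhd Q G x"
    using assms unfolding pl_on_def polyhedral_iff_nbhd by blast
  have "polyhedral_nbhd Q ((\<lambda>(S, T). S \<inter> T) ` (F \<times> G)) x"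
    using polyhedral_nbhd_Int[OF F(1) G] assms(3) by (simp add: Int_absorb1)
  moreover have "\<forall>S\<in>(\<lambda>(S, T). S \<inter> T) ` (F \<times> G). affine_map_on f S"
    using F(2) by (auto intro: affine_map_on_subset)
  ultimately show "\<exists>F. polyhedral_nbhd Q F x \<and> (\<forall>S\<in>F. affine_map_on f S)" by blast
qed

lemma pl_on_cong:
  assumes "pl_on P f" "\<And>x. x \<in> P \<Longrightarrow> f x = g x"
  shows "pl_on P g"
  unfolding pl_on_def
proof
  fix x assume "x \<in> P"
  then obtain F where F: "polyhedral_nbhd P F x" "\<forall>S\<in>F. affine_map_on f S"
    using assms unfolding pl_on_def by blast
  have "\<forall>S\<in>F. affine_map_on g S"
    using F assms(2) unfolding polyhedral_nbhd_def affine_map_on_def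
    by (metis Union_upper subsetD)
  then show "\<exists>F. polyhedral_nbhd P F x \<and> (\<forall>S\<in>F. affine_map_on g S)" using F by blast
qed

lemma at_within_Int_open_nhd: "x \<in> U \<Longrightarrow> open U \<Longrightarrow> at x within (P \<inter> U) = at x within P"
  by (rule at_within_nhd[of x U]) auto

lemma pl_on_continuous:
  assumes "pl_on P f"
  shows "continuous_on P f"
  unfolding continuous_on_eq_continuous_within
proof
  fix x assume x: "x \<in> P"
  then obtain F e where F: "finite F" "\<forall>S\<in>F. polytope S" "\<Union>F \<subseteq> P" "\<forall>S\<in>F. affine_map_on f S"
    and e: "e > 0" "P \<inter> ball x e \<subseteq> \<Union>F"
    using assms unfolding pl_on_def polyhedral_nbhd_def by meson
  have "continuous_on (\<Union>F) f"
    using F by (intro continuous_on_closed_Union[of F "\<lambda>S. S", simplified])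
      (auto simp: polytope_imp_closed affine_map_on_continuous)
  then have "continuous_on (P \<inter> ball x e) f"
    using e continuous_on_subset by blast
  moreover have "openin (top_of_set P) (P \<inter> ball x e)"
    by (simp add: openin_open_Int)
  ultimately show "continuous (at x within P) f"
    using e(1) x at_within_Int_open_nhd[of x "ball x e" P]
    by (metis IntI centre_in_ball continuous_on_eq_continuous_within open_ball)
qed

lemma ball_within_polytope:
  fixes x :: "'a::euclidean_space"
  assumes "e > 0"
  obtains B d where "polytope B" "B \<subseteq> ball x e" "d > 0" "ball x d \<subseteq> B"
proof -
  obtain a b where ab: "cbox a b \<subseteq> ball x e" "x \<in> box a b"
    using open_contains_cbox[OF open_ball, of x x e] centre_in_ball[of x e] assms by metis
  then obtain d where "d > 0" "ball x d \<subseteq> box a b"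
    using open_box openE by blast
  then show thesis
    using that[of "cbox a b" d] ab polytope_interval box_subset_cbox by fastforce
qed

lemma open_imp_polyhedral:
  assumes "open S"
  shows "polyhedral S"
  unfolding polyhedral_iff_nbhd
proof
  fix x assume "x \<in> S"
  then obtain e where e: "e > 0" "ball x e \<subseteq> S"
    using assms openE by blast
  obtain B d where B: "polytope B" "B \<subseteq> ball x e" "d > 0" "ball x d \<subseteq> B"
    using ball_within_polytope[OF e(1)] .
  then have "polyhedral_nbhd S {B} x"
    unfolding polyhedral_nbhd_def using e by auto
  then show "\<exists>F. polyhedral_nbhd S F x" ..
qed

lemma polyhedron_imp_polyhedral:
  assumes "polyhedron S"
  shows "polyhedral S"
  unfolding polyhedral_iff_nbhd
proof
  fix x assume "x \<in> S"
  obtain B d where B: "polytope B" "B \<subseteq> ball x 1" "d > 0" "ball x d \<subseteq> B"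
    using ball_within_polytope[of 1 x] by auto
  then have "polyhedral_nbhd S {S \<inter> B} x"
    unfolding polyhedral_nbhd_def using assms polyhedron_Int_polytope by auto
  then show "\<exists>F. polyhedral_nbhd S F x" ..
qed

lemma polyhedral_openin: "openin (top_of_set P) U \<Longrightarrow> polyhedral P \<Longrightarrow> polyhedral U"
  unfolding openin_open using open_imp_polyhedral polyhedral_Int by blast

lemma compact_pl_cover:
  assumes "compact P" "pl_on P f"
  obtains F where "finite F" "\<forall>S\<in>F. polytope S" "\<forall>S\<in>F. affine_map_on f S" "\<Union>F = P"
proof -
  have "\<forall>x\<in>P. \<exists>F e. finite F \<and> (\<forall>S\<in>F. polytope S \<and> affine_map_on f S) \<and> \<Union>F \<subseteq> P \<and> e > 0
      \<and> P \<inter> ball x e \<subseteq> \<Union>F"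
    using assms(2) unfolding pl_on_def polyhedral_nbhd_def by meson
  then obtain F e where Fe: "\<And>x. x \<in> P \<Longrightarrow> finite (F x) \<and> (\<forall>S\<in>F x. polytope S \<and> affine_map_on f S)
      \<and> \<Union>(F x) \<subseteq> P \<and> e x > (0::real) \<and> P \<inter> ball x (e x) \<subseteq> \<Union>(F x)"
    by metis
  have "P \<subseteq> (\<Union>x\<in>P. ball x (e x))"
    using Fe by force
  then obtain D where D: "D \<subseteq> P" "finite D" "P \<subseteq> (\<Union>x\<in>D. ball x (e x))"
    using compactE_image[OF assms(1), of P "\<lambda>x. ball x (e x)"] by auto
  show thesis
  proof (rule that[of "\<Union>(F ` D)"])
    show "finite (\<Union>(F ` D))" using D(2) Fe[OF subsetD[OF D(1)]] by simp
    show "\<Union>(\<Union>(F ` D)) = P"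
    proof
      show "\<Union>(\<Union>(F ` D)) \<subseteq> P" using Fe[OF subsetD[OF D(1)]] by auto
      show "P \<subseteq> \<Union>(\<Union>(F ` D))"
      proof
        fix y assume y: "y \<in> P"
        then obtain x where x: "x \<in> D" "y \<in> ball x (e x)" using D(3) by blast
        then have "y \<in> \<Union>(F x)" using Fe[OF subsetD[OF D(1) x(1)]] y by blast
        then show "y \<in> \<Union>(\<Union>(F ` D))" using x(1) by blast
      qed
    qed
    show "\<forall>S\<in>\<Union>(F ` D). polytope S" "\<forall>S\<in>\<Union>(F ` D). affine_map_on f S"
      using Fe[OF subsetD[OF D(1)]] by auto
  qed
qed

lemma pl_on_affine:
  assumes "polyhedral P" "linear l"
  shows "pl_on P (\<lambda>x. l x + c)"
  unfolding pl_on_def using assms(1) affine_map_on_linear[OF assms(2)]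
  by (simp add: polyhedral_iff_nbhd)

lemma pl_on_id: "polyhedral P \<Longrightarrow> pl_on P (\<lambda>x. x)"
  using pl_on_affine[of P "\<lambda>x. x" 0] linear_id by (simp add: id_def)

lemma pl_on_const: "polyhedral P \<Longrightarrow> pl_on P (\<lambda>x. c)"
  using pl_on_affine[of P "\<lambda>x. 0" c] linear_zero by simp

lemma finite_Union_polytopes:
  assumes "finite F" "\<forall>S\<in>F. polytope S"
  shows "compact (\<Union>F)" "polyhedral (\<Union>F)"
proof -
  have "polyhedral_nbhd (\<Union>F) F x" for x
    unfolding polyhedral_nbhd_def using assms by (auto intro: exI[of _ 1])
  then show "polyhedral (\<Union>F)"
    unfolding polyhedral_iff_nbhd by blast
  show "compact (\<Union>F)"
    using assms by (intro compact_Union) (auto intro: polytope_imp_compact)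
qed

lemma compact_polyhedral_iff:
  "compact P \<and> polyhedral P \<longleftrightarrow> (\<exists>F. finite F \<and> (\<forall>S\<in>F. polytope S) \<and> P = \<Union>F)"
proof
  assume "compact P \<and> polyhedral P"
  then have "compact P" "pl_on P (\<lambda>x. x)"
    using pl_on_id by blast+
  then obtain F where F: "finite F" "\<forall>S\<in>F. polytope S" "\<forall>S\<in>F. affine_map_on (\<lambda>x. x) S" "\<Union>F = P"
    by (rule compact_pl_cover)
  show "\<exists>F. finite F \<and> (\<forall>S\<in>F. polytope S) \<and> P = \<Union>F"
    by (rule exI[of _ F], intro conjI F(1,2) F(4)[symmetric])
qed (use finite_Union_polytopes in metis)

lemma compact_polyhedral_Un:
  assumes "compact P" "polyhedral P" "compact Q" "polyhedral Q"
  shows "polyhedral (P \<union> Q)"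
proof -
  obtain F where "finite F \<and> (\<forall>S\<in>F. polytope S) \<and> P = \<Union>F"
    using iffD1[OF compact_polyhedral_iff conjI[OF assms(1,2)]] ..
  moreover obtain G where "finite G \<and> (\<forall>S\<in>G. polytope S) \<and> Q = \<Union>G"
    using iffD1[OF compact_polyhedral_iff conjI[OF assms(3,4)]] ..
  ultimately show ?thesis
    using finite_Union_polytopes(2)[of "F \<union> G"] by (simp add: ball_Un)
qed

lemma compact_polyhedral_image:
  assumes "compact P" "pl_on P f"
  shows "compact (f ` P)" "polyhedral (f ` P)"
proof -
  obtain F where F: "finite F" "\<forall>S\<in>F. polytope S" "\<forall>S\<in>F. affine_map_on f S" "\<Union>F = P"
    using compact_pl_cover[OF assms] .
  have "finite ((`) f ` F)" "\<forall>S\<in>(`) f ` F. polytope S"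
    using F(1-3) by (auto intro: polytope_affine_image)
  from finite_Union_polytopes[OF this] show "compact (f ` P)" "polyhedral (f ` P)"
    by (simp_all add: F(4)[symmetric] image_Union)
qed

text \<open>
  Stated on the preimage, and not only for maps into \<open>Q\<close>, so that it also yields that preimages of
  polyhedra are polyhedra.
\<close>
lemma pl_on_compose_vimage:
  assumes f: "pl_on P f" and g: "pl_on Q g"
  shows "pl_on {x\<in>P. f x \<in> Q} (\<lambda>x. g (f x))"
  unfolding pl_on_def
proof
  fix x assume "x \<in> {x\<in>P. f x \<in> Q}"
  then have x: "x \<in> P" and fx: "f x \<in> Q" by auto
  obtain F d where F: "finite F" "\<forall>S\<in>F. polytope S" "\<Union>F \<subseteq> P" "\<forall>S\<in>F. affine_map_on f S"
    and d: "d > 0" "P \<inter> ball x d \<subseteq> \<Union>F"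
    using f x unfolding pl_on_def polyhedral_nbhd_def by meson
  obtain G e where G: "finite G" "\<forall>S\<in>G. polytope S" "\<Union>G \<subseteq> Q" "\<forall>S\<in>G. affine_map_on g S"
    and e: "e > 0" "Q \<inter> ball (f x) e \<subseteq> \<Union>G"
    using g fx unfolding pl_on_def polyhedral_nbhd_def by meson
  obtain k where k: "k > 0" "\<forall>y\<in>P. dist y x < k \<longrightarrow> dist (f y) (f x) < e"
    using pl_on_continuous[OF f] x e(1) unfolding continuous_on_iff by meson
  define H where "H = (\<lambda>(S, T). {y\<in>S. f y \<in> T}) ` (F \<times> G)"
  let ?P = "{x\<in>P. f x \<in> Q}"
  have "?P \<inter> ball x (min d k) \<subseteq> \<Union>H"
  proof
    fix y assume y: "y \<in> ?P \<inter> ball x (min d k)"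
    then have yP: "y \<in> P" "f y \<in> Q" "dist y x < k" "y \<in> ball x d" by (simp_all add: dist_commute)
    then have "dist (f y) (f x) < e"
      using k(2) by blast
    then have "f y \<in> Q \<inter> ball (f x) e" using yP(2) by (simp add: dist_commute)
    then have "f y \<in> \<Union>G" using e(2) by blast
    moreover have "y \<in> \<Union>F" using yP d(2) by blast
    ultimately show "y \<in> \<Union>H" unfolding H_def by auto
  qed
  moreover have "min d k > 0" using d k by auto
  moreover have "\<forall>S\<in>H. polytope S"
    unfolding H_def using F(2,4) G(2) by (auto intro!: polytope_affine_preimage polytope_imp_polyhedron)
  moreover have "\<Union>H \<subseteq> ?P" "finite H"
    unfolding H_def using F G by auto
  ultimately have "polyhedral_nbhd ?P H x"
    unfolding polyhedral_nbhd_def by blast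
  moreover have "\<forall>S\<in>H. affine_map_on (\<lambda>x. g (f x)) S"
  proof
    fix R assume "R \<in> H"
    then obtain S T where R: "S \<in> F" "T \<in> G" "R = {y\<in>S. f y \<in> T}" unfolding H_def by auto
    then have "affine_map_on f R" "affine_map_on g T" "f ` R \<subseteq> T"
      using F(4) G(4) by (auto intro: affine_map_on_subset)
    then show "affine_map_on (\<lambda>x. g (f x)) R"
      by (rule affine_map_on_compose)
  qed
  ultimately show "\<exists>F. polyhedral_nbhd ?P F x \<and> (\<forall>S\<in>F. affine_map_on (\<lambda>x. g (f x)) S)" by blast
qed

lemma pl_on_compose:
  assumes "pl_on P f" "pl_on Q g" "f ` P \<subseteq> Q"
  shows "pl_on P (\<lambda>x. g (f x))"
proof -
  have "{x\<in>P. f x \<in> Q} = P" using assms(3) by blast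
  then show ?thesis using pl_on_compose_vimage[OF assms(1,2)] by simp
qed

lemma polyhedral_vimage:
  assumes "pl_on P f" "polyhedral Q"
  shows "polyhedral {x\<in>P. f x \<in> Q}"
  using pl_on_imp_polyhedral[OF pl_on_compose_vimage[OF assms(1) pl_on_id[OF assms(2)]]] .

lemma pl_on_Pair:
  assumes "pl_on P f" "pl_on P g"
  shows "pl_on P (\<lambda>x. (f x, g x))"
  unfolding pl_on_def
proof
  fix x assume x: "x \<in> P"
  then obtain F G where F: "polyhedral_nbhd P F x" "\<forall>S\<in>F. affine_map_on f S"
    and G: "polyhedral_nbhd P G x" "\<forall>S\<in>G. affine_map_on g S"
    using assms unfolding pl_on_def by meson
  have "polyhedral_nbhd P ((\<lambda>(S, T). S \<inter> T) ` (F \<times> G)) x"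
    using polyhedral_nbhd_Int[OF F(1) G(1)] by simp
  moreover have "\<forall>S\<in>(\<lambda>(S, T). S \<inter> T) ` (F \<times> G). affine_map_on (\<lambda>x. (f x, g x)) S"
    using F(2) G(2) by (auto intro!: affine_map_on_Pair intro: affine_map_on_subset)
  ultimately show "\<exists>F. polyhedral_nbhd P F x \<and> (\<forall>S\<in>F. affine_map_on (\<lambda>x. (f x, g x)) S)" by blast
qed

lemma pl_on_linear_compose:
  assumes "pl_on P f" "linear l"
  shows "pl_on P (\<lambda>x. l (f x))"
  using pl_on_compose[OF assms(1) pl_on_affine[OF open_imp_polyhedral[OF open_UNIV] assms(2), of 0]]
  by simp

lemma pl_on_add:
  assumes "pl_on P f" "pl_on P g"
  shows "pl_on P (\<lambda>x. f x + g x)"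
proof -
  have "linear (\<lambda>z::'b \<times> 'b. fst z + snd z)"
    by (auto intro!: linearI simp: algebra_simps)
  from pl_on_linear_compose[OF pl_on_Pair[OF assms] this] show ?thesis by simp
qed

lemma pl_on_uminus: "pl_on P f \<Longrightarrow> pl_on P (\<lambda>x. - f x)"
  by (erule pl_on_linear_compose) (auto intro!: linearI)

lemma pl_on_diff: "pl_on P f \<Longrightarrow> pl_on P g \<Longrightarrow> pl_on P (\<lambda>x. f x - g x)"
  using pl_on_add[of P f "\<lambda>x. - g x"] pl_on_uminus[of P g] by simp

lemma pl_on_scaleR_const: "pl_on P f \<Longrightarrow> pl_on P (\<lambda>x. f x *\<^sub>R v)"
  by (erule pl_on_linear_compose) (auto intro!: linearI simp: scaleR_add_left)

lemma pl_on_inner: "polyhedral P \<Longrightarrow> pl_on P (\<lambda>x. a \<bullet> x)"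
proof -
  assume "polyhedral P"
  moreover have "linear (\<lambda>x. a \<bullet> x)"
    by (rule linearI) (simp_all add: inner_add_right)
  ultimately show ?thesis
    using pl_on_affine[of P "\<lambda>x. a \<bullet> x" 0] by simp
qed

text \<open>
  The one nonlinear building block: maxima and minima are obtained from it by adding and composing.
\<close>
lemma pl_on_pos_part: "pl_on UNIV (max 0 :: real \<Rightarrow> real)"
  unfolding pl_on_def
proof
  fix x :: real
  let ?F = "{cbox (-\<bar>x\<bar> - 1) 0, cbox 0 (\<bar>x\<bar> + 1)}"
  have "polyhedral_nbhd UNIV ?F x"
    unfolding polyhedral_nbhd_def
    by (auto intro!: exI[of _ 1] polytope_interval[where 'a=real, simplified] simp: dist_real_def)
  moreover have "affine_map_on (max 0) (cbox (-\<bar>x\<bar> - 1) 0)"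
    unfolding affine_map_on_def by (intro exI[of _ "\<lambda>x. 0"] exI[of _ 0]) (auto simp: linear_zero)
  moreover have "affine_map_on (max 0) (cbox 0 (\<bar>x\<bar> + 1))"
    unfolding affine_map_on_def by (intro exI[of _ "\<lambda>x. x"] exI[of _ 0]) (auto simp: linear_ident)
  ultimately show "\<exists>F. polyhedral_nbhd UNIV F x \<and> (\<forall>S\<in>F. affine_map_on (max 0) S)" by blast
qed

lemma pl_on_max:
  fixes f g :: "'a::euclidean_space \<Rightarrow> real"
  assumes "pl_on P f" "pl_on P g"
  shows "pl_on P (\<lambda>x. max (f x) (g x))"
proof -
  have "pl_on P (\<lambda>x. g x + max 0 (f x - g x))"
    using pl_on_compose[OF pl_on_diff[OF assms] pl_on_pos_part] assms by (intro pl_on_add) auto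
  then show ?thesis
    by (rule pl_on_cong) auto
qed

lemma pl_on_min:
  fixes f g :: "'a::euclidean_space \<Rightarrow> real"
  assumes "pl_on P f" "pl_on P g"
  shows "pl_on P (\<lambda>x. min (f x) (g x))"
proof -
  have "pl_on P (\<lambda>x. - max (- f x) (- g x))"
    using assms by (intro pl_on_uminus pl_on_max)
  then show ?thesis
    by (rule pl_on_cong) auto
qed

lemma pl_on_Max:
  fixes f :: "'i \<Rightarrow> 'a::euclidean_space \<Rightarrow> real"
  assumes "finite I" "I \<noteq> {}" "\<And>i. i \<in> I \<Longrightarrow> pl_on P (f i)"
  shows "pl_on P (\<lambda>x. Max ((\<lambda>i. f i x) ` I))"
  using assms
proof (induction I rule: finite_ne_induct)
  case (insert i I)
  then have "pl_on P (\<lambda>x. max (f i x) (Max ((\<lambda>i. f i x) ` I)))"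
    by (intro pl_on_max) auto
  then show ?case
    using insert.hyps by simp
qed auto

lemma pl_on_Min:
  fixes f :: "'i \<Rightarrow> 'a::euclidean_space \<Rightarrow> real"
  assumes "finite I" "I \<noteq> {}" "\<And>i. i \<in> I \<Longrightarrow> pl_on P (f i)"
  shows "pl_on P (\<lambda>x. Min ((\<lambda>i. f i x) ` I))"
  using assms
proof (induction I rule: finite_ne_induct)
  case (insert i I)
  then have "pl_on P (\<lambda>x. min (f i x) (Min ((\<lambda>i. f i x) ` I)))"
    by (intro pl_on_min) auto
  then show ?case
    using insert.hyps by simp
qed auto

text \<open>
  Links the definition by polyhedral graphs with local affineness. Projecting the polytopes of the
  graph gives the affine pieces; conversely, the graph over an affine piece is a polytope.
\<close>
lemma pl_map_iff: "pl_map P Q f \<longleftrightarrow> pl_on P f \<and> polyhedral Q \<and> f ` P \<subseteq> Q"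
proof safe
  assume f: "pl_map P Q f"
  let ?\<Gamma> = "(\<lambda>x. (x, f x)) ` P"
  have cont: "continuous_on P (\<lambda>x. (x, f x))"
    using f unfolding pl_map_def by (auto intro!: continuous_intros)
  show "polyhedral Q" using f unfolding pl_map_def by blast
  show "\<And>x. x \<in> P \<Longrightarrow> f x \<in> Q" using f unfolding pl_map_def by blast
  show "pl_on P f"
    unfolding pl_on_def
  proof
    fix x assume x: "x \<in> P"
    have "polyhedral ?\<Gamma>" "(x, f x) \<in> ?\<Gamma>"
      using f x unfolding pl_map_def by blast+
    then obtain F where "polyhedral_nbhd ?\<Gamma> F (x, f x)"
      unfolding polyhedral_iff_nbhd by blast
    then obtain e where F: "finite F" "\<forall>S\<in>F. polytope S" "\<Union>F \<subseteq> ?\<Gamma>"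
      and e: "e > 0" "?\<Gamma> \<inter> ball (x, f x) e \<subseteq> \<Union>F"
      unfolding polyhedral_nbhd_def by blast
    obtain d where d: "d > 0" "\<forall>y\<in>P. dist y x < d \<longrightarrow> dist (y, f y) (x, f x) < e"
      using cont x e(1) unfolding continuous_on_iff by meson
    have "P \<inter> ball x d \<subseteq> \<Union>((`) fst ` F)"
    proof
      fix y assume y: "y \<in> P \<inter> ball x d"
      then have "(y, f y) \<in> ?\<Gamma> \<inter> ball (x, f x) e"
        using d(2) by (auto simp: dist_commute[of "(x, f x)"] dist_commute[of x])
      then obtain S where "S \<in> F" "(y, f y) \<in> S" using e(2) by blast
      then have "fst (y, f y) \<in> fst ` S" by (intro imageI)
      then show "y \<in> \<Union>((`) fst ` F)" using \<open>S \<in> F\<close> by auto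
    qed
    moreover have "\<Union>((`) fst ` F) \<subseteq> P"
      using F(3) by auto
    ultimately have "polyhedral_nbhd P ((`) fst ` F) x"
      unfolding polyhedral_nbhd_def using F(1,2) d(1)
      by (auto intro: polytope_linear_image[OF linear_fst])
    moreover have "affine_map_on f (fst ` S)" if "S \<in> F" for S
    proof (rule affine_map_on_fst_graph)
      show "convex S" using that F(2) polytope_imp_convex by blast
      show "snd s = f (fst s)" if "s \<in> S" for s
        using that \<open>S \<in> F\<close> F(3) by auto
    qed
    ultimately show "\<exists>F. polyhedral_nbhd P F x \<and> (\<forall>S\<in>F. affine_map_on f S)"
      by (intro exI[of _ "(`) fst ` F"]) simp
  qed
next
  assume f: "pl_on P f" "polyhedral Q" "f ` P \<subseteq> Q"
  let ?\<Gamma> = "(\<lambda>x. (x, f x)) ` P"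
  have "polyhedral ?\<Gamma>"
    unfolding polyhedral_iff_nbhd
  proof
    fix z assume "z \<in> ?\<Gamma>"
    then obtain x where x: "x \<in> P" "z = (x, f x)" by blast
    obtain F e where F: "finite F" "\<forall>S\<in>F. polytope S" "\<Union>F \<subseteq> P" "\<forall>S\<in>F. affine_map_on f S"
      and e: "e > 0" "P \<inter> ball x e \<subseteq> \<Union>F"
      using f x unfolding pl_on_def polyhedral_nbhd_def by meson
    have poly: "polytope ((\<lambda>x. (x, f x)) ` S)" if "S \<in> F" for S
      using F(2,4) that affine_map_on_linear[OF linear_ident, of 0 S]
      by (intro polytope_affine_image affine_map_on_Pair) simp_all
    have "?\<Gamma> \<inter> ball z e \<subseteq> \<Union>((`) (\<lambda>x. (x, f x)) ` F)"
    proof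
      fix w assume "w \<in> ?\<Gamma> \<inter> ball z e"
      then obtain y where y: "y \<in> P" "w = (y, f y)" "dist z w < e" by auto
      have "dist x y \<le> dist z w"
        using dist_fst_le[of z w] x y by simp
      then have "y \<in> P \<inter> ball x e" using y by simp
      then obtain S where "S \<in> F" "y \<in> S" using e(2) by blast
      then show "w \<in> \<Union>((`) (\<lambda>x. (x, f x)) ` F)" using y(2) by auto
    qed
    moreover have "\<Union>((`) (\<lambda>x. (x, f x)) ` F) \<subseteq> ?\<Gamma>"
      using F(3) by auto
    ultimately have "polyhedral_nbhd ?\<Gamma> ((`) (\<lambda>x. (x, f x)) ` F) z"
      unfolding polyhedral_nbhd_def using F(1) e(1) poly by auto
    then show "\<exists>F. polyhedral_nbhd ?\<Gamma> F z" ..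
  qed
  then show "pl_map P Q f"
    unfolding pl_map_def using f pl_on_imp_polyhedral[OF f(1)] pl_on_continuous[OF f(1)] by simp
qed

lemma pl_homeomorphism_iff:
  "pl_homeomorphism P Q f g \<longleftrightarrow> homeomorphism P Q f g \<and> pl_on P f \<and> pl_on Q g"
  unfolding pl_homeomorphism_def pl_map_iff
  by (auto simp: homeomorphism_def dest: pl_on_imp_polyhedral)

lemma pl_homeomorphism_restrict:
  assumes "pl_homeomorphism P Q f g" "polyhedral P'" "P' \<subseteq> P"
  shows "pl_homeomorphism P' (f ` P') f g"
proof -
  have fg: "homeomorphism P Q f g" "pl_on P f" "pl_on Q g"
    using assms(1) unfolding pl_homeomorphism_iff by auto
  have eq: "f ` P' = {y\<in>Q. g y \<in> P'}"
  proof (intro equalityI subsetI)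
    fix y assume "y \<in> f ` P'"
    then show "y \<in> {y\<in>Q. g y \<in> P'}"
      using fg(1) assms(3) homeomorphism_apply1[OF fg(1)] homeomorphism_image1[OF fg(1)] by auto
  next
    fix y assume "y \<in> {y\<in>Q. g y \<in> P'}"
    then show "y \<in> f ` P'"
      using homeomorphism_apply2[OF fg(1), of y] by (metis (mono_tags) imageI mem_Collect_eq)
  qed
  have "homeomorphism P' (f ` P') f g"
    using homeomorphism_of_subsets[OF fg(1) assms(3) order_refl] homeomorphism_image1[OF fg(1)] assms(3)
    by blast
  moreover have "pl_on P' f" using pl_on_subset fg(2) assms(2,3) by blast
  moreover have "pl_on (f ` P') g"
    using polyhedral_vimage[OF fg(3) assms(2)] unfolding eq by (intro pl_on_subset[OF fg(3)]) auto
  ultimately show ?thesis unfolding pl_homeomorphism_iff by blast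
qed

lemma pl_homeomorphism_compose:
  assumes "pl_homeomorphism P Q f g" "pl_homeomorphism Q R f' g'"
  shows "pl_homeomorphism P R (\<lambda>x. f' (f x)) (\<lambda>x. g (g' x))"
proof -
  have h: "homeomorphism P Q f g" "homeomorphism Q R f' g'"
      "pl_on P f" "pl_on Q g" "pl_on Q f'" "pl_on R g'"
    using assms unfolding pl_homeomorphism_iff by auto
  have "homeomorphism P R (f' \<circ> f) (g \<circ> g')"
    using homeomorphism_compose[OF h(1,2)] .
  moreover have "f ` P \<subseteq> Q" "g' ` R \<subseteq> Q"
    using h(1,2) unfolding homeomorphism_def by blast+
  ultimately show ?thesis
    unfolding pl_homeomorphism_iff comp_def
    using pl_on_compose[OF h(3,5)] pl_on_compose[OF h(6,4)] by blast
qed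

lemma pl_homeomorphism_sym: "pl_homeomorphism P Q f g \<Longrightarrow> pl_homeomorphism Q P g f"
  unfolding pl_homeomorphism_iff using homeomorphism_symD by blast

section \<open>Compact manifold neighbourhoods\<close>

lemma polyhedron_halfspaces:
  assumes "\<forall>T\<in>F. polyhedron T"
  obtains K :: "'a::euclidean_space set \<Rightarrow> 'a set set" and a b where
    "\<forall>T\<in>F. finite (K T)" "\<forall>T\<in>F. \<forall>x. x \<in> T \<longleftrightarrow> (\<forall>h\<in>K T. a h \<bullet> x \<le> (b h :: real))"
proof -
  have "\<forall>T\<in>F. \<exists>K. finite K \<and> T = \<Inter>K \<and> (\<forall>h\<in>K. \<exists>a b. h = {x. a \<bullet> x \<le> b})"
    using assms unfolding polyhedron_def by meson
  then obtain K where K: "\<And>T. T \<in> F \<Longrightarrow> finite (K T) \<and> T = \<Inter>(K T) \<and> (\<forall>h\<in>K T. \<exists>a b. h = {x. a \<bullet> x \<le> b})"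
    by metis
  define a where "a h = (SOME a. \<exists>b. h = {x. a \<bullet> x \<le> b})" for h :: "'a set"
  define b where "b h = (SOME b. h = {x. a h \<bullet> x \<le> b})" for h :: "'a set"
  have ab: "h = {x. a h \<bullet> x \<le> b h}" if "T \<in> F" "h \<in> K T" for T h
  proof -
    have "\<exists>a b. h = {x. a \<bullet> x \<le> b}" using K that by blast
    then have "\<exists>b. h = {x. a h \<bullet> x \<le> b}"
      unfolding a_def by (rule someI_ex)
    then show ?thesis unfolding b_def by (rule someI_ex)
  qed
  show thesis
  proof (rule that)
    show "\<forall>T\<in>F. finite (K T)" using K by blast
    show "\<forall>T\<in>F. \<forall>x. x \<in> T \<longleftrightarrow> (\<forall>h\<in>K T. a h \<bullet> x \<le> b h)"
    proof (intro ballI allI)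
      fix T x assume T: "T \<in> F"
      have "x \<in> T \<longleftrightarrow> (\<forall>h\<in>K T. x \<in> h)" using K[OF T] by blast
      also have "\<dots> \<longleftrightarrow> (\<forall>h\<in>K T. a h \<bullet> x \<le> b h)"
        using ab[OF T] by (metis mem_Collect_eq)
      finally show "x \<in> T \<longleftrightarrow> (\<forall>h\<in>K T. a h \<bullet> x \<le> b h)" .
    qed
  qed
qed

lemma finite_image_factor:
  assumes "finite (s ` A)" "\<And>x y. x \<in> A \<Longrightarrow> y \<in> A \<Longrightarrow> s x = s y \<Longrightarrow> g x = g y"
  shows "finite (g ` A)"
proof -
  have "g x = (g \<circ> inv_into A s) (s x)" if "x \<in> A" for x
    using assms(2)[OF that, of "inv_into A s (s x)"] that
    by (simp add: inv_into_into f_inv_into_f)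
  then have "g ` A = (g \<circ> inv_into A s) ` s ` A"
    unfolding image_image by (intro image_cong) auto
  then show ?thesis using assms(1) by simp
qed

text \<open>
  Take finitely many polytopes that cover a neighbourhood of \<open>p\<close> and on which \<open>G\<close> is affine, and
  consider all inequalities \<open>a \<bullet> x \<le> b\<close> that define them. Points that satisfy the same inequalities,
  and the same ones with equality, form a cell. At a point \<open>q\<close> the directions of its cell are those
  along which all equalities at \<open>q\<close> persist. Near \<open>q\<close>, a small translation in such a direction does
  not lead out of any of the polytopes. It changes \<open>G\<close> at the same rate on all those that come close
  to \<open>q\<close>, since they all contain \<open>q\<close>, where the rate can be compared.
  If this rate vanishes in all directions, then \<open>G\<close> is constant on the cell, and there are only
  finitely many cells. In any other case some direction has a nonzero rate and can be scaled to
  rate one.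
\<close>
lemma regular_direction:
  fixes G :: "'a::euclidean_space \<Rightarrow> real"
  assumes G: "pl_on Y G" and p: "p \<in> Y"
  obtains e C where "e > 0" "finite C"
    "\<forall>q\<in>Y. dist p q < e \<longrightarrow> G q \<notin> C \<longrightarrow> (\<exists>v d. d > 0 \<and>
        (\<forall>x s. x \<in> Y \<longrightarrow> dist q x < d \<longrightarrow> \<bar>s\<bar> < d \<longrightarrow> x + s *\<^sub>R v \<in> Y \<and> G (x + s *\<^sub>R v) = G x + s))"
proof -
  obtain F e where F: "finite F" "\<forall>S\<in>F. polytope S" "\<Union>F \<subseteq> Y" "\<forall>S\<in>F. affine_map_on G S"
    and e: "e > 0" "Y \<inter> ball p e \<subseteq> \<Union>F"
    using G p unfolding pl_on_def polyhedral_nbhd_def by meson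
  have "\<forall>T\<in>F. polyhedron T" using F(2) polytope_imp_polyhedron by blast
  then obtain K :: "'a set \<Rightarrow> 'a set set" and a b where K': "\<forall>T\<in>F. finite (K T)"
    "\<forall>T\<in>F. \<forall>x. x \<in> T \<longleftrightarrow> (\<forall>h\<in>K T. a h \<bullet> x \<le> (b h :: real))"
    by (rule polyhedron_halfspaces)
  have K: "finite (K T)" "x \<in> T \<longleftrightarrow> (\<forall>h\<in>K T. a h \<bullet> x \<le> b h)" if "T \<in> F" for T x
    using K' that by blast+
  obtain l c where l: "\<And>T. T \<in> F \<Longrightarrow> linear (l T)"
    and lG: "\<And>T x. T \<in> F \<Longrightarrow> x \<in> T \<Longrightarrow> G x = l T x + c T"
    using F(4) unfolding affine_map_on_def by metis
  define H where "H = \<Union>(K ` F)"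
  have finH: "finite H" unfolding H_def using F(1) K(1) by blast
  \<comment> \<open>directions of the cell of \<open>q\<close>\<close>
  define L where "L q = {v. \<forall>h\<in>H. a h \<bullet> q = b h \<longrightarrow> a h \<bullet> v = 0}" for q
  define crit where "crit = {q \<in> Y \<inter> ball p e. \<forall>v\<in>L q. \<forall>T\<in>F. q \<in> T \<longrightarrow> l T v = 0}"
  \<comment> \<open>the cell of \<open>q\<close>, encoded by the inequalities that hold and those that are tight\<close>
  define \<sigma> where "\<sigma> q = ({h\<in>H. a h \<bullet> q \<le> b h}, {h\<in>H. a h \<bullet> q = b h})" for q
  have "finite (G ` crit)"
  proof (rule finite_image_factor[of \<sigma>])
    have "\<sigma> ` crit \<subseteq> Pow H \<times> Pow H" unfolding \<sigma>_def by auto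
    then show "finite (\<sigma> ` crit)" using finH finite_subset by blast
    fix q r assume q: "q \<in> crit" "r \<in> crit" "\<sigma> q = \<sigma> r"
    obtain T where T: "T \<in> F" "q \<in> T"
      using q(1) e(2) unfolding crit_def by blast
    have le: "a h \<bullet> q \<le> b h \<longleftrightarrow> a h \<bullet> r \<le> b h" if "h \<in> H" for h
      using q(3) that unfolding \<sigma>_def by blast
    have eq: "a h \<bullet> q = b h \<longleftrightarrow> a h \<bullet> r = b h" if "h \<in> H" for h
      using q(3) that unfolding \<sigma>_def by blast
    have "K T \<subseteq> H" unfolding H_def using T(1) by blast
    then have "r \<in> T"
      using T K(2)[OF T(1)] le by blast
    have "a h \<bullet> (r - q) = 0" if "h \<in> H" "a h \<bullet> q = b h" for h
      using eq[OF that(1)] that(2) by (simp add: inner_diff_right)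
    then have "r - q \<in> L q"
      unfolding L_def by blast
    then have "l T (r - q) = 0"
      using q(1) T unfolding crit_def by blast
    then show "G q = G r"
      using lG[OF T] lG[OF T(1) \<open>r \<in> T\<close>] linear_diff[OF l[OF T(1)]] by simp
  qed
  moreover have "\<exists>v d. d > 0 \<and>
        (\<forall>x s. x \<in> Y \<longrightarrow> dist q x < d \<longrightarrow> \<bar>s\<bar> < d \<longrightarrow> x + s *\<^sub>R v \<in> Y \<and> G (x + s *\<^sub>R v) = G x + s)"
    if q: "q \<in> Y" "dist p q < e" "G q \<notin> G ` crit" for q
  proof -
    have "q \<notin> crit" using q(3) by blast
    then obtain w T0 where w: "w \<in> L q" "T0 \<in> F" "q \<in> T0" "l T0 w \<noteq> 0"
      using q unfolding crit_def by auto
    define v where "v = (1 / l T0 w) *\<^sub>R w"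
    have v: "l T0 v = 1"
      unfolding v_def using w linear_scale[OF l[OF w(2)], of _ w] by simp
    have vL: "a h \<bullet> v = 0" if "h \<in> H" "a h \<bullet> q = b h" for h
      using w(1) that unfolding v_def L_def by simp
    \<comment> \<open>here the inequalities that are strict at \<open>q\<close>, or strictly violated, remain so\<close>
    define U where "U = ball p e \<inter> (\<Inter>h\<in>{h\<in>H. a h \<bullet> q < b h}. {x. a h \<bullet> x < b h})
        \<inter> (\<Inter>h\<in>{h\<in>H. a h \<bullet> q > b h}. {x. a h \<bullet> x > b h})"
    have "open U"
      unfolding U_def using finH
      by (intro open_Int open_INT ballI open_ball open_halfspace_lt open_halfspace_gt) auto
    moreover have "q \<in> U" unfolding U_def using q by auto
    ultimately obtain r where r: "r > 0" "ball q r \<subseteq> U"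
      using openE by blast
    have move: "q \<in> T \<and> x + s *\<^sub>R v \<in> T \<and> G (x + s *\<^sub>R v) = G x + s * l T v"
      if x: "T \<in> F" "x \<in> T" "x \<in> ball q r" "x + s *\<^sub>R v \<in> ball q r" for x s T
    proof -
      have KH: "h \<in> H" if "h \<in> K T" for h
        unfolding H_def using that x(1) by blast
      have xU: "x \<in> U" "x + s *\<^sub>R v \<in> U" using x(3,4) r(2) by blast+
      have xle: "a h \<bullet> x \<le> b h" if "h \<in> K T" for h
        using that x(2) K(2)[OF x(1)] by blast
      have qle: "a h \<bullet> q \<le> b h" if h: "h \<in> K T" for h
      proof (rule ccontr)
        assume "\<not> a h \<bullet> q \<le> b h"
        then have "a h \<bullet> x > b h"
          using xU(1) KH[OF h] unfolding U_def by auto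
        then show False using xle[OF h] by simp
      qed
      have "a h \<bullet> (x + s *\<^sub>R v) \<le> b h" if h: "h \<in> K T" for h
      proof (cases "a h \<bullet> q = b h")
        case True
        then show ?thesis
          using vL[OF KH[OF h]] xle[OF h] by (simp add: inner_add_right)
      next
        case False
        then have "a h \<bullet> q < b h" using qle[OF h] by simp
        then have "a h \<bullet> (x + s *\<^sub>R v) < b h"
          using xU(2) KH[OF h] unfolding U_def by blast
        then show ?thesis by simp
      qed
      then have "x + s *\<^sub>R v \<in> T" "q \<in> T"
        using qle K(2)[OF x(1)] by blast+
      then show ?thesis
        using lG[OF x(1)] x(2) linear_add[OF l[OF x(1)]] linear_scale[OF l[OF x(1)]] by simp
    qed
    \<comment> \<open>so that moving a point at distance less than \<open>d\<close> by less than \<open>d\<close> times \<open>v\<close> stays in the ball of radius \<open>r\<close>\<close>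
    define d where "d = r / (2 * (1 + norm v))"
    have d0: "d > 0" unfolding d_def using r(1) by (simp add: add_pos_nonneg)
    have "d * (2 * (1 + norm v)) = r"
      unfolding d_def by (simp add: add_nonneg_eq_0_iff)
    then have dr: "d + d * norm v < r"
      using r(1) by (simp add: algebra_simps)
    have near: "x \<in> ball q r" "x + s *\<^sub>R v \<in> ball q r" if "dist q x < d" "\<bar>s\<bar> < d" for x s
    proof -
      have "\<bar>s\<bar> * norm v \<le> d * norm v" using that(2) by (intro mult_right_mono) auto
      moreover have "dist q (x + s *\<^sub>R v) \<le> dist q x + \<bar>s\<bar> * norm v"
        using dist_triangle[of q "x + s *\<^sub>R v" x] by (simp add: dist_norm)
      moreover have "0 \<le> d * norm v" using d0 by simp
      ultimately show "x \<in> ball q r" "x + s *\<^sub>R v \<in> ball q r"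
        using that(1) dr by auto
    qed
    have slope: "l T v = 1" if T: "T \<in> F" "q \<in> T" for T
    proof -
      have "q \<in> ball q r" "q + (d/2) *\<^sub>R v \<in> ball q r"
        using near[of q "d/2"] d0 r(1) by auto
      then have "G q + (d/2) * l T v = G q + (d/2) * l T0 v"
        using move[OF T] move[OF w(2,3)] by metis
      then show ?thesis using v d0 by simp
    qed
    show ?thesis
    proof (intro exI[of _ v] exI[of _ d] conjI allI impI d0)
      fix x s assume x: "x \<in> Y" "dist q x < d" "\<bar>s\<bar> < d"
      have "x \<in> ball q r" "x + s *\<^sub>R v \<in> ball q r" using near x by blast+
      moreover have "x \<in> Y \<inter> ball p e"
        using x(1) calculation(1) r(2) unfolding U_def by blast
      then obtain T where T: "T \<in> F" "x \<in> T" using e(2) by blast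
      ultimately have "q \<in> T \<and> x + s *\<^sub>R v \<in> T \<and> G (x + s *\<^sub>R v) = G x + s * l T v"
        using move[OF T] by blast
      then show "x + s *\<^sub>R v \<in> Y" "G (x + s *\<^sub>R v) = G x + s"
        using slope[OF T(1)] T(1) F(3) by auto
    qed
  qed
  ultimately show thesis
    using that[of e "G ` crit"] e(1) by blast
qed

text \<open>
  The map adds to \<open>x\<close> the multiple \<open>\<eta> x\<close> of \<open>v\<close>, where \<open>\<eta>\<close> is the difference between \<open>G\<close> and the
  affine function that agrees with \<open>G\<close> at \<open>q\<close>, has slope one along \<open>v\<close> and is constant in the
  orthogonal directions. Since \<open>\<eta>\<close> does not change along \<open>v\<close>, subtracting the same multiple is the
  inverse, and the height of the image of \<open>x\<close> above the level of \<open>q\<close> is \<open>G x - G q\<close>.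
\<close>
lemma straighten_level:
  fixes G :: "'a::euclidean_space \<Rightarrow> real"
  assumes G: "pl_on Y G" and q: "q \<in> Y" and d: "d > 0"
    and move: "\<And>x s. \<lbrakk>x \<in> Y; dist q x < d; \<bar>s\<bar> < d\<rbrakk> \<Longrightarrow> x + s *\<^sub>R v \<in> Y \<and> G (x + s *\<^sub>R v) = G x + s"
  obtains W W' \<Psi> \<Psi>' where "openin (top_of_set Y) W" "openin (top_of_set Y) W'" "q \<in> W"
    "pl_homeomorphism W W' \<Psi> \<Psi>'" "\<Psi> q = q" "\<forall>x\<in>W. G x \<le> G q \<longleftrightarrow> 0 \<le> (-v) \<bullet> (\<Psi> x - q)"
proof -
  have v0: "v \<noteq> 0"
    using move[OF q, of "d/2"] d by auto
  define \<eta> where "\<eta> x = G x - G q - ((1 / (v \<bullet> v)) *\<^sub>R v) \<bullet> (x - q)" for x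
  have Y: "polyhedral Y" using G pl_on_imp_polyhedral by blast
  have \<eta>pl: "pl_on Y \<eta>"
    unfolding \<eta>_def inner_diff_right
    by (intro pl_on_diff G pl_on_const pl_on_inner Y)
  have \<eta>inv: "\<eta> (x + s *\<^sub>R v) = \<eta> x" if "x \<in> Y" "dist q x < d" "\<bar>s\<bar> < d" for x s
    using move[OF that] v0 by (simp add: \<eta>_def inner_add_right inner_diff_right algebra_simps)
  \<comment> \<open>domain of the map (\<open>\<tau> = 1\<close>) and of its inverse (\<open>\<tau> = -1\<close>); both are open, which makes the image open\<close>
  define D where "D = (\<lambda>\<tau>. {x\<in>Y. x \<in> ball q d \<and> \<eta> x \<in> {-d<..<d} \<and> x + (\<tau> * \<eta> x) *\<^sub>R v \<in> ball q d})"
  have pl: "pl_on Y (\<lambda>x. x + (\<tau> * \<eta> x) *\<^sub>R v)" for \<tau>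
    using pl_on_add[OF pl_on_id[OF Y] pl_on_scaleR_const[OF \<eta>pl, of "\<tau> *\<^sub>R v"]]
    by (simp add: mult.commute)
  have op: "openin (top_of_set Y) (D \<tau>)" for \<tau>
  proof -
    have "D \<tau> = (Y \<inter> ball q d) \<inter> (Y \<inter> \<eta> -` {-d<..<d}) \<inter> (Y \<inter> (\<lambda>x. x + (\<tau> * \<eta> x) *\<^sub>R v) -` ball q d)"
      unfolding D_def by auto
    moreover have "openin (top_of_set Y) (Y \<inter> \<eta> -` {-d<..<d})"
      by (rule continuous_openin_preimage_gen[OF pl_on_continuous[OF \<eta>pl]]) simp
    moreover have "openin (top_of_set Y) (Y \<inter> (\<lambda>x. x + (\<tau> * \<eta> x) *\<^sub>R v) -` ball q d)"
      by (rule continuous_openin_preimage_gen[OF pl_on_continuous[OF pl]]) simp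
    ultimately show ?thesis
      by (simp add: openin_Int openin_open_Int)
  qed
  have maps: "x + (\<tau> * \<eta> x) *\<^sub>R v \<in> D (-\<tau>) \<and> \<eta> (x + (\<tau> * \<eta> x) *\<^sub>R v) = \<eta> x"
    if x: "x \<in> D \<tau>" "\<bar>\<tau>\<bar> = 1" for x \<tau>
  proof -
    have s: "\<bar>\<tau> * \<eta> x\<bar> < d" "x \<in> Y" "dist q x < d"
      using x unfolding D_def by (auto simp: abs_mult)
    then show ?thesis
      using move[OF s(2,3,1)] \<eta>inv[OF s(2,3,1)] x unfolding D_def by auto
  qed
  have "homeomorphism (D 1) (D (-1)) (\<lambda>x. x + (1 * \<eta> x) *\<^sub>R v) (\<lambda>x. x + ((-1) * \<eta> x) *\<^sub>R v)"
  proof (rule homeomorphismI)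
    show "continuous_on (D 1) (\<lambda>x. x + (1 * \<eta> x) *\<^sub>R v)"
      by (rule continuous_on_subset[OF pl_on_continuous[OF pl]]) (auto simp: D_def)
    show "continuous_on (D (-1)) (\<lambda>x. x + ((-1) * \<eta> x) *\<^sub>R v)"
      by (rule continuous_on_subset[OF pl_on_continuous[OF pl]]) (auto simp: D_def)
  qed (use maps[of _ 1] maps[of _ "-1"] in auto)
  then have hom: "pl_homeomorphism (D 1) (D (-1)) (\<lambda>x. x + (1 * \<eta> x) *\<^sub>R v) (\<lambda>x. x + ((-1) * \<eta> x) *\<^sub>R v)"
    unfolding pl_homeomorphism_iff
    using pl_on_subset[OF pl] polyhedral_openin[OF op Y] openin_imp_subset[OF op] by blast
  have \<eta>q: "\<eta> q = 0" unfolding \<eta>_def by simp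
  show thesis
  proof (rule that[OF op op _ hom])
    show "q \<in> D 1" unfolding D_def using q d \<eta>q by auto
    show "q + (1 * \<eta> q) *\<^sub>R v = q" using \<eta>q by simp
    have "G x \<le> G q \<longleftrightarrow> 0 \<le> (-v) \<bullet> (x + (1 * \<eta> x) *\<^sub>R v - q)" for x
    proof -
      have "v \<bullet> (x + \<eta> x *\<^sub>R v - q) = (G x - G q) * (v \<bullet> v)"
      using v0 unfolding \<eta>_def by (simp add: inner_diff_right inner_add_right field_simps)
    moreover have "(G x - G q) * (v \<bullet> v) \<le> 0 \<longleftrightarrow> G x - G q \<le> 0"
    proof -
      have "t * k \<le> 0 \<longleftrightarrow> t \<le> 0" if "k > 0" for t k :: real
        using that by (simp add: mult_le_0_iff)
      then show ?thesis using inner_gt_zero_iff[of v] v0 by blast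
    qed
    ultimately show ?thesis
      by simp
    qed
    then show "\<forall>x\<in>D 1. G x \<le> G q \<longleftrightarrow> 0 \<le> (-v) \<bullet> (x + (1 * \<eta> x) *\<^sub>R v - q)" by blast
  qed
qed

text \<open>
  In the coordinates \<open>a\<close> and \<open>b\<close> along \<open>n\<close> and \<open>m\<close> this is the homeomorphism
  \<open>(a, b) \<mapsto> (min a b, a - b)\<close> of the plane, with inverse \<open>(a, b) \<mapsto> (a + max 0 b, a + max 0 (-b))\<close>.
  The quadrant is where \<open>min a b\<close> is nonnegative.
\<close>
lemma corner_to_halfspace:
  fixes n m :: "'e::euclidean_space"
  assumes "n \<noteq> 0" "m \<noteq> 0" "n \<bullet> m = 0"
  obtains \<Theta> \<Theta>' where "pl_homeomorphism UNIV UNIV \<Theta> \<Theta>'"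
    "\<And>y. 0 \<le> n \<bullet> y \<and> 0 \<le> m \<bullet> y \<longleftrightarrow> 0 \<le> n \<bullet> \<Theta> y"
proof -
  define a where "a y = ((1 / (n \<bullet> n)) *\<^sub>R n) \<bullet> y" for y
  define b where "b y = ((1 / (m \<bullet> m)) *\<^sub>R m) \<bullet> y" for y
  have U: "polyhedral (UNIV :: 'e set)" by (simp add: open_imp_polyhedral)
  have pl: "pl_on UNIV a" "pl_on UNIV b"
    unfolding a_def b_def by (intro pl_on_inner U)+
  define \<Theta> where "\<Theta> y = y + (min (a y) (b y) - a y) *\<^sub>R n + (a y - b y - b y) *\<^sub>R m" for y
  define \<Theta>' where "\<Theta>' z = z + (max 0 (b z)) *\<^sub>R n + (a z + max 0 (- b z) - b z) *\<^sub>R m" for z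
  have ab: "a (y + s *\<^sub>R n + t *\<^sub>R m) = a y + s" "b (y + s *\<^sub>R n + t *\<^sub>R m) = b y + t" for y s t
    using assms unfolding a_def b_def by (simp_all add: inner_add_right inner_commute field_simps)
  have "pl_on UNIV \<Theta>" "pl_on UNIV \<Theta>'"
    unfolding \<Theta>_def \<Theta>'_def
    by (intro pl_on_add pl_on_scaleR_const pl_on_diff pl_on_min pl_on_max pl_on_uminus pl pl_on_id
        pl_on_const U)+
  moreover have "\<Theta>' (\<Theta> y) = y" for y
  proof -
    have "a (\<Theta> y) = min (a y) (b y)" "b (\<Theta> y) = a y - b y"
      unfolding \<Theta>_def ab by simp_all
    then have "\<Theta>' (\<Theta> y) = \<Theta> y + max 0 (a y - b y) *\<^sub>R n
        + (min (a y) (b y) + max 0 (- (a y - b y)) - (a y - b y)) *\<^sub>R m"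
      by (simp only: \<Theta>'_def[of "\<Theta> y"])
    also have "\<dots> = y + ((min (a y) (b y) - a y) + max 0 (a y - b y)) *\<^sub>R n
        + ((a y - b y - b y) + (min (a y) (b y) + max 0 (- (a y - b y)) - (a y - b y))) *\<^sub>R m"
      unfolding \<Theta>_def by (simp only: scaleR_add_left add_ac)
    also have "(min (a y) (b y) - a y) + max 0 (a y - b y) = 0" by simp
    also have "(a y - b y - b y) + (min (a y) (b y) + max 0 (- (a y - b y)) - (a y - b y)) = 0" by simp
    finally show ?thesis by simp
  qed
  moreover have "\<Theta> (\<Theta>' y) = y" for y
  proof -
    have "a (\<Theta>' y) = a y + max 0 (b y)" "b (\<Theta>' y) = a y + max 0 (- b y)"
      unfolding \<Theta>'_def ab by simp_all
    then have "\<Theta> (\<Theta>' y) = \<Theta>' y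
        + (min (a y + max 0 (b y)) (a y + max 0 (- b y)) - (a y + max 0 (b y))) *\<^sub>R n
        + (a y + max 0 (b y) - (a y + max 0 (- b y)) - (a y + max 0 (- b y))) *\<^sub>R m"
      by (simp only: \<Theta>_def[of "\<Theta>' y"])
    also have "\<dots> = y + (max 0 (b y) + (min (a y + max 0 (b y)) (a y + max 0 (- b y)) - (a y + max 0 (b y)))) *\<^sub>R n
        + ((a y + max 0 (- b y) - b y) + (a y + max 0 (b y) - (a y + max 0 (- b y)) - (a y + max 0 (- b y)))) *\<^sub>R m"
      unfolding \<Theta>'_def by (simp only: scaleR_add_left add_ac)
    also have "max 0 (b y) + (min (a y + max 0 (b y)) (a y + max 0 (- b y)) - (a y + max 0 (b y))) = 0" by simp
    also have "(a y + max 0 (- b y) - b y) + (a y + max 0 (b y) - (a y + max 0 (- b y)) - (a y + max 0 (- b y))) = 0" by simp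
    finally show ?thesis by simp
  qed
  ultimately have "pl_homeomorphism UNIV UNIV \<Theta> \<Theta>'"
    unfolding pl_homeomorphism_iff by (auto intro!: homeomorphismI pl_on_continuous)
  moreover have "0 \<le> n \<bullet> y \<and> 0 \<le> m \<bullet> y \<longleftrightarrow> 0 \<le> n \<bullet> \<Theta> y" for y
  proof -
    have "a (\<Theta> y) = min (a y) (b y)"
      unfolding \<Theta>_def ab by simp
    moreover have "0 \<le> a x \<longleftrightarrow> 0 \<le> n \<bullet> x" "0 \<le> b x \<longleftrightarrow> 0 \<le> m \<bullet> x" for x
    proof -
      have *: "0 \<le> t / k \<longleftrightarrow> 0 \<le> t" if "k > 0" for t k :: real
        using that by (simp add: zero_le_divide_iff)
      show "0 \<le> a x \<longleftrightarrow> 0 \<le> n \<bullet> x" "0 \<le> b x \<longleftrightarrow> 0 \<le> m \<bullet> x"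
        using *[of "n \<bullet> n"] *[of "m \<bullet> m"] assms(1,2) unfolding a_def b_def by simp_all
    qed
    ultimately show ?thesis by (metis min_le_iff_disj min.bounded_iff)
  qed
  ultimately show thesis using that by blast
qed

lemma pl_homeomorphism_translation:
  "pl_homeomorphism UNIV UNIV (\<lambda>x. x - q) (\<lambda>x. x + q)"
  unfolding pl_homeomorphism_iff
  using pl_on_affine[OF open_imp_polyhedral[OF open_UNIV] linear_ident, of q]
    pl_on_affine[OF open_imp_polyhedral[OF open_UNIV] linear_ident, of "-q"]
  by (auto intro!: homeomorphismI pl_on_continuous)

lemma pl_homeomorphism_compose_UNIV:
  assumes "pl_homeomorphism P Q f g" "pl_homeomorphism UNIV UNIV f' g'"
  shows "pl_homeomorphism P (f' ` Q) (\<lambda>x. f' (f x)) (\<lambda>x. g (g' x))"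
proof -
  have "polyhedral Q"
    using assms(1) pl_on_imp_polyhedral unfolding pl_homeomorphism_iff by blast
  from pl_homeomorphism_compose[OF assms(1) pl_homeomorphism_restrict[OF assms(2) this]]
  show ?thesis by simp
qed

lemma pl_chart_mono:
  assumes "pl_chart M U \<phi>" "openin (top_of_set M) V" "V \<subseteq> U" "V \<subseteq> Q" "Q \<subseteq> M"
  shows "pl_chart Q V \<phi>"
proof -
  obtain \<psi> where \<psi>: "pl_homeomorphism U (\<phi> ` U) \<phi> \<psi>"
    and alt: "open (\<phi> ` U) \<or> (\<exists>v. v \<noteq> 0 \<and> openin (top_of_set {y. 0 \<le> v \<bullet> y}) (\<phi> ` U))"
    and U: "openin (top_of_set M) U"
    using assms(1) unfolding pl_chart_def by blast
  have "openin (top_of_set U) V"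
    using assms(2,3) openin_imp_subset[OF U] openin_subset_trans by blast
  moreover have "homeomorphism U (\<phi> ` U) \<phi> \<psi>" "polyhedral U"
    using \<psi> pl_on_imp_polyhedral unfolding pl_homeomorphism_iff by blast+
  ultimately have V: "openin (top_of_set (\<phi> ` U)) (\<phi> ` V)" "polyhedral V"
    using homeomorphism_imp_open_map polyhedral_openin by blast+
  have "open (\<phi> ` V) \<or> (\<exists>v. v \<noteq> 0 \<and> openin (top_of_set {y. 0 \<le> v \<bullet> y}) (\<phi> ` V))"
    using alt V(1) openin_open_trans openin_trans by blast
  moreover have "openin (top_of_set Q) V"
    using assms(2,4,5) openin_subset_trans by blast
  ultimately show ?thesis
    unfolding pl_chart_def using pl_homeomorphism_restrict[OF \<psi> V(2) assms(3)] by blast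
qed

lemma pl_manifold_openin:
  assumes "pl_manifold (d :: 'e::euclidean_space itself) M" "openin (top_of_set M) V" "x \<in> V" "V \<subseteq> Q" "Q \<subseteq> M"
  shows "\<exists>U (\<phi> :: 'a::euclidean_space \<Rightarrow> 'e). x \<in> U \<and> pl_chart Q U \<phi>"
proof -
  obtain U and \<phi> :: "'a \<Rightarrow> 'e" where U: "x \<in> U" "pl_chart M U \<phi>"
    using assms openin_imp_subset unfolding pl_manifold_def by blast
  have "openin (top_of_set M) (U \<inter> V)"
    using U(2) assms(2) unfolding pl_chart_def by blast
  then show ?thesis
    using pl_chart_mono[OF U(2), of "U \<inter> V" Q] U(1) assms(3-5) by blast
qed

text \<open>
  The second case of \<open>Z\<close> is a chart at the boundary of \<open>M\<close>. There the normals \<open>n\<close> and \<open>m\<close> of the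
  boundary and of the level are orthogonal, so that the two half-spaces meet in a corner.
\<close>
lemma halfspace_sublevel_chart:
  fixes f :: "'a::euclidean_space \<Rightarrow> 'e::euclidean_space"
  assumes "polyhedral Q" and U: "openin (top_of_set M) U" and f: "pl_homeomorphism U Z f f'"
    and Q: "Q \<subseteq> M" "\<And>x. x \<in> U \<Longrightarrow> x \<in> Q \<longleftrightarrow> 0 \<le> m \<bullet> f x" and "m \<noteq> 0"
    and Z: "open Z \<or> (\<exists>n Ob. n \<noteq> 0 \<and> n \<bullet> m = 0 \<and> open Ob \<and> Z = Ob \<inter> {y. 0 \<le> n \<bullet> y})"
  shows "\<exists>\<phi> :: 'a \<Rightarrow> 'e. pl_chart Q (U \<inter> Q) \<phi>"
proof -
  have op: "openin (top_of_set Q) (U \<inter> Q)"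
  proof -
    obtain Ob where "open Ob" "U = M \<inter> Ob"
      using U unfolding openin_open by blast
    then have "U \<inter> Q = Q \<inter> Ob" using Q(1) by blast
    then show ?thesis using \<open>open Ob\<close> by (simp add: openin_open_Int)
  qed
  then have poly: "polyhedral (U \<inter> Q)"
    using assms(1) polyhedral_openin by blast
  have fZ: "f ` U = Z" using f unfolding pl_homeomorphism_iff homeomorphism_def by blast
  have fUQ: "f ` (U \<inter> Q) = Z \<inter> {y. 0 \<le> m \<bullet> y}"
    using Q(2) fZ by auto
  show ?thesis
    using Z
  proof (elim disjE exE conjE)
    assume "open Z"
    then have "openin (top_of_set {y. 0 \<le> m \<bullet> y}) (f ` (U \<inter> Q))"
      unfolding fUQ using openin_open_Int[of Z "{y. 0 \<le> m \<bullet> y}"] by (simp add: Int_commute)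
    then show ?thesis
      unfolding pl_chart_def
      using op pl_homeomorphism_restrict[OF f poly] \<open>m \<noteq> 0\<close> by blast
  next
    fix n Ob assume n: "n \<noteq> 0" "n \<bullet> m = 0" "open Ob" "Z = Ob \<inter> {y. 0 \<le> n \<bullet> y}"
    obtain \<Theta> \<Theta>' where \<Theta>: "pl_homeomorphism UNIV UNIV \<Theta> \<Theta>'"
      "\<And>y. 0 \<le> n \<bullet> y \<and> 0 \<le> m \<bullet> y \<longleftrightarrow> 0 \<le> n \<bullet> \<Theta> y"
      using corner_to_halfspace[OF n(1) \<open>m \<noteq> 0\<close> n(2)] by metis
    have hom: "homeomorphism UNIV UNIV \<Theta> \<Theta>'"
      using \<Theta>(1) unfolding pl_homeomorphism_iff by blast
    have "open (\<Theta> ` Ob)"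
      using homeomorphism_imp_open_map[OF hom, of Ob] n(3) by simp
    moreover have "\<Theta> ` (f ` (U \<inter> Q)) = \<Theta> ` Ob \<inter> {y. 0 \<le> n \<bullet> y}"
    proof (intro equalityI subsetI)
      fix z assume "z \<in> \<Theta> ` (f ` (U \<inter> Q))"
      then obtain y where "z = \<Theta> y" "y \<in> Z" "0 \<le> m \<bullet> y" unfolding fUQ by blast
      then show "z \<in> \<Theta> ` Ob \<inter> {y. 0 \<le> n \<bullet> y}"
        using \<Theta>(2)[of y] unfolding n(4) by blast
    next
      fix z assume "z \<in> \<Theta> ` Ob \<inter> {y. 0 \<le> n \<bullet> y}"
      then obtain y where "z = \<Theta> y" "y \<in> Ob" "0 \<le> n \<bullet> \<Theta> y" by blast
      then show "z \<in> \<Theta> ` (f ` (U \<inter> Q))"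
        using \<Theta>(2)[of y] unfolding fUQ n(4) by blast
    qed
    ultimately have "openin (top_of_set {y. 0 \<le> n \<bullet> y}) ((\<lambda>x. \<Theta> (f x)) ` (U \<inter> Q))"
      using openin_open_Int[of "\<Theta> ` Ob" "{y. 0 \<le> n \<bullet> y}"] by (simp add: Int_commute image_image)
    moreover have "pl_homeomorphism (U \<inter> Q) ((\<lambda>x. \<Theta> (f x)) ` (U \<inter> Q)) (\<lambda>x. \<Theta> (f x)) (\<lambda>x. f' (\<Theta>' x))"
      using pl_homeomorphism_restrict[OF pl_homeomorphism_compose_UNIV[OF f \<Theta>(1)] poly] by simp
    ultimately show ?thesis
      unfolding pl_chart_def using op n(1) by blast
  qed
qed

text \<open>
  Read \<open>g\<close> in a chart around \<open>z\<close>, and straighten its level through \<open>w\<close>. If \<open>w\<close> corresponds to a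
  boundary point of a half-space, then the direction of straightening is tangent to the boundary,
  because small translations in both senses keep the point in the half-space.
\<close>
lemma regular_sublevel_chart:
  fixes g :: "'a::euclidean_space \<Rightarrow> real"
  assumes M: "pl_manifold (TYPE('e::euclidean_space)) M" and g: "pl_on M g" and z: "z \<in> M"
  obtains e C where "e > 0" "finite C"
    "\<And>w. \<lbrakk>w \<in> M; dist z w < e; g w \<notin> C\<rbrakk> \<Longrightarrow> \<exists>U (\<phi> :: 'a \<Rightarrow> 'e). w \<in> U \<and> pl_chart {x\<in>M. g x \<le> g w} U \<phi>"
proof -
  obtain U and \<phi> :: "'a \<Rightarrow> 'e" where U: "z \<in> U" "pl_chart M U \<phi>"
    using M z unfolding pl_manifold_def by blast
  define Y where "Y = \<phi> ` U"
  obtain \<psi> where \<phi>: "pl_homeomorphism U Y \<phi> \<psi>"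
    and Yalt: "open Y \<or> (\<exists>n. n \<noteq> 0 \<and> openin (top_of_set {y. 0 \<le> n \<bullet> y}) Y)"
    and opU: "openin (top_of_set M) U"
    using U(2) unfolding pl_chart_def Y_def by blast
  have hom: "homeomorphism U Y \<phi> \<psi>" and pl: "pl_on U \<phi>" "pl_on Y \<psi>"
    using \<phi> unfolding pl_homeomorphism_iff by auto
  have UM: "U \<subseteq> M" using opU openin_imp_subset by blast
  have \<psi>Y: "\<psi> ` Y \<subseteq> M" using hom UM unfolding homeomorphism_def by blast
  have G: "pl_on Y (\<lambda>y. g (\<psi> y))"
    using pl_on_compose[OF pl(2) g \<psi>Y] .
  have "\<phi> z \<in> Y" unfolding Y_def using U(1) by blast
  then obtain e C where e: "e > 0" "finite C"
    and dir: "\<forall>q\<in>Y. dist (\<phi> z) q < e \<longrightarrow> g (\<psi> q) \<notin> C \<longrightarrow> (\<exists>v d. d > 0 \<and>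
        (\<forall>x s. x \<in> Y \<longrightarrow> dist q x < d \<longrightarrow> \<bar>s\<bar> < d \<longrightarrow> x + s *\<^sub>R v \<in> Y \<and> g (\<psi> (x + s *\<^sub>R v)) = g (\<psi> x) + s))"
    by (rule regular_direction[OF G])
  have "openin (top_of_set U) (U \<inter> \<phi> -` ball (\<phi> z) e)"
    using homeomorphism_cont1[OF hom] by (intro continuous_openin_preimage_gen) auto
  then have "openin (top_of_set M) (U \<inter> \<phi> -` ball (\<phi> z) e)"
    using opU openin_trans by blast
  moreover have "z \<in> U \<inter> \<phi> -` ball (\<phi> z) e" using U(1) e(1) by simp
  ultimately obtain e' where e': "e' > 0" "ball z e' \<inter> M \<subseteq> U \<inter> \<phi> -` ball (\<phi> z) e"
    by (meson openin_contains_ball)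
  have "\<exists>U (\<phi> :: 'a \<Rightarrow> 'e). w \<in> U \<and> pl_chart {x\<in>M. g x \<le> g w} U \<phi>"
    if w: "w \<in> M" "dist z w < e'" "g w \<notin> C" for w
  proof -
    have wU: "w \<in> U" "dist (\<phi> z) (\<phi> w) < e" using e'(2) w(1,2) by auto
    define q where "q = \<phi> w"
    have q: "q \<in> Y" "\<psi> q = w" unfolding q_def Y_def
      using wU(1) homeomorphism_apply1[OF hom] by auto
    have "dist (\<phi> z) q < e" "g (\<psi> q) \<notin> C" using wU(2) w(3) q(2) unfolding q_def by auto
    then obtain v d where d: "d > 0" and move': "\<forall>x s. x \<in> Y \<longrightarrow> dist q x < d \<longrightarrow> \<bar>s\<bar> < d \<longrightarrow>
        x + s *\<^sub>R v \<in> Y \<and> g (\<psi> (x + s *\<^sub>R v)) = g (\<psi> x) + s"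
      using dir q(1) by meson
    have move: "x + s *\<^sub>R v \<in> Y \<and> g (\<psi> (x + s *\<^sub>R v)) = g (\<psi> x) + s"
      if "x \<in> Y" "dist q x < d" "\<bar>s\<bar> < d" for x s
      using move' that by blast
    obtain W W' \<Psi> \<Psi>' where W: "openin (top_of_set Y) W" "openin (top_of_set Y) W'" "q \<in> W"
      and \<Psi>: "pl_homeomorphism W W' \<Psi> \<Psi>'" "\<Psi> q = q"
        "\<forall>x\<in>W. g (\<psi> x) \<le> g (\<psi> q) \<longleftrightarrow> 0 \<le> (-v) \<bullet> (\<Psi> x - q)"
      by (rule straighten_level[OF G q(1) d move])
    have v0: "- v \<noteq> 0"
      using move[OF q(1), of "d/2"] d by auto
    let ?Q = "{x\<in>M. g x \<le> g w}"
    have polyQ: "polyhedral ?Q"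
      using polyhedral_vimage[OF g polyhedron_imp_polyhedral[OF polyhedron_halfspace_le[of 1 "g w"]]] by simp
    \<comment> \<open>the straightened chart, centred at the origin, on the part of the domain that goes to Z\<close>
    have chart: "\<exists>U (\<phi> :: 'a \<Rightarrow> 'e). w \<in> U \<and> pl_chart ?Q U \<phi>"
      if Z: "openin (top_of_set W') Z" "q \<in> Z" and Zalt: "open Z \<or> (\<exists>n Ob. n \<noteq> 0 \<and> n \<bullet> v = 0 \<and> n \<bullet> q = 0 \<and> open Ob \<and> Z = Ob \<inter> {y. 0 \<le> n \<bullet> y})"
      for Z
    proof -
      have \<Psi>h: "homeomorphism W W' \<Psi> \<Psi>'" and WY: "W \<subseteq> Y" "polyhedral W"
        using \<Psi>(1) openin_imp_subset[OF W(1)] pl_on_imp_polyhedral unfolding pl_homeomorphism_iff by blast+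
      have ZW: "Z \<subseteq> W'" using Z(1) openin_imp_subset by blast
      define A where "A = \<Psi>' ` Z"
      have A: "openin (top_of_set W) A" "\<Psi> ` A = Z"
      proof -
        have \<Psi>h': "homeomorphism W' W \<Psi>' \<Psi>" using \<Psi>h homeomorphism_symD by blast
        show "openin (top_of_set W) A"
          unfolding A_def using homeomorphism_imp_open_map[OF \<Psi>h' Z(1)] .
        show "\<Psi> ` A = Z" unfolding A_def image_image
          using ZW homeomorphism_apply2[OF \<Psi>h] by force
      qed
      have AW: "A \<subseteq> W" using A(1) openin_imp_subset by blast
      have "openin (top_of_set Y) A" using A(1) W(1) openin_trans by blast
      define B where "B = \<psi> ` A"
      have \<psi>h: "homeomorphism Y U \<psi> \<phi>" using hom homeomorphism_symD by blast
      have B: "openin (top_of_set M) B" "\<phi> ` B = A"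
      proof -
        show "openin (top_of_set M) B"
          unfolding B_def using homeomorphism_imp_open_map[OF \<psi>h \<open>openin (top_of_set Y) A\<close>] opU openin_trans by blast
        show "\<phi> ` B = A" unfolding B_def image_image
          using AW WY homeomorphism_apply2[OF hom] by force
      qed
      have BU: "B \<subseteq> U" unfolding B_def using AW WY(1) \<psi>h homeomorphism_image1 by blast
      have polyAB: "polyhedral A" "polyhedral B"
        using A(1) B(1) polyhedral_openin WY(2) pl_on_imp_polyhedral[OF g] by blast+
      have "pl_homeomorphism B A \<phi> \<psi>"
        using pl_homeomorphism_restrict[OF \<phi> polyAB(2) BU] B(2) by simp
      moreover have "pl_homeomorphism A Z \<Psi> \<Psi>'"
        using pl_homeomorphism_restrict[OF \<Psi>(1) polyAB(1) AW] A(2) by simp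
      ultimately have "pl_homeomorphism B Z (\<lambda>x. \<Psi> (\<phi> x)) (\<lambda>x. \<psi> (\<Psi>' x))"
        by (rule pl_homeomorphism_compose)
      from pl_homeomorphism_compose_UNIV[OF this pl_homeomorphism_translation]
      have homB: "pl_homeomorphism B ((\<lambda>x. x - q) ` Z) (\<lambda>x. \<Psi> (\<phi> x) - q) (\<lambda>x. \<psi> (\<Psi>' (x + q)))" .
      have "\<exists>\<phi> :: 'a \<Rightarrow> 'e. pl_chart ?Q (B \<inter> ?Q) \<phi>"
      proof (rule halfspace_sublevel_chart[OF polyQ B(1) homB _ _ v0])
        show "x \<in> ?Q \<longleftrightarrow> 0 \<le> - v \<bullet> (\<Psi> (\<phi> x) - q)" if x: "x \<in> B" for x
        proof -
          have "\<phi> x \<in> W" "\<psi> (\<phi> x) = x" "x \<in> M"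
            using x B(2) AW BU UM homeomorphism_apply1[OF hom] by blast+
          then show ?thesis using bspec[OF \<Psi>(3), of "\<phi> x"] q(2) by simp
        qed
        show "open ((\<lambda>x. x - q) ` Z) \<or> (\<exists>n Ob. n \<noteq> 0 \<and> n \<bullet> - v = 0 \<and> open Ob \<and>
            (\<lambda>x. x - q) ` Z = Ob \<inter> {y. 0 \<le> n \<bullet> y})"
          using Zalt
        proof (elim disjE exE conjE)
          assume "open Z"
          then show ?thesis by (simp add: open_translation_subtract)
        next
          fix n Ob assume n: "n \<noteq> 0" "n \<bullet> v = 0" "n \<bullet> q = 0" "open Ob" "Z = Ob \<inter> {y. 0 \<le> n \<bullet> y}"
          have "(\<lambda>x. x - q) ` Z = (\<lambda>x. x - q) ` Ob \<inter> {y. 0 \<le> n \<bullet> y}"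
            unfolding n(5) using n(3) by (auto simp: inner_diff_right)
          moreover have "open ((\<lambda>x. x - q) ` Ob)" using n(4) by (simp add: open_translation_subtract)
          ultimately show ?thesis using n(1,2) by (intro disjI2 exI[of _ n] exI[of _ "(\<lambda>x. x - q) ` Ob"]) simp
        qed
      qed auto
      moreover have "w \<in> B \<inter> ?Q"
      proof -
        have "\<Psi>' q = q" using homeomorphism_apply1[OF \<Psi>h W(3)] \<Psi>(2) by simp
        then have "q \<in> A" unfolding A_def using Z(2) by force
        then have "\<psi> q \<in> B" unfolding B_def by (rule imageI)
        then show ?thesis using q(2) w(1) by simp
      qed
      ultimately show ?thesis by (elim exE, intro exI conjI) assumption+
    qed
    have qW': "q \<in> W'"
    proof -
      have "\<Psi> ` W = W'" using \<Psi>(1) unfolding pl_homeomorphism_iff homeomorphism_def by blast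
      then show ?thesis using W(3) \<Psi>(2) by (metis imageI)
    qed
    obtain Ob where Ob: "open Ob" "W' = Y \<inter> Ob" using W(2) unfolding openin_open by blast
    show ?thesis
    proof (cases "q \<in> interior Y")
      case True
      have "interior Y \<inter> Ob = W' \<inter> interior Y" using Ob(2) interior_subset by blast
      then have "openin (top_of_set W') (interior Y \<inter> Ob)"
        by (simp add: openin_open_Int)
      moreover have "open (interior Y \<inter> Ob)" using Ob(1) by blast
      ultimately show ?thesis using chart[of "interior Y \<inter> Ob"] True qW' Ob(2) by blast
    next
      case False
      then have "\<not> open Y" using q(1) interior_open by blast
      then obtain n Oc where n: "n \<noteq> 0" "open Oc" "Y = {y. 0 \<le> n \<bullet> y} \<inter> Oc"
        using Yalt unfolding openin_open by blast
      have nq: "n \<bullet> q = 0"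
      proof (rule ccontr)
        assume "n \<bullet> q \<noteq> 0"
        then have "q \<in> {y. 0 < n \<bullet> y} \<inter> Oc" using q(1) n(3) by auto
        moreover have "open ({y. 0 < n \<bullet> y} \<inter> Oc)"
          using n(2) open_halfspace_gt[of 0 n] by (simp add: open_Int)
        moreover have "{y. 0 < n \<bullet> y} \<inter> Oc \<subseteq> Y" using n(3) by auto
        ultimately show False using False interiorI by blast
      qed
      \<comment> \<open>both \<open>q + (d/2) v\<close> and \<open>q - (d/2) v\<close> lie in the half-space, and \<open>q\<close> lies on its boundary\<close>
      have nv: "n \<bullet> v = 0"
      proof -
        have "q + (d/2) *\<^sub>R v \<in> Y" "q + (-d/2) *\<^sub>R v \<in> Y"
          using move[OF q(1), of "d/2"] move[OF q(1), of "-d/2"] d by auto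
        then have "0 \<le> n \<bullet> (q + (d/2) *\<^sub>R v)" "0 \<le> n \<bullet> (q + (-d/2) *\<^sub>R v)"
          using n(3) by blast+
        then have "0 \<le> (d/2) * (n \<bullet> v)" "(d/2) * (n \<bullet> v) \<le> 0"
          using nq by (simp_all add: inner_add_right inner_diff_right)
        then have "d * (n \<bullet> v) = 0" by simp
        then show ?thesis using d by simp
      qed
      have "W' = (Oc \<inter> Ob) \<inter> {y. 0 \<le> n \<bullet> y}" using Ob(2) n(3) by blast
      then have "\<exists>n Ob. n \<noteq> 0 \<and> n \<bullet> v = 0 \<and> n \<bullet> q = 0 \<and> open Ob \<and> W' = Ob \<inter> {y. 0 \<le> n \<bullet> y}"
        using n(1,2) nq nv Ob(1) by (intro exI[of _ n] exI[of _ "Oc \<inter> Ob"]) (simp add: open_Int)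
      then show ?thesis
        by (intro chart[OF openin_subtopology_self qW'] disjI2)
    qed
  qed
  then show thesis using that[OF e'(1) e(2)] by blast
qed

lemma pl_manifold_regular_sublevel:
  fixes g :: "'a::euclidean_space \<Rightarrow> real" and M :: "'a set"
  assumes M: "pl_manifold (TYPE('e::euclidean_space)) M" and g: "pl_on M g" and K: "compact K" "K \<subseteq> M"
  obtains C where "finite C"
    "\<forall>c. c \<notin> C \<longrightarrow> {x\<in>M. g x \<le> c} \<subseteq> K \<longrightarrow> pl_manifold (TYPE('e)) {x\<in>M. g x \<le> c}"
proof -
  define good where "good w \<longleftrightarrow> (\<exists>U (\<phi> :: 'a \<Rightarrow> 'e). w \<in> U \<and> pl_chart {x\<in>M. g x \<le> g w} U \<phi>)" for w
  have "\<exists>e C. e > 0 \<and> finite C \<and> (\<forall>w\<in>M. dist z w < e \<longrightarrow> g w \<notin> C \<longrightarrow> good w)" if z: "z \<in> K" for z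
  proof -
    have "z \<in> M" using z K(2) by blast
    show ?thesis
    proof (rule regular_sublevel_chart[OF M g \<open>z \<in> M\<close>])
      fix e :: real and C assume "e > 0" "finite C"
        "\<And>w. \<lbrakk>w \<in> M; dist z w < e; g w \<notin> C\<rbrakk> \<Longrightarrow> \<exists>U (\<phi> :: 'a \<Rightarrow> 'e). w \<in> U \<and> pl_chart {x\<in>M. g x \<le> g w} U \<phi>"
      then show ?thesis unfolding good_def by (intro exI[of _ e] exI[of _ C]) simp
    qed
  qed
  then obtain e C where eC: "\<And>z. z \<in> K \<Longrightarrow> e z > (0::real) \<and> finite (C z) \<and> (\<forall>w\<in>M. dist z w < e z \<longrightarrow> g w \<notin> C z \<longrightarrow> good w)"
    by metis
  have "K \<subseteq> (\<Union>z\<in>K. ball z (e z))" using eC by force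
  then obtain D where D: "D \<subseteq> K" "finite D" "K \<subseteq> (\<Union>z\<in>D. ball z (e z))"
    using compactE_image[OF K(1), of K "\<lambda>z. ball z (e z)"] by auto
  have "pl_manifold (TYPE('e)) {x\<in>M. g x \<le> c}"
    if c: "c \<notin> \<Union>(C ` D)" "{x\<in>M. g x \<le> c} \<subseteq> K" for c
    unfolding pl_manifold_def
  proof (intro conjI ballI)
    show "polyhedral {x\<in>M. g x \<le> c}"
      using polyhedral_vimage[OF g polyhedron_imp_polyhedral[OF polyhedron_halfspace_le[of 1 c]]] by simp
    fix w assume w: "w \<in> {x\<in>M. g x \<le> c}"
    show "\<exists>U (\<phi> :: 'a \<Rightarrow> 'e). w \<in> U \<and> pl_chart {x\<in>M. g x \<le> c} U \<phi>"
    proof (cases "g w = c")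
      case True
      have "w \<in> K" using w c(2) by blast
      then obtain z where z: "z \<in> D" "dist z w < e z" using D(3) by auto
      have "z \<in> K" using z(1) D(1) by blast
      moreover have "g w \<notin> C z" using c(1) z(1) True by blast
      ultimately have "good w" using eC[of z] z(2) w by blast
      then show ?thesis unfolding good_def True .
    next
      case False
      have "openin (top_of_set M) (M \<inter> g -` {..<c})"
        by (rule continuous_openin_preimage_gen[OF pl_on_continuous[OF g]]) simp
      then show ?thesis
        by (rule pl_manifold_openin[OF M]) (use w False in auto)
    qed
  qed
  then show thesis
    using that[of "\<Union>(C ` D)"] D(1,2) eC by auto
qed

lemma polyhedral_compact_nbhd:
  assumes "polyhedral M" "compact P" "P \<subseteq> M"
  obtains K V where "compact K" "K \<subseteq> M" "open V" "P \<subseteq> V" "M \<inter> V \<subseteq> K"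
proof -
  have "\<forall>x\<in>P. \<exists>K e. compact K \<and> K \<subseteq> M \<and> e > 0 \<and> M \<inter> ball x e \<subseteq> K"
  proof
    fix x assume "x \<in> P"
    then obtain F where "polyhedral_nbhd M F x"
      using assms(1,3) unfolding polyhedral_iff_nbhd by blast
    then obtain e where F: "finite F" "\<forall>S\<in>F. polytope S" "\<Union>F \<subseteq> M" "e > 0" "M \<inter> ball x e \<subseteq> \<Union>F"
      unfolding polyhedral_nbhd_def by meson
    then show "\<exists>K e. compact K \<and> K \<subseteq> M \<and> e > 0 \<and> M \<inter> ball x e \<subseteq> K"
      using finite_Union_polytopes(1)[OF F(1,2)] by (intro exI[of _ "\<Union>F"] exI[of _ e]) simp
  qed
  then obtain K e where Ke: "\<And>x. x \<in> P \<Longrightarrow> compact (K x) \<and> K x \<subseteq> M \<and> e x > (0::real) \<and> M \<inter> ball x (e x) \<subseteq> K x"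
    by metis
  have "P \<subseteq> (\<Union>x\<in>P. ball x (e x))" using Ke by force
  then obtain D where D: "D \<subseteq> P" "finite D" "P \<subseteq> (\<Union>x\<in>D. ball x (e x))"
    using compactE_image[OF assms(2), of P "\<lambda>x. ball x (e x)"] by auto
  have KD: "compact (K x) \<and> K x \<subseteq> M \<and> M \<inter> ball x (e x) \<subseteq> K x" if "x \<in> D" for x
    using Ke D(1) that by blast
  show thesis
  proof (rule that)
    show "compact (\<Union>(K ` D))" using D(2) KD by (intro compact_UN) auto
    show "\<Union>(K ` D) \<subseteq> M" using KD by blast
    show "open (\<Union>x\<in>D. ball x (e x))" by blast
    show "P \<subseteq> (\<Union>x\<in>D. ball x (e x))" by fact
    show "M \<inter> (\<Union>x\<in>D. ball x (e x)) \<subseteq> \<Union>(K ` D)" using KD by blast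
  qed
qed

text \<open>
  The distance from \<open>D\<close> in the maximum norm: unlike the Euclidean distance it is PL, and the two
  norms differ at most by the factor \<open>DIM('a)\<close>.
\<close>
lemma cube_distance_function:
  fixes D :: "'a::euclidean_space set"
  assumes D: "finite D" "D \<noteq> {}"
  obtains g where "pl_on UNIV g" "\<And>z p. p \<in> D \<Longrightarrow> g z \<le> norm (z - p)"
    "\<And>z. \<exists>p\<in>D. norm (z - p) \<le> real DIM('a) * g z"
proof -
  define f where "f p z = Max ((\<lambda>i. max (i \<bullet> z - i \<bullet> p) (- (i \<bullet> z - i \<bullet> p))) ` Basis)" for p z :: 'a
  define g where "g z = Min ((\<lambda>p. f p z) ` D)" for z
  have U: "polyhedral (UNIV :: 'a set)" by (simp add: open_imp_polyhedral)
  have f_alt: "f p z = Max ((\<lambda>i. \<bar>i \<bullet> (z - p)\<bar>) ` Basis)" for p z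
    unfolding f_def by (intro arg_cong[of _ _ Max] image_cong) (auto simp: inner_diff_right)
  have "pl_on UNIV g"
    unfolding g_def f_def
    by (intro pl_on_Min pl_on_Max pl_on_max pl_on_uminus pl_on_diff pl_on_inner pl_on_const U D)
      (auto simp: ex_in_conv)
  moreover have "g z \<le> norm (z - p)" if "p \<in> D" for z p
  proof -
    have "g z \<le> f p z" unfolding g_def using D(1) that by (intro Min_le) auto
    also have "f p z \<le> norm (z - p)"
      unfolding f_alt using Basis_le_norm by (subst Max_le_iff) (auto simp: inner_commute)
    finally show ?thesis .
  qed
  moreover have "\<exists>p\<in>D. norm (z - p) \<le> real DIM('a) * g z" for z
  proof -
    have "g z \<in> (\<lambda>p. f p z) ` D" unfolding g_def using D by (intro Min_in) auto
    then obtain p where p: "p \<in> D" "g z = f p z" by blast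
    have "norm (z - p) \<le> (\<Sum>i\<in>Basis. \<bar>(z - p) \<bullet> i\<bar>)" by (rule norm_le_l1)
    also have "\<dots> \<le> (\<Sum>i\<in>(Basis::'a set). f p z)"
      unfolding f_alt by (intro sum_mono Max_ge) (auto simp: inner_commute)
    finally show ?thesis using p by auto
  qed
  ultimately show thesis by (rule that)
qed

text \<open>
  The sublevel set of level \<open>c\<close> of the distance from a \<open>\<rho>\<close>-net of \<open>P\<close> contains a neighbourhood of
  \<open>P\<close> as soon as \<open>c > \<rho>\<close>, and stays inside \<open>W\<close> and a compact part of \<open>M\<close> as long as \<open>c < 2 * \<rho>\<close>.
  Only finitely many of these levels fail to give a manifold.
\<close>
proposition compact_pl_manifold_nbhd:
  fixes M :: "'a::euclidean_space set"
  assumes M: "pl_manifold (TYPE('e::euclidean_space)) M" and P: "compact P" "P \<subseteq> M" and W: "open W" "P \<subseteq> W"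
  obtains Q V where "compact Q" "pl_manifold (TYPE('e)) Q" "open V" "P \<subseteq> V" "M \<inter> V \<subseteq> Q" "Q \<subseteq> M \<inter> W"
proof (cases "P = {}")
  case True
  have "pl_manifold (TYPE('e)) ({} :: 'a set)" unfolding pl_manifold_def polyhedral_def by simp
  then show ?thesis using that[of "{}" "{}"] True by simp
next
  case False
  have Mp: "polyhedral M" using M unfolding pl_manifold_def by blast
  obtain K V0 where K: "compact K" "K \<subseteq> M" "open V0" "P \<subseteq> V0" "M \<inter> V0 \<subseteq> K"
    by (rule polyhedral_compact_nbhd[OF Mp P])
  have "open (V0 \<inter> W)" "P \<subseteq> V0 \<inter> W" using K W by auto
  then obtain \<epsilon> where \<epsilon>: "\<epsilon> > 0" "(\<Union>x\<in>P. ball x \<epsilon>) \<subseteq> V0 \<inter> W"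
    by (rule compact_subset_open_imp_ball_epsilon_subset[OF P(1)])
  \<comment> \<open>maximum norm less than \<open>2 * \<rho>\<close> gives Euclidean norm less than \<open>\<epsilon>\<close>\<close>
  define \<rho> where "\<rho> = \<epsilon> / (2 * real DIM('a))"
  have \<rho>: "\<rho> > 0" "real DIM('a) * (2 * \<rho>) = \<epsilon>" unfolding \<rho>_def using \<epsilon>(1) by simp_all
  have "P \<subseteq> (\<Union>x\<in>P. ball x \<rho>)" using \<rho>(1) by force
  then obtain D where D: "D \<subseteq> P" "finite D" "P \<subseteq> (\<Union>x\<in>D. ball x \<rho>)"
    using compactE_image[OF P(1), of P "\<lambda>x. ball x \<rho>"] by auto
  have "D \<noteq> {}" using D(3) False by blast
  obtain g where g: "pl_on UNIV g" "\<And>z p. p \<in> D \<Longrightarrow> g z \<le> norm (z - p)"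
    "\<And>z. \<exists>p\<in>D. norm (z - p) \<le> real DIM('a) * g z"
    using cube_distance_function[OF D(2) \<open>D \<noteq> {}\<close>] by blast
  have gM: "pl_on M g" using pl_on_subset[OF g(1) Mp] by simp
  obtain C where C: "finite C"
    "\<forall>c. c \<notin> C \<longrightarrow> {x\<in>M. g x \<le> c} \<subseteq> K \<longrightarrow> pl_manifold (TYPE('e)) {x\<in>M. g x \<le> c}"
    by (rule pl_manifold_regular_sublevel[OF M gM K(1,2)])
  have "infinite {\<rho><..<2*\<rho>}" using \<rho>(1) by (simp add: infinite_Ioo)
  then obtain c where c: "\<rho> < c" "c < 2 * \<rho>" "c \<notin> C"
    using C(1) by (metis finite_subset greaterThanLessThan_iff subsetI)
  define Q where "Q = {x\<in>M. g x \<le> c}"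
  have "Q \<subseteq> V0 \<inter> W"
  proof
    fix z assume z: "z \<in> Q"
    obtain p where p: "p \<in> D" "norm (z - p) \<le> real DIM('a) * g z" using g(3) by blast
    have "real DIM('a) * g z \<le> real DIM('a) * c" using z unfolding Q_def by (intro mult_left_mono) auto
    also have "\<dots> < \<epsilon>" using c(2) \<rho>(2) by (metis DIM_positive mult_less_cancel_left_pos of_nat_0_less_iff)
    finally have "z \<in> ball p \<epsilon>" using p(2) by (simp add: dist_norm norm_minus_commute)
    then show "z \<in> V0 \<inter> W" using \<epsilon>(2) p(1) D(1) by blast
  qed
  then have QK: "Q \<subseteq> K" using K(5) unfolding Q_def by blast
  show ?thesis
  proof (rule that)
    have "Q = K \<inter> g -` {..c}" using QK K(2) unfolding Q_def by auto
    moreover have "closed (g -` {..c})"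
      using pl_on_continuous[OF g(1)] by (intro closed_vimage) auto
    ultimately show "compact Q" using K(1) by (simp add: compact_Int_closed)
    show "pl_manifold (TYPE('e)) Q" using C(2) c(3) QK unfolding Q_def by blast
    show "open (\<Union>x\<in>D. ball x \<rho>)" by blast
    show "P \<subseteq> (\<Union>x\<in>D. ball x \<rho>)" by fact
    show "M \<inter> (\<Union>x\<in>D. ball x \<rho>) \<subseteq> Q"
    proof
      fix z assume "z \<in> M \<inter> (\<Union>x\<in>D. ball x \<rho>)"
      then obtain p where "z \<in> M" "p \<in> D" "norm (z - p) < \<rho>"
        by (auto simp: dist_norm norm_minus_commute)
      then show "z \<in> Q" using g(2)[of p z] c(1) unfolding Q_def by auto
    qed
    show "Q \<subseteq> M \<inter> W" using \<open>Q \<subseteq> V0 \<inter> W\<close> unfolding Q_def by blast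
  qed
qed

section \<open>Triviality of inclusions and homotopies\<close>

text \<open>
  What the proof needs to know about a notion of trivial inclusion. The last clause says that an
  inclusion is trivial if, up to homotopy, it factors through a trivial inclusion.
\<close>
definition triviality_condition :: "('a::euclidean_space set \<Rightarrow> 'a set \<Rightarrow> bool) \<Rightarrow> bool" where
  "triviality_condition triv \<longleftrightarrow> (\<forall>x. triv {x} {x}) \<and> (\<forall>P Q. triv P Q \<longrightarrow> P \<subseteq> Q) \<and>
     (\<forall>P Q A B r. triv P Q \<longrightarrow> Q \<subseteq> B \<longrightarrow> homotopic_with_canon (\<lambda>_. True) A B (\<lambda>x. x) r \<longrightarrow> r ` A \<subseteq> P
        \<longrightarrow> triv A B)"

lemma triviality_singleton: "triviality_condition triv \<Longrightarrow> triv {x} {x}"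
  unfolding triviality_condition_def by blast

lemma triviality_subset: "triviality_condition triv \<Longrightarrow> triv P Q \<Longrightarrow> P \<subseteq> Q"
  unfolding triviality_condition_def by blast

lemma triviality_homotopy:
  assumes "triviality_condition triv" "triv P Q" "Q \<subseteq> B"
    and "homotopic_with_canon (\<lambda>_. True) A B (\<lambda>x. x) r" "r ` A \<subseteq> P"
  shows "triv A B"
proof -
  have "\<forall>P Q A B r. triv P Q \<longrightarrow> Q \<subseteq> B \<longrightarrow> homotopic_with_canon (\<lambda>_. True) A B (\<lambda>x. x) r \<longrightarrow> r ` A \<subseteq> P
        \<longrightarrow> triv A B"
    using assms(1) unfolding triviality_condition_def by (elim conjE)
  then show ?thesis using assms(2-5) by meson
qed

lemma triviality_mono:
  assumes "triviality_condition triv" "triv P Q" "A \<subseteq> P" "Q \<subseteq> B"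
  shows "triv A B"
proof (rule triviality_homotopy[OF assms(1,2,4)])
  have "A \<subseteq> B" using assms triviality_subset by blast
  then show "homotopic_with_canon (\<lambda>_. True) A B (\<lambda>x. x) (\<lambda>x. x)"
    by (auto simp: homotopic_with_refl)
qed (use assms(3) in auto)

lemma triviality_contractible:
  assumes "triviality_condition triv" "contractible A" "A \<noteq> {}"
  shows "triv A A"
proof -
  obtain a where a: "homotopic_with_canon (\<lambda>_. True) A A (\<lambda>x. x) (\<lambda>x. a)"
    using assms(2) unfolding contractible_def id_def by blast
  have "(\<lambda>x. a) ` A \<subseteq> A" using homotopic_with_imp_subset2[OF a] .
  then have "{a} \<subseteq> A" using assms(3) by blast
  then show ?thesis
    by (rule triviality_homotopy[OF assms(1) triviality_singleton[OF assms(1)] _ a]) auto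
qed

lemma triviality_null_homotopic:
  "triviality_condition (null_homotopic_inclusion :: 'a::euclidean_space set \<Rightarrow> _)"
  unfolding triviality_condition_def
proof (intro conjI allI impI)
  fix x :: 'a
  show "null_homotopic_inclusion {x} {x}"
    unfolding null_homotopic_inclusion_def
    by (auto intro!: exI[of _ x] homotopic_with_equal)
next
  fix P Q :: "'a set" assume "null_homotopic_inclusion P Q"
  then show "P \<subseteq> Q" unfolding null_homotopic_inclusion_def by blast
next
  fix P Q A B :: "'a set" and r
  assume PQ: "null_homotopic_inclusion P Q" and B: "Q \<subseteq> B"
    and r: "homotopic_with_canon (\<lambda>_. True) A B (\<lambda>x. x) r" "r ` A \<subseteq> P"
  obtain c where c: "homotopic_with_canon (\<lambda>_. True) P Q (\<lambda>x. x) (\<lambda>_. c)"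
    using PQ unfolding null_homotopic_inclusion_def by blast
  have "continuous_on A r" using homotopic_with_imp_continuous[OF r(1)] by blast
  then have "homotopic_with_canon (\<lambda>_. True) A Q ((\<lambda>x. x) \<circ> r) ((\<lambda>_. c) \<circ> r)"
    using r(2) by (intro homotopic_with_compose_continuous_right[OF c]) auto
  then have "homotopic_with_canon (\<lambda>_. True) A B r (\<lambda>_. c)"
    using homotopic_with_subset_right[OF _ B] by (simp add: comp_def)
  then have "homotopic_with_canon (\<lambda>_. True) A B (\<lambda>x. x) (\<lambda>_. c)"
    using homotopic_with_trans[OF r(1)] by blast
  moreover have "A \<subseteq> B" using homotopic_with_imp_subset1[OF r(1)] by auto
  ultimately show "null_homotopic_inclusion A B"
    unfolding null_homotopic_inclusion_def by blast
qed

lemma triviality_null_homologous: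
  "triviality_condition (null_homologous_inclusion :: 'a::euclidean_space set \<Rightarrow> _)"
  unfolding triviality_condition_def
proof (intro conjI allI impI)
  fix x :: 'a
  have "contractible_space (top_of_set {x})"
    by (simp add: contractible_space_top_of_set)
  then have triv: "trivial_group (reduced_homology_group p (top_of_set {x}))" for p
    by (rule trivial_reduced_homology_group_contractible_space)
  have "trivial_homomorphism (reduced_homology_group p (top_of_set {x})) (reduced_homology_group p (top_of_set {x}))
            (hom_induced p (top_of_set {x}) {} (top_of_set {x}) {} (\<lambda>x. x))" for p
    unfolding trivial_homomorphism_def
  proof (intro conjI ballI)
    fix a assume "a \<in> carrier (reduced_homology_group p (top_of_set {x}))"
    then have "hom_induced p (top_of_set {x}) {} (top_of_set {x}) {} (\<lambda>x. x) a
        \<in> carrier (reduced_homology_group p (top_of_set {x}))"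
      by (rule hom_induced_reduced)
    then show "hom_induced p (top_of_set {x}) {} (top_of_set {x}) {} (\<lambda>x. x) a
        = \<one>\<^bsub>reduced_homology_group p (top_of_set {x})\<^esub>"
      using triv[of p] unfolding trivial_group_def by simp
  qed (rule hom_induced_reduced_hom)
  then show "null_homologous_inclusion {x} {x}"
    unfolding null_homologous_inclusion_def by blast
next
  fix P Q :: "'a set" assume "null_homologous_inclusion P Q"
  then show "P \<subseteq> Q" unfolding null_homologous_inclusion_def by blast
next
  fix P Q A B :: "'a set" and r
  assume PQ: "null_homologous_inclusion P Q" and B: "Q \<subseteq> B"
    and r: "homotopic_with_canon (\<lambda>_. True) A B (\<lambda>x. x) r" "r ` A \<subseteq> P"
  have AB: "A \<subseteq> B" using homotopic_with_imp_subset1[OF r(1)] by auto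
  have PQs: "P \<subseteq> Q" using PQ unfolding null_homologous_inclusion_def by blast
  have cr: "continuous_map (top_of_set A) (top_of_set P) r"
    using homotopic_with_imp_continuous[OF r(1)] r(2) by (auto simp: image_subset_iff_funcset)
  have ci: "continuous_map (top_of_set P) (top_of_set Q) (\<lambda>x. x)" using PQs by auto
  have cj: "continuous_map (top_of_set Q) (top_of_set B) (\<lambda>x. x)" using B by auto
  have "trivial_homomorphism (reduced_homology_group p (top_of_set A)) (reduced_homology_group p (top_of_set B))
            (hom_induced p (top_of_set A) {} (top_of_set B) {} (\<lambda>x. x))" for p
    unfolding trivial_homomorphism_def
  proof (intro conjI ballI)
    fix a assume a: "a \<in> carrier (reduced_homology_group p (top_of_set A))"
    have "hom_induced p (top_of_set A) {} (top_of_set B) {} (\<lambda>x. x) a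
        = hom_induced p (top_of_set A) {} (top_of_set B) {} (((\<lambda>x. x) \<circ> (\<lambda>x. x)) \<circ> r) a"
      using homology_homotopy_empty[OF r(1)] by (simp add: comp_def)
    also have "\<dots> = hom_induced p (top_of_set Q) {} (top_of_set B) {} (\<lambda>x. x)
        (hom_induced p (top_of_set P) {} (top_of_set Q) {} (\<lambda>x. x)
          (hom_induced p (top_of_set A) {} (top_of_set P) {} r a))"
      using hom_induced_compose_empty[OF cr continuous_map_compose[OF ci cj]]
        hom_induced_compose_empty[OF ci cj] by simp
    also have "hom_induced p (top_of_set P) {} (top_of_set Q) {} (\<lambda>x. x)
          (hom_induced p (top_of_set A) {} (top_of_set P) {} r a) = \<one>\<^bsub>reduced_homology_group p (top_of_set Q)\<^esub>"
      using PQ hom_induced_reduced[OF a]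
      unfolding null_homologous_inclusion_def trivial_homomorphism_def by blast
    also have "hom_induced p (top_of_set Q) {} (top_of_set B) {} (\<lambda>x. x) \<one>\<^bsub>reduced_homology_group p (top_of_set Q)\<^esub>
        = \<one>\<^bsub>reduced_homology_group p (top_of_set B)\<^esub>"
      by (rule hom_one[OF hom_induced_reduced_hom]) simp_all
    finally show "hom_induced p (top_of_set A) {} (top_of_set B) {} (\<lambda>x. x) a
        = \<one>\<^bsub>reduced_homology_group p (top_of_set B)\<^esub>" .
  qed (rule hom_induced_reduced_hom)
  then show "null_homologous_inclusion A B"
    unfolding null_homologous_inclusion_def using AB by blast
qed

lemma compact_polyhedral_imp_ENR:
  assumes "compact P" "polyhedral P"
  shows "ENR P"
proof -
  obtain F where F: "finite F \<and> (\<forall>S\<in>F. polytope S) \<and> P = \<Union>F"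
    using iffD1[OF compact_polyhedral_iff conjI[OF assms]] ..
  then have "ENR (\<Union>F)"
    by (intro ENR_finite_Union_convex_closed) (auto intro: polytope_imp_closed polytope_imp_convex)
  then show ?thesis using F by simp
qed

text \<open>
  Let \<open>r\<close> be a retraction of a neighbourhood onto \<open>P\<close>, and \<open>\<rho>\<close> one onto \<open>B\<close>. Near \<open>P\<close> the segment from
  \<open>z\<close> to \<open>r z\<close> is short, so it lies in the domain of \<open>\<rho>\<close>. Its image under \<open>\<rho>\<close> moves \<open>z\<close> to \<open>r z\<close>
  inside \<open>B\<close>.
\<close>
lemma triviality_thicken:
  assumes triv: "triviality_condition triv" "triv P P'"
    and P: "compact P" "polyhedral P" and B: "compact B" "polyhedral B" "P' \<subseteq> B"
  obtains W where "open W" "P \<subseteq> W" "\<forall>A. A \<subseteq> B \<inter> W \<longrightarrow> triv A B"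
proof -
  have PB: "P \<subseteq> B" using triviality_subset[OF triv] B(3) by blast
  obtain V r where V: "open V" "retraction V P r"
    using compact_polyhedral_imp_ENR[OF P] unfolding ENR_def retract_of_def by blast
  obtain U \<rho> where U: "open U" "retraction U B \<rho>"
    using compact_polyhedral_imp_ENR[OF B(1,2)] unfolding ENR_def retract_of_def by blast
  have r: "P \<subseteq> V" "continuous_on V r" "\<And>x. x \<in> V \<Longrightarrow> r x \<in> P" "\<And>x. x \<in> P \<Longrightarrow> r x = x"
    using V(2) unfolding retraction_def by auto
  have \<rho>: "B \<subseteq> U" "continuous_on U \<rho>" "\<And>x. x \<in> U \<Longrightarrow> \<rho> x \<in> B" "\<And>x. x \<in> B \<Longrightarrow> \<rho> x = x"
    using U(2) unfolding retraction_def by auto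
  have "P \<subseteq> U" using PB \<rho>(1) by blast
  then obtain \<epsilon> where \<epsilon>: "\<epsilon> > 0" "(\<Union>x\<in>P. ball x \<epsilon>) \<subseteq> U"
    by (rule compact_subset_open_imp_ball_epsilon_subset[OF P(1) U(1)])
  define W where "W = V \<inter> (\<lambda>z. dist (r z) z) -` {..<\<epsilon>}"
  show thesis
  proof (rule that)
    show "open W"
      unfolding W_def using r(2) V(1)
      by (intro continuous_open_preimage) (auto intro!: continuous_intros)
    show "P \<subseteq> W" unfolding W_def using r(1,4) \<epsilon>(1) by auto
    show "\<forall>A. A \<subseteq> B \<inter> W \<longrightarrow> triv A B"
    proof (intro allI impI)
      fix A assume A: "A \<subseteq> B \<inter> W"
      then have AV: "A \<subseteq> V" unfolding W_def by blast
      have "homotopic_with_canon (\<lambda>_. True) A U (\<lambda>x. x) r"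
      proof (rule homotopic_with_linear)
        show "continuous_on A (\<lambda>x. x)" by (rule continuous_on_id)
        show "continuous_on A r" using r(2) AV continuous_on_subset by blast
        fix x assume x: "x \<in> A"
        then have "r x \<in> P" "dist (r x) x < \<epsilon>" using A r(3) unfolding W_def by auto
        then have "closed_segment x (r x) \<subseteq> ball (r x) \<epsilon>"
          using \<epsilon>(1) by (intro closed_segment_subset convex_ball) auto
        then show "closed_segment x (r x) \<subseteq> U" using \<epsilon>(2) \<open>r x \<in> P\<close> by blast
      qed
      then have "homotopic_with_canon (\<lambda>_. True) A B (\<rho> \<circ> (\<lambda>x. x)) (\<rho> \<circ> r)"
        using \<rho>(2,3) by (intro homotopic_with_compose_continuous_left) auto
      then have "homotopic_with_canon (\<lambda>_. True) A B (\<lambda>x. x) r"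
      proof (rule homotopic_with_eq)
        show "x = (\<rho> \<circ> (\<lambda>x. x)) x" "r x = (\<rho> \<circ> r) x" if "x \<in> topspace (top_of_set A)" for x
          using that A AV r(3) PB \<rho>(4) by (auto simp: subset_iff)
      qed auto
      then show "triv A B"
        using triviality_homotopy[OF triv B(3)] r(3) AV by blast
    qed
  qed
qed

text \<open>
  Each neighbourhood is chosen after its successor, inside which it must be deformed. The open set
  \<open>V\<close> records that \<open>Q 0\<close> is a neighbourhood, which leaves room for the next step of the induction.
\<close>
lemma triviality_manifold_chain:
  fixes M :: "'a::euclidean_space set" and P :: "nat \<Rightarrow> 'a set"
  assumes triv: "triviality_condition triv" and M: "pl_manifold (TYPE('e::euclidean_space)) M" and W: "open W"
    and P: "\<And>i. i \<le> n \<Longrightarrow> compact (P i) \<and> polyhedral (P i) \<and> P i \<subseteq> M \<inter> W"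
      "\<And>i. i < n \<Longrightarrow> triv (P i) (P (Suc i))"
  shows "\<exists>Q V. open V \<and> P 0 \<subseteq> V \<and> M \<inter> V \<subseteq> Q 0 \<and>
    (\<forall>i\<le>n. compact (Q i) \<and> pl_manifold (TYPE('e)) (Q i) \<and> P i \<subseteq> Q i \<and> Q i \<subseteq> M \<inter> W) \<and>
    (\<forall>i<n. triv (Q i) (Q (Suc i)))"
  using P
proof (induction n arbitrary: P)
  case 0
  have P0: "compact (P 0)" "P 0 \<subseteq> M" "P 0 \<subseteq> W" using 0(1)[of 0] by auto
  obtain Q V where "compact Q" "pl_manifold (TYPE('e)) Q" "open V" "P 0 \<subseteq> V" "M \<inter> V \<subseteq> Q" "Q \<subseteq> M \<inter> W"
    by (rule compact_pl_manifold_nbhd[OF M P0(1,2) W P0(3)])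
  then show ?case
    using P0(2) by (intro exI[of _ "\<lambda>_. Q"] exI[of _ V]) auto
next
  case (Suc n)
  have "\<exists>Q V. open V \<and> P (Suc 0) \<subseteq> V \<and> M \<inter> V \<subseteq> Q 0 \<and>
    (\<forall>i\<le>n. compact (Q i) \<and> pl_manifold (TYPE('e)) (Q i) \<and> P (Suc i) \<subseteq> Q i \<and> Q i \<subseteq> M \<inter> W) \<and>
    (\<forall>i<n. triv (Q i) (Q (Suc i)))"
    using Suc.IH[of "\<lambda>i. P (Suc i)"] Suc.prems by simp
  then obtain Q V where QV: "open V" "P (Suc 0) \<subseteq> V" "M \<inter> V \<subseteq> Q 0"
    and Q: "\<And>i. i \<le> n \<Longrightarrow> compact (Q i) \<and> pl_manifold (TYPE('e)) (Q i) \<and> P (Suc i) \<subseteq> Q i \<and> Q i \<subseteq> M \<inter> W"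
      "\<And>i. i < n \<Longrightarrow> triv (Q i) (Q (Suc i))" by metis
  have P0: "compact (P 0)" "polyhedral (P 0)" "P 0 \<subseteq> M" "P 0 \<subseteq> W" "triv (P 0) (P (Suc 0))"
    using Suc.prems(1)[of 0] Suc.prems(2)[of 0] by auto
  have Q0: "compact (Q 0)" "polyhedral (Q 0)" "P (Suc 0) \<subseteq> Q 0"
    using Q(1)[of 0] unfolding pl_manifold_def by auto
  obtain W1 where W1: "open W1" "P 0 \<subseteq> W1" "\<forall>A. A \<subseteq> Q 0 \<inter> W1 \<longrightarrow> triv A (Q 0)"
    by (rule triviality_thicken[OF triv P0(5,1,2) Q0])
  have "P 0 \<subseteq> P (Suc 0)" using triviality_subset[OF triv P0(5)] .
  then have "open (W \<inter> W1 \<inter> V)" "P 0 \<subseteq> W \<inter> W1 \<inter> V"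
    using W W1(1,2) QV(1,2) P0(4) by auto
  then obtain R U where R: "compact R" "pl_manifold (TYPE('e)) R" "open U" "P 0 \<subseteq> U" "M \<inter> U \<subseteq> R"
      "R \<subseteq> M \<inter> (W \<inter> W1 \<inter> V)"
    by (rule compact_pl_manifold_nbhd[OF M P0(1,3)])
  have RQ: "triv R (Q 0)" using W1(3) R(6) QV(3) by blast
  have PR: "P 0 \<subseteq> R" "R \<subseteq> M \<inter> W" using R(4-6) P0(3) by blast+
  have 1: "compact (case_nat R Q i) \<and> pl_manifold (TYPE('e)) (case_nat R Q i) \<and> P i \<subseteq> case_nat R Q i
      \<and> case_nat R Q i \<subseteq> M \<inter> W" if "i \<le> Suc n" for i
    using that Q(1) R(1,2) PR by (cases i) auto
  have 2: "triv (case_nat R Q i) (case_nat R Q (Suc i))" if "i < Suc n" for i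
    using that Q(2) RQ by (cases i) auto
  show ?case
    using 1 2 R(3-5) by (intro exI[of _ "case_nat R Q"] exI[of _ U]) simp
qed

section \<open>Arcs\<close>

lemma continuous_on_compact_quotient:
  fixes q :: "'a::t2_space \<Rightarrow> 'b::t2_space" and H :: "'b \<Rightarrow> 'c::topological_space"
  assumes "compact S" "continuous_on S q" "continuous_on S (\<lambda>x. H (q x))"
  shows "continuous_on (q ` S) H"
proof -
  have "closed (H -` B \<inter> q ` S)" if B: "closed B" for B
  proof -
    have "closed ((\<lambda>x. H (q x)) -` B \<inter> S)"
      using iffD1[OF continuous_on_closed_vimage[OF compact_imp_closed[OF assms(1)]] assms(3)] B by simp
    then have "compact (S \<inter> ((\<lambda>x. H (q x)) -` B \<inter> S))"
      using assms(1) compact_Int_closed by blast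
    moreover have "S \<inter> ((\<lambda>x. H (q x)) -` B \<inter> S) \<subseteq> S" by blast
    ultimately have "compact (q ` (S \<inter> ((\<lambda>x. H (q x)) -` B \<inter> S)))"
      by (intro compact_continuous_image continuous_on_subset[OF assms(2)])
    moreover have "q ` (S \<inter> ((\<lambda>x. H (q x)) -` B \<inter> S)) = H -` B \<inter> q ` S" by auto
    ultimately show ?thesis using compact_imp_closed by simp
  qed
  moreover have "closed (q ` S)"
    using assms(1,2) compact_continuous_image compact_imp_closed by blast
  ultimately show ?thesis by (simp add: continuous_on_closed_vimage)
qed

text \<open>
  In the parameter of the arc, \<open>J\<close> is an interval, and the straight-line homotopy to the nearest
  point of the interval moves \<open>C\<close> into \<open>J\<close> and fixes \<open>J\<close>. It descends to \<open>R \<union> f ` C\<close>, where \<open>R\<close> is kept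
  fixed, since all identifications made by \<open>f\<close>, and all contacts with \<open>R\<close>, happen in \<open>J\<close>. The
  homotopy on the image is continuous because \<open>f\<close> is a quotient map on the compact arc.
\<close>
lemma arc_tails_retract:
  fixes f :: "'a::euclidean_space \<Rightarrow> 'b::euclidean_space"
  assumes C: "homeomorphism {0..1::real} C \<gamma> \<delta>" and J: "compact J" "connected J" "J \<noteq> {}" "J \<subseteq> C"
    and f: "continuous_on C f" and R: "compact R" "\<And>u. u \<in> C \<Longrightarrow> f u \<in> R \<Longrightarrow> u \<in> J"
    and inj: "\<And>u v. u \<in> C \<Longrightarrow> v \<in> C \<Longrightarrow> f u = f v \<Longrightarrow> u = v \<or> u \<in> J \<and> v \<in> J"
  obtains r where "homotopic_with_canon (\<lambda>_. True) (R \<union> f ` C) (R \<union> f ` C) (\<lambda>x. x) r"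
    "r ` (R \<union> f ` C) \<subseteq> R \<union> f ` J"
proof -
  have \<gamma>: "\<gamma> t \<in> C" "\<delta> (\<gamma> t) = t" if "t \<in> {0..1}" for t
    using imageI[OF that, of \<gamma>] homeomorphism_image1[OF C] homeomorphism_apply1[OF C that] by simp_all
  have \<delta>: "\<delta> u \<in> {0..1}" "\<gamma> (\<delta> u) = u" if "u \<in> C" for u
    using imageI[OF that, of \<delta>] homeomorphism_image2[OF C] homeomorphism_apply2[OF C that] by simp_all
  have cont\<gamma>: "continuous_on {0..1} \<gamma>" and cont\<delta>: "continuous_on C \<delta>"
    using homeomorphism_cont1[OF C] homeomorphism_cont2[OF C] .
  have Ccomp: "compact C"
    using compact_continuous_image[OF cont\<gamma> compact_Icc] homeomorphism_image1[OF C] by simp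
  have "connected (\<delta> ` J)" "compact (\<delta> ` J)"
    using connected_continuous_image[OF continuous_on_subset[OF cont\<delta> J(4)] J(2)]
      compact_continuous_image[OF continuous_on_subset[OF cont\<delta> J(4)] J(1)] .
  then obtain a b where ab: "\<delta> ` J = {a..b}"
    using connected_compact_interval_1[of "\<delta> ` J"] by blast
  have "{a..b} \<noteq> {}" using ab J(3) by (metis image_is_empty)
  then have ab_le: "a \<le> b" by simp
  have "\<delta> ` J \<subseteq> {0..1}" using J(4) \<delta>(1) by (intro image_subsetI) (simp add: subset_iff)
  then have "{a..b} \<subseteq> {0..1}" using ab by simp
  then have ab01: "0 \<le> a" "b \<le> 1" using ab_le by auto
  have J_iff: "u \<in> J \<longleftrightarrow> \<delta> u \<in> {a..b}" if "u \<in> C" for u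
  proof
    assume "\<delta> u \<in> {a..b}"
    then obtain v where "v \<in> J" "\<delta> v = \<delta> u" using ab by (metis imageE)
    then show "u \<in> J" using that J(4) \<delta>(2) by (metis subsetD)
  next
    assume "u \<in> J"
    then show "\<delta> u \<in> {a..b}" using imageI[of u J \<delta>] ab by simp
  qed
  define clamp where "clamp t = max a (min b t)" for t :: real
  have clamp: "clamp t \<in> {a..b}" "t \<in> {a..b} \<Longrightarrow> clamp t = t" for t
    unfolding clamp_def using ab_le by auto
  define k where "k t u = (1 - t) * \<delta> u + t * clamp (\<delta> u)" for t u
  have k01: "k t u \<in> {0..1}" if "t \<in> {0..1}" "u \<in> C" for t u
  proof -
    have c: "0 \<le> clamp (\<delta> u)" "clamp (\<delta> u) \<le> 1" using clamp(1)[of "\<delta> u"] ab01 by auto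
    have d: "0 \<le> \<delta> u" "\<delta> u \<le> 1" using \<delta>(1)[OF that(2)] by auto
    have "k t u \<le> 1"
      unfolding k_def using convex_bound_le[OF d(2) c(2), of "1 - t" t] that(1) by simp
    moreover have "0 \<le> k t u" unfolding k_def using c(1) d(1) that(1) by simp
    ultimately show ?thesis by simp
  qed
  have k_cont: "continuous_on ({0..1} \<times> C) (\<lambda>(t, u). k t u)"
  proof -
    have "continuous_on ({0..1} \<times> C) (\<lambda>z. \<delta> (snd z))"
      by (rule continuous_on_compose2[OF cont\<delta>]) (auto intro: continuous_intros)
    then show ?thesis
      unfolding k_def clamp_def case_prod_unfold by (intro continuous_intros)
  qed
  have kJ: "k t u = \<delta> u" if "u \<in> J" for t u
  proof -
    have "clamp (\<delta> u) = \<delta> u" using clamp(2) J_iff that J(4) by blast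
    then show ?thesis unfolding k_def by (simp add: algebra_simps)
  qed
  define H where "H = (\<lambda>(t::real, y). if y \<in> R then y else f (\<gamma> (k t (inv_into C f y))))"
  have HR: "H (t, y) = y" if "y \<in> R" for t y using that unfolding H_def by simp
  have Hf: "H (t, f u) = f (\<gamma> (k t u))" if u: "u \<in> C" for t u
  proof (cases "f u \<in> R")
    case True
    then have "\<gamma> (k t u) = u" using kJ[OF R(2)[OF u True]] \<delta>(2)[OF u] by simp
    then show ?thesis using HR[OF True] by simp
  next
    case False
    define v where "v = inv_into C f (f u)"
    have v: "v \<in> C" "f v = f u"
      unfolding v_def using u by (auto intro: inv_into_into f_inv_into_f)
    have "f (\<gamma> (k t v)) = f (\<gamma> (k t u))"
    proof (cases "u = v")
      case neq: False
      then have "u \<in> J" "v \<in> J" using inj[OF u v(1)] v(2) by auto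
      then show ?thesis using kJ \<delta>(2) u v by simp
    qed simp
    then show ?thesis unfolding H_def v_def using False by simp
  qed
  have H_range: "H (t, y) \<in> R \<union> f ` C" if "t \<in> {0..1}" "y \<in> R \<union> f ` C" for t y
    using that HR Hf \<gamma>(1) k01 by auto
  have contR: "continuous_on ({0..1} \<times> R) H"
    by (rule continuous_on_eq[OF continuous_on_snd[OF continuous_on_id]]) (auto simp: HR)
  have contC: "continuous_on ({0..1} \<times> f ` C) H"
  proof -
    let ?q = "\<lambda>z :: real \<times> 'a. (fst z, f (snd z))"
    have "continuous_on (?q ` ({0..1} \<times> C)) H"
    proof (rule continuous_on_compact_quotient)
      show "compact ({0..1::real} \<times> C)" using Ccomp compact_Times by blast
      have "continuous_on ({0..1} \<times> C) (\<lambda>z. f (snd z))"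
        by (rule continuous_on_compose2[OF f]) (auto intro: continuous_intros)
      then show "continuous_on ({0..1} \<times> C) ?q" by (intro continuous_intros)
      have "continuous_on ({0..1} \<times> C) (\<lambda>z. f (\<gamma> (case z of (t, u) \<Rightarrow> k t u)))"
        by (rule continuous_on_compose2[OF f continuous_on_compose2[OF cont\<gamma> k_cont]])
          (use k01 \<gamma>(1) in auto)
      then show "continuous_on ({0..1} \<times> C) (\<lambda>z. H (?q z))"
        by (rule continuous_on_eq) (auto simp: Hf)
    qed
    moreover have "?q ` ({0..1} \<times> C) = {0..1} \<times> f ` C" by force
    ultimately show ?thesis by simp
  qed
  have "compact (f ` C)" using f Ccomp compact_continuous_image by blast
  then have "continuous_on (({0..1} \<times> R) \<union> ({0..1} \<times> f ` C)) H"
    using contR contC R(1) by (intro continuous_on_closed_Un closed_Times compact_imp_closed) auto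
  then have contH: "continuous_on ({0..1} \<times> (R \<union> f ` C)) H"
    by (simp add: Sigma_Un_distrib2)
  show thesis
  proof (rule that)
    show "homotopic_with_canon (\<lambda>_. True) (R \<union> f ` C) (R \<union> f ` C) (\<lambda>x. x) (\<lambda>y. H (1, y))"
    proof (subst homotopic_with)
      have H0: "H (0, y) = y" if "y \<in> R \<union> f ` C" for y
        using that HR Hf \<delta>(2) unfolding k_def by auto
      have "continuous_map (prod_topology (top_of_set {0..1}) (top_of_set (R \<union> f ` C))) (top_of_set (R \<union> f ` C)) H"
      proof -
        have "H \<in> {0..1} \<times> (R \<union> f ` C) \<rightarrow> R \<union> f ` C"
          using H_range by (intro Pi_I) (auto simp only: mem_Sigma_iff split_paired_all)
        then show ?thesis
          using contH by (simp add: continuous_map_in_subtopology)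
      qed
      then show "\<exists>h. continuous_map (prod_topology (top_of_set {0..1::real}) (top_of_set (R \<union> f ` C))) (top_of_set (R \<union> f ` C)) h \<and>
        (\<forall>x\<in>topspace (top_of_set (R \<union> f ` C)). h (0, x) = x) \<and>
        (\<forall>x\<in>topspace (top_of_set (R \<union> f ` C)). h (1, x) = H (1, x)) \<and> (\<forall>t\<in>{0..1::real}. True)"
        using H0 by (intro exI[of _ H] conjI ballI) simp_all
    qed simp
    show "(\<lambda>y. H (1, y)) ` (R \<union> f ` C) \<subseteq> R \<union> f ` J"
    proof safe
      fix y assume "H (1, y) \<notin> f ` J" "y \<in> R"
      then show "H (1, y) \<in> R" using HR by simp
    next
      fix u assume u: "u \<in> C" and notJ: "H (1, f u) \<notin> f ` J"
      have "\<gamma> (k 1 u) \<in> J"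
      proof -
        have k1: "k 1 u \<in> {0..1}" using k01[of 1, OF _ u] by simp
        have "k 1 u = clamp (\<delta> u)" unfolding k_def by simp
        then have "\<delta> (\<gamma> (k 1 u)) \<in> {a..b}" using \<gamma>(2)[OF k1] clamp(1) by metis
        then show ?thesis using J_iff[OF \<gamma>(1)[OF k1]] by blast
      qed
      then show "H (1, f u) \<in> R" using notJ Hf[OF u] by simp
    qed
  qed
qed

text \<open>
  A chart with open image around \<open>f 0\<close> would map a half-open interval \<open>{0..<d}\<close> onto an open set of
  reals. Removing the image of \<open>0\<close> disconnects the latter, but \<open>{0<..<d}\<close> is connected.
\<close>
lemma pl_arc_start_in_boundary:
  assumes "pl_homeomorphism {0..1::real} J f g"
  shows "f 0 \<in> bd1 J"
proof (rule ccontr)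
  assume neg: "f 0 \<notin> bd1 J"
  have h: "homeomorphism {0..1::real} J f g" using assms unfolding pl_homeomorphism_iff by blast
  have "f 0 \<in> J" using homeomorphism_image1[OF h] by force
  then obtain U and \<phi> :: "'a \<Rightarrow> real" where U: "f 0 \<in> U" "pl_chart J U \<phi>" "open (\<phi> ` U)"
    using neg unfolding pl_boundary_def by auto
  then obtain \<psi> where opU: "openin (top_of_set J) U" and hU: "homeomorphism U (\<phi> ` U) \<phi> \<psi>"
    unfolding pl_chart_def pl_homeomorphism_def by blast
  have "openin (top_of_set {0..1}) ({0..1} \<inter> f -` U)"
  proof (rule continuous_openin_preimage[OF homeomorphism_cont1[OF h] _ opU])
    show "f \<in> {0..1} \<rightarrow> J" using homeomorphism_image1[OF h] by (simp add: image_subset_iff_funcset[symmetric])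
  qed
  moreover have "0 \<in> {0..1} \<inter> f -` U" using U(1) by simp
  ultimately obtain e where e: "e > 0" "ball 0 e \<inter> {0..1} \<subseteq> {0..1} \<inter> f -` U"
    unfolding openin_contains_ball by blast
  define d where "d = min e 1"
  have d: "0 < d" "d \<le> 1" "{0..<d} \<subseteq> {0..1} \<inter> f -` U"
  proof -
    show "0 < d" "d \<le> 1" unfolding d_def using e(1) by simp_all
    have "{0..<d} \<subseteq> ball 0 e \<inter> {0..1}" unfolding d_def by (auto simp: dist_real_def)
    then show "{0..<d} \<subseteq> {0..1} \<inter> f -` U" using e(2) by (rule order_trans)
  qed
  have op: "open (\<phi> ` f ` S)" if S: "S \<subseteq> {0..<d}" "openin (top_of_set {0..1}) S" for S
  proof -
    have "openin (top_of_set J) (f ` S)" using homeomorphism_imp_open_map[OF h S(2)] .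
    moreover have "f ` S \<subseteq> U" using S(1) d(3) by blast
    ultimately have "openin (top_of_set U) (f ` S)"
      using openin_imp_subset[OF opU] openin_subset_trans by blast
    then have "openin (top_of_set (\<phi> ` U)) (\<phi> ` f ` S)" using homeomorphism_imp_open_map[OF hU] by blast
    then show ?thesis using U(3) openin_open_trans by blast
  qed
  have "{0..<d} = {0..1} \<inter> {..<d}" using d(2) by auto
  then have "openin (top_of_set {0..1}) {0..<d}" by (metis open_lessThan openin_open_Int)
  then have "open (\<phi> ` f ` {0..<d})" using op by blast
  moreover have "\<phi> (f 0) \<in> \<phi> ` f ` {0..<d}" using d(1) by auto
  ultimately obtain r where r: "r > 0" "ball (\<phi> (f 0)) r \<subseteq> \<phi> ` f ` {0..<d}"
    using openE by blast
  have inj: "t = 0" if "t \<in> {0..<d}" "\<phi> (f t) = \<phi> (f 0)" for t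
  proof -
    have "f t \<in> U" using that(1) d(3) by blast
    then have "f t = f 0" using that(2) U(1) homeomorphism_apply1[OF hU] by metis
    then show ?thesis using that(1) d(2) homeomorphism_apply1[OF h, of t] homeomorphism_apply1[OF h, of 0] by auto
  qed
  have in_pos: "y \<in> \<phi> ` f ` {0<..<d}" if "y \<in> ball (\<phi> (f 0)) r" "y \<noteq> \<phi> (f 0)" for y
  proof -
    have "y \<in> (\<lambda>t. \<phi> (f t)) ` {0..<d}" using subsetD[OF r(2) that(1)] by (simp only: image_image)
    then obtain t where t: "y = \<phi> (f t)" "t \<in> {0..<d}" by (rule imageE)
    then have "t \<noteq> 0" using that(2) by auto
    then show ?thesis using t by auto
  qed
  have "continuous_on {0<..<d} (\<lambda>t. \<phi> (f t))"
  proof (rule continuous_on_compose2[OF homeomorphism_cont1[OF hU]])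
    show "continuous_on {0<..<d} f"
      by (rule continuous_on_subset[OF homeomorphism_cont1[OF h]]) (use d(2) in auto)
    show "f ` {0<..<d} \<subseteq> U"
    proof
      fix u assume "u \<in> f ` {0<..<d}"
      then obtain t where "u = f t" "t \<in> {0..<d}" by auto
      then show "u \<in> U" using d(3) by blast
    qed
  qed
  then have "connected (\<phi> ` f ` {0<..<d})"
    unfolding image_image by (intro connected_continuous_image) auto
  moreover have "\<phi> (f 0) - r/2 \<in> \<phi> ` f ` {0<..<d}" "\<phi> (f 0) + r/2 \<in> \<phi> ` f ` {0<..<d}"
    using r(1) in_pos[of "\<phi> (f 0) - r/2"] in_pos[of "\<phi> (f 0) + r/2"] by (simp_all add: dist_real_def)
  ultimately have "\<phi> (f 0) \<in> \<phi> ` f ` {0<..<d}"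
    by (rule connectedD_interval) (use r(1) in simp_all)
  then have "\<phi> (f 0) \<in> (\<lambda>t. \<phi> (f t)) ` {0<..<d}" by (simp only: image_image)
  then obtain t where "\<phi> (f 0) = \<phi> (f t)" "t \<in> {0<..<d}" by (rule imageE)
  then show False using inj[of t] by simp
qed

lemma polyhedral_Icc: "polyhedral {a..b::real}"
  using polyhedron_imp_polyhedral[OF polyhedron_interval[of a b]] by simp

lemma pl_homeomorphism_affine_real:
  fixes a b :: real
  assumes "b \<noteq> 0"
  shows "pl_homeomorphism UNIV UNIV (\<lambda>t. a + b * t) (\<lambda>s. (s - a) / b)"
proof -
  have "linear (\<lambda>t. b * t)" "linear (\<lambda>t. (1/b) * t)"
    by (auto intro!: linearI simp: algebra_simps add_divide_distrib)
  from this[THEN pl_on_affine[OF open_imp_polyhedral[OF open_UNIV]]]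
  have "pl_on UNIV (\<lambda>t. b * t + a)" "pl_on UNIV (\<lambda>t. (1/b) * t + (- a / b))" by blast+
  then have "pl_on UNIV (\<lambda>t. a + b * t)" "pl_on UNIV (\<lambda>s. (s - a) / b)"
    by (auto elim!: pl_on_cong simp: diff_divide_distrib)
  then show ?thesis
    unfolding pl_homeomorphism_iff using assms by (auto intro!: homeomorphismI pl_on_continuous)
qed

lemma pl_arc_boundary:
  assumes "pl_homeomorphism {0..1::real} J f g"
  shows "bd1 J = {f 0, f 1}"
proof
  have h: "homeomorphism {0..1::real} J f g" using assms unfolding pl_homeomorphism_iff by blast
  have aff: "(\<lambda>t. 1 + (-1) * t) ` {0..1::real} = {0..1}"
    by (auto intro!: image_eqI[of _ "\<lambda>t. 1 + (-1) * t" "1 - _"])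
  from pl_homeomorphism_restrict[OF pl_homeomorphism_affine_real[of "-1" 1] polyhedral_Icc[of 0 1] subset_UNIV]
  have "pl_homeomorphism {0..1} {0..1::real} (\<lambda>t. 1 + (-1) * t) (\<lambda>s. (s - 1) / (-1))"
    unfolding aff by simp
  from pl_arc_start_in_boundary[OF pl_homeomorphism_compose[OF this assms]]
  have "f 1 \<in> bd1 J" by simp
  then show "{f 0, f 1} \<subseteq> bd1 J" using pl_arc_start_in_boundary[OF assms] by blast
  show "bd1 J \<subseteq> {f 0, f 1}"
  proof
    fix z assume z: "z \<in> bd1 J"
    then have "z \<in> J" unfolding pl_boundary_def by blast
    then obtain t where t: "t \<in> {0..1}" "z = f t" using homeomorphism_image1[OF h] by blast
    show "z \<in> {f 0, f 1}"
    proof (rule ccontr)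
      assume "z \<notin> {f 0, f 1}"
      then have t': "t \<in> {0<..<1}" using t by (cases "t = 0"; cases "t = 1") auto
      have op: "openin (top_of_set {0..1}) {0<..<1::real}"
        by (rule open_subset) auto
      have opJ: "openin (top_of_set J) (f ` {0<..<1})" using homeomorphism_imp_open_map[OF h op] .
      have "polyhedral {0<..<1::real}" by (simp add: open_imp_polyhedral)
      moreover have "{0<..<1::real} \<subseteq> {0..1}" by auto
      ultimately have "pl_homeomorphism {0<..<1} (f ` {0<..<1}) f g"
        using pl_homeomorphism_restrict[OF assms] by blast
      moreover have "g ` f ` {0<..<1} = {0<..<1}"
        unfolding image_image using homeomorphism_apply1[OF h] by force
      ultimately have "pl_homeomorphism (f ` {0<..<1}) (g ` f ` {0<..<1}) g f" "open (g ` f ` {0<..<1})"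
        using pl_homeomorphism_sym by auto
      then have "pl_chart J (f ` {0<..<1}) g" "open (g ` f ` {0<..<1})"
        unfolding pl_chart_def using opJ by blast+
      moreover have "z \<in> f ` {0<..<1}" using t t' by blast
      ultimately show False using z unfolding pl_boundary_def by blast
    qed
  qed
qed

lemma pl_subarc:
  assumes C: "pl_homeomorphism {0..1::real} C \<gamma> \<delta>" and ab: "0 \<le> a" "a < b" "b \<le> 1"
  shows "pl_arc (\<gamma> ` {a..b})" "bd1 (\<gamma> ` {a..b}) = {\<gamma> a, \<gamma> b}"
proof -
  have img: "(\<lambda>t. a + (b - a) * t) ` {0..1} = {a..b}"
  proof (intro equalityI subsetI)
    fix s assume "s \<in> (\<lambda>t. a + (b - a) * t) ` {0..1}"
    then obtain t where t': "s = a + (b - a) * t" "t \<in> {0..1}" by (rule imageE)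
    then have t: "s = a + (b - a) * t" "0 \<le> t" "t \<le> 1" by simp_all
    have "(b - a) * t \<le> b - a" "0 \<le> (b - a) * t" using t(2,3) ab(2) by (auto intro: mult_left_le)
    then show "s \<in> {a..b}" using t(1) by simp
  next
    fix s assume s: "s \<in> {a..b}"
    have "s = a + (b - a) * ((s - a) / (b - a))" using ab(2) by simp
    moreover have "(s - a) / (b - a) \<in> {0..1}" using s ab(2) by (auto simp: divide_simps)
    ultimately show "s \<in> (\<lambda>t. a + (b - a) * t) ` {0..1}" by (rule image_eqI)
  qed
  have "b - a \<noteq> 0" using ab(2) by simp
  from pl_homeomorphism_restrict[OF pl_homeomorphism_affine_real[OF this, of a] polyhedral_Icc[of 0 1] subset_UNIV]
  have 1: "pl_homeomorphism {0..1} {a..b} (\<lambda>t. a + (b - a) * t) (\<lambda>s. (s - a) / (b - a))"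
    unfolding img .
  have "{a..b} \<subseteq> {0..1}" using ab by auto
  from pl_homeomorphism_compose[OF 1 pl_homeomorphism_restrict[OF C polyhedral_Icc this]]
  have 2: "pl_homeomorphism {0..1} (\<gamma> ` {a..b}) (\<lambda>t. \<gamma> (a + (b - a) * t)) (\<lambda>x. (\<delta> x - a) / (b - a))" .
  then show "pl_arc (\<gamma> ` {a..b})" unfolding pl_arc_def by blast
  show "bd1 (\<gamma> ` {a..b}) = {\<gamma> a, \<gamma> b}" using pl_arc_boundary[OF 2] by simp
qed

lemma pl_arc_imp:
  assumes "pl_arc C"
  shows "compact C" "connected C" "polyhedral C" "contractible C" "C \<noteq> {}"
proof -
  obtain \<gamma> \<delta> where C: "pl_homeomorphism {0..1::real} C \<gamma> \<delta>" using assms unfolding pl_arc_def by blast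
  then have h: "homeomorphism {0..1::real} C \<gamma> \<delta>" unfolding pl_homeomorphism_iff by blast
  have img: "\<gamma> ` {0..1} = C" using homeomorphism_image1[OF h] .
  show "compact C" using compact_continuous_image[OF homeomorphism_cont1[OF h] compact_Icc] img by simp
  show "connected C" using connected_continuous_image[OF homeomorphism_cont1[OF h] connected_Icc] img by simp
  show "polyhedral C" using C pl_on_imp_polyhedral unfolding pl_homeomorphism_iff by blast
  have "{0..1::real} homeomorphic C" using h unfolding homeomorphic_def by blast
  then show "contractible C"
    using homeomorphic_contractible_eq convex_imp_contractible[OF convex_real_interval(5)[of 0 1]] by blast
  show "C \<noteq> {}" using img by auto
qed

section \<open>Quasi-embeddings and chains around the components\<close>

text \<open>
  The common form of \<open>r_contractible\<close> and \<open>r_split\<close> with \<open>r = n - 1\<close>: the chain then has indices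
  \<open>0, \<dots>, n\<close>.
\<close>
definition trivial_chain :: "('a::euclidean_space set \<Rightarrow> 'a set \<Rightarrow> bool) \<Rightarrow> nat \<Rightarrow> 'a set \<Rightarrow> 'a set \<Rightarrow> bool" where
  "trivial_chain triv n A X \<longleftrightarrow> (\<exists>P :: nat \<Rightarrow> 'a set. A \<subseteq> P 0 \<and>
     (\<forall>i\<le>n. compact (P i) \<and> polyhedral (P i) \<and> P i \<subseteq> X) \<and> (\<forall>i<n. triv (P i) (P (Suc i))))"

lemma r_contractible_iff:
  "r_contractible (int n - 1) A X \<longleftrightarrow> compact A \<and> trivial_chain null_homotopic_inclusion n A X"
  unfolding r_contractible_def trivial_chain_def by simp

lemma r_split_iff:
  "r_split (int n - 1) M A B \<longleftrightarrow> compact A \<and> compact B \<and> trivial_chain null_homologous_inclusion n A (M - B)"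
  unfolding r_split_def trivial_chain_def by simp

lemma arc_component_facts:
  assumes "finite_union_of_arcs N" "C \<in> components N"
  shows "pl_arc C" "C \<subseteq> N" "compact C" "polyhedral C"
  using assms pl_arc_imp in_components_subset unfolding finite_union_of_arcs_def by blast+

text \<open>
  The component is an embedded arc, hence contractible, so the constant chain \<open>f ` C\<close> works.
\<close>
lemma trivial_chain_embedded_component:
  assumes triv: "triviality_condition triv" and N: "finite_union_of_arcs N" and f: "pl_on N f" "f ` N \<subseteq> M"
    and C: "C \<in> components N" and inj: "inj_on f C" and disj: "f ` C \<inter> f ` (N - C) = {}"
  shows "trivial_chain triv n (f ` C) (M - (\<Union>D\<in>components N - {C}. f ` D))"
proof -
  note facts = arc_component_facts[OF N C]
  have plC: "pl_on C f" using pl_on_subset[OF f(1) facts(4,2)] .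
  have "C homeomorphic f ` C"
    using homeomorphic_compact[OF facts(3) pl_on_continuous[OF plC] refl inj] .
  then have "contractible (f ` C)"
    using homeomorphic_contractible_eq pl_arc_imp(4)[OF facts(1)] by blast
  moreover have "f ` C \<noteq> {}" using pl_arc_imp(5)[OF facts(1)] by simp
  ultimately have "triv (f ` C) (f ` C)" by (rule triviality_contractible[OF triv])
  moreover have "f ` C \<subseteq> M - (\<Union>D\<in>components N - {C}. f ` D)"
  proof -
    have "D \<subseteq> N - C" if "D \<in> components N - {C}" for D
      using that C components_nonoverlap[of D N C] in_components_subset[of D N] by blast
    then have "f ` D \<inter> f ` C = {}" if "D \<in> components N - {C}" for D
      using that disj by blast
    then show ?thesis using f(2) facts(2) by blast
  qed
  ultimately show ?thesis
    unfolding trivial_chain_def using compact_polyhedral_image[OF facts(3) plC]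
    by (intro exI[of _ "\<lambda>_. f ` C"]) simp
qed

lemma single_double_pointD:
  assumes "single_double_point N f x"
  obtains u v where "u \<noteq> v" "{w \<in> N. f w = x} = {u, v}"
  using assms unfolding single_double_point_def card_2_iff by (elim conjE exE) (rule that)

lemma single_double_point_inj:
  "\<lbrakk>single_double_point N f x; a \<in> N; b \<in> N; f a = f b; f a \<noteq> x\<rbrakk> \<Longrightarrow> a = b"
  unfolding single_double_point_def by simp

text \<open>
  The chain around the component \<open>C\<close> that carries the double point is \<open>P i \<union> f ` C\<close>; all other
  components are embedded.
\<close>
lemma quasi_embedding_imp_trivial_chain:
  assumes triv: "triviality_condition triv" and N: "finite_union_of_arcs N"
    and q: "gen_quasi_embedding triv n N M f" and C: "C \<in> components N"
  shows "trivial_chain triv n (f ` C) (M - (\<Union>D\<in>components N - {C}. f ` D))"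
proof -
  have "pl_pair_map N M f" using q unfolding gen_quasi_embedding_def by (rule conjunct1)
  then have f: "pl_on N f" "f ` N \<subseteq> M"
    unfolding pl_pair_map_def pl_map_iff by simp_all
  obtain x P J where x: "single_double_point N f x" and J0: "pl_arc (J 0)" and P0: "P 0 = {x}"
    and PJ: "\<forall>i\<le>n. polyhedral (P i) \<and> P i \<subseteq> M \<and> polyhedral (J i) \<and> J i \<subseteq> N"
    and PJS: "\<forall>i<n. P i \<subseteq> P (Suc i) \<and> J i \<subseteq> J (Suc i)"
    and fP: "\<forall>i\<le>n. {u \<in> N. f u \<in> P i} \<subseteq> J i"
    and tr: "\<forall>i<n. triv (P i \<union> f ` J i) (P (Suc i))"
    and arcs: "\<forall>i<n. compact (P (Suc i)) \<and> pl_3_manifold (P (Suc i)) \<and> pl_arc (J (Suc i))"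
    using q unfolding gen_quasi_embedding_def by (elim conjE exE) (rule that; assumption)
  have Jarc: "pl_arc (J i)" if "i \<le> n" for i
    using that J0 arcs by (cases i) simp_all
  have Pc: "compact (P i)" if "i \<le> n" for i
    using that P0 arcs by (cases i) simp_all
  have J0J: "J 0 \<subseteq> J i" if "i \<le> n" for i
    using that
  proof (induction i)
    case (Suc i)
    then have "J 0 \<subseteq> J i" "J i \<subseteq> J (Suc i)" using PJS by auto
    then show ?case by blast
  qed simp
  have x_pre: "{u \<in> N. f u = x} \<subseteq> J 0" using fP P0 by auto
  have inj: "a = b \<or> a \<in> J 0 \<and> b \<in> J 0" if "a \<in> N" "b \<in> N" "f a = f b" for a b
  proof (cases "f a = x")
    case True
    then show ?thesis using x_pre that by auto
  next
    case False
    then show ?thesis using single_double_point_inj[OF x that] by blast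
  qed
  have J0N: "J 0 \<subseteq> N" using PJ by blast
  obtain u0 where u0: "u0 \<in> J 0" using pl_arc_imp(5)[OF J0] by blast
  have "u0 \<in> \<Union>(components N)" using u0 J0N by (simp add: Union_components subset_iff)
  then obtain C0 where C0: "C0 \<in> components N" "u0 \<in> C0" by blast
  have JC0: "J i \<subseteq> C0" if "i \<le> n" for i
  proof (rule components_maximal[OF C0(1) pl_arc_imp(2)[OF Jarc[OF that]]])
    show "J i \<subseteq> N" using PJ that by blast
    show "C0 \<inter> J i \<noteq> {}" using C0(2) u0 J0J[OF that] by blast
  qed
  have disj: "D \<inter> E = {}" if "D \<in> components N" "E \<in> components N" "D \<noteq> E" for D E
    using that components_nonoverlap by blast
  note facts = arc_component_facts[OF N C]
  show ?thesis
  proof (cases "C = C0")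
    case False
    have CJ: "C \<inter> J 0 = {}" using disj[OF C C0(1) False] JC0[of 0] by blast
    have "inj_on f C"
      using inj facts(2) CJ unfolding inj_on_def by blast
    moreover have "f ` C \<inter> f ` (N - C) = {}"
      using inj facts(2) CJ by blast
    ultimately show ?thesis
      by (rule trivial_chain_embedded_component[OF triv N f C])
  next
    case True
    obtain \<gamma> \<delta> where "pl_homeomorphism {0..1::real} C \<gamma> \<delta>" using facts(1) unfolding pl_arc_def by blast
    then have hom: "homeomorphism {0..1::real} C \<gamma> \<delta>" unfolding pl_homeomorphism_iff by blast
    have plC: "pl_on C f" using pl_on_subset[OF f(1) facts(4,2)] .
    note fC = compact_polyhedral_image[OF facts(3) plC]
    have sub: "P i \<union> f ` C \<subseteq> M - (\<Union>D\<in>components N - {C}. f ` D)" if i: "i \<le> n" for i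
    proof -
      have "y \<notin> f ` D" if y: "y \<in> P i \<union> f ` C" and D: "D \<in> components N - {C}" for y D
      proof
        assume "y \<in> f ` D"
        then obtain d where d: "d \<in> D" "y = f d" by blast
        have dN: "d \<in> N" "d \<notin> C" using D d(1) disj[of D C] C in_components_subset by blast+
        show False
        proof (cases "y \<in> P i")
          case True
          then have "d \<in> J i" using fP i dN(1) d(2) by blast
          then show False using JC0[OF i] dN(2) \<open>C = C0\<close> by blast
        next
          case False
          then obtain c where c: "c \<in> C" "f c = f d" using y d(2) by auto
          then have "c = d \<or> d \<in> J 0" using inj[of c d] facts(2) dN(1) by blast
          then show False using c(1) dN(2) JC0[of 0] \<open>C = C0\<close> by blast
        qed
      qed
      moreover have "P i \<union> f ` C \<subseteq> M" using PJ i f(2) facts(2) by blast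
      ultimately show ?thesis by blast
    qed
    have step: "triv (P i \<union> f ` C) (P (Suc i) \<union> f ` C)" if i: "i < n" for i
    proof -
      have i': "i \<le> n" using i by simp
      have JiC: "J i \<subseteq> C" using JC0[OF i'] True by simp
      obtain r where r: "homotopic_with_canon (\<lambda>_. True) (P i \<union> f ` C) (P i \<union> f ` C) (\<lambda>x. x) r"
        "r ` (P i \<union> f ` C) \<subseteq> P i \<union> f ` J i"
      proof (rule arc_tails_retract[OF hom _ _ _ JiC pl_on_continuous[OF plC] Pc[OF i']])
        show "compact (J i)" "connected (J i)" "J i \<noteq> {}" using pl_arc_imp[OF Jarc[OF i']] by blast+
        show "u \<in> J i" if "u \<in> C" "f u \<in> P i" for u using that fP i' facts(2) by blast
        show "a = b \<or> a \<in> J i \<and> b \<in> J i" if "a \<in> C" "b \<in> C" "f a = f b" for a b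
          using inj[of a b] that facts(2) J0J[OF i'] by blast
      qed
      have "P i \<subseteq> P (Suc i)" using PJS i by blast
      then have "homotopic_with_canon (\<lambda>_. True) (P i \<union> f ` C) (P (Suc i) \<union> f ` C) (\<lambda>x. x) r"
        by (intro homotopic_with_subset_right[OF r(1)]) blast
      then show ?thesis
        using triviality_homotopy[OF triv, of "P i \<union> f ` J i" "P (Suc i)"] tr i r(2) by blast
    qed
    show ?thesis
      unfolding trivial_chain_def
    proof (intro exI[of _ "\<lambda>i. P i \<union> f ` C"] conjI allI impI)
      fix i assume i: "i \<le> n"
      show "compact (P i \<union> f ` C)" using Pc[OF i] fC(1) by blast
      show "polyhedral (P i \<union> f ` C)" using compact_polyhedral_Un[OF Pc[OF i] _ fC] PJ i by blast
      show "P i \<union> f ` C \<subseteq> M - (\<Union>D\<in>components N - {C}. f ` D)" using sub[OF i] .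
    qed (use step in auto)
  qed
qed

text \<open>
  The manifold neighbourhoods of the chain serve from index \<open>1\<close> on. The step from \<open>{x}\<close> to the first
  of them is trivial because the loop \<open>f ` J\<close> lies in \<open>P 0\<close>, whose inclusion into \<open>P 1\<close> is trivial.
\<close>
lemma trivial_chain_imp_quasi_embedding:
  fixes M :: "'a::euclidean_space set" and N :: "'b::euclidean_space set"
  assumes triv: "triviality_condition triv" and N: "finite_union_of_arcs N" and M: "pl_3_manifold M"
    and f: "pl_pair_map N M f" and x: "single_double_point N f x"
    and chain: "\<forall>C\<in>components N. trivial_chain triv n (f ` C) (M - (\<Union>D\<in>components N - {C}. f ` D))"
  shows "gen_quasi_embedding triv n N M f"
proof -
  have plf: "pl_on N f" "f ` N \<subseteq> M"
    using f unfolding pl_pair_map_def pl_map_iff by simp_all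
  obtain u v where uv: "u \<noteq> v" "{w \<in> N. f w = x} = {u, v}" using single_double_pointD[OF x] .
  have uvN: "u \<in> N" "v \<in> N" "f u = x" "f v = x"
  proof -
    have "u \<in> {w \<in> N. f w = x}" "v \<in> {w \<in> N. f w = x}" unfolding uv(2) by simp_all
    then show "u \<in> N" "v \<in> N" "f u = x" "f v = x" by simp_all
  qed
  have "u \<in> \<Union>(components N)" using uvN(1) by simp
  then obtain C where C: "C \<in> components N" "u \<in> C" by blast
  note facts = arc_component_facts[OF N C(1)]
  define B where "B = (\<Union>D\<in>components N - {C}. f ` D)"
  have "trivial_chain triv n (f ` C) (M - B)" unfolding B_def using bspec[OF chain C(1)] .
  then obtain P :: "nat \<Rightarrow> 'a set" where P: "f ` C \<subseteq> P 0"
    "\<forall>i\<le>n. compact (P i) \<and> polyhedral (P i) \<and> P i \<subseteq> M - B" "\<forall>i<n. triv (P i) (P (Suc i))"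
    unfolding trivial_chain_def by (elim exE conjE) (rule that)
  have outside: "w \<in> C" if "w \<in> N" "f w \<notin> B" for w
  proof (rule ccontr)
    assume "w \<notin> C"
    have "w \<in> \<Union>(components N)" using that(1) by simp
    then obtain D where "D \<in> components N" "w \<in> D" by blast
    then have "f w \<in> B" using \<open>w \<notin> C\<close> unfolding B_def by blast
    then show False using that(2) by blast
  qed
  have xP0: "x \<in> P 0" using P(1) C(2) uvN(3) by blast
  then have vC: "v \<in> C" using P(2) uvN(2,4) by (intro outside) auto
  obtain \<gamma> \<delta> where C\<gamma>: "pl_homeomorphism {0..1::real} C \<gamma> \<delta>" using facts(1) unfolding pl_arc_def by blast
  then have hom: "homeomorphism {0..1::real} C \<gamma> \<delta>" unfolding pl_homeomorphism_iff by blast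
  \<comment> \<open>parameters of the two preimages, in increasing order\<close>
  obtain a b where ab: "0 \<le> a" "a < b" "b \<le> 1" "{\<gamma> a, \<gamma> b} = {u, v}"
  proof -
    have \<delta>01: "\<delta> u \<in> {0..1}" "\<delta> v \<in> {0..1}"
      using imageI[OF C(2), of \<delta>] imageI[OF vC, of \<delta>] homeomorphism_image2[OF hom] by simp_all
    have \<gamma>\<delta>: "\<gamma> (\<delta> u) = u" "\<gamma> (\<delta> v) = v" using homeomorphism_apply2[OF hom] C(2) vC by simp_all
    then have "\<delta> u \<noteq> \<delta> v" using uv(1) by metis
    then consider "\<delta> u < \<delta> v" | "\<delta> v < \<delta> u" by linarith
    then show thesis
    proof cases
      case 1
      then show ?thesis using that[of "\<delta> u" "\<delta> v"] \<delta>01 \<gamma>\<delta> by simp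
    next
      case 2
      then show ?thesis using that[of "\<delta> v" "\<delta> u"] \<delta>01 \<gamma>\<delta> by (simp add: insert_commute)
    qed
  qed
  define J where "J = \<gamma> ` {a..b}"
  have J: "pl_arc J" "bd1 J = {u, v}"
    unfolding J_def using pl_subarc[OF C\<gamma> ab(1-3)] ab(4) by simp_all
  have JC: "J \<subseteq> C"
  proof -
    have "{a..b} \<subseteq> {0..1}" using ab(1-3) by simp
    then show ?thesis unfolding J_def using homeomorphism_image1[OF hom] by blast
  qed
  have uvJ: "{u, v} \<subseteq> J" unfolding J_def ab(4)[symmetric] using ab(2) by simp
  have "compact B"
  proof -
    have "compact (f ` D)" if "D \<in> components N" for D
      using arc_component_facts[OF N that]
      by (intro compact_continuous_image continuous_on_subset[OF pl_on_continuous[OF plf(1)]])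
    then show ?thesis
      unfolding B_def using N unfolding finite_union_of_arcs_def by (intro compact_UN) simp_all
  qed
  then have "open (- B)" by (intro open_Compl compact_imp_closed)
  have "\<exists>Q V. open V \<and> P 0 \<subseteq> V \<and> M \<inter> V \<subseteq> Q 0 \<and>
    (\<forall>i\<le>n. compact (Q i) \<and> pl_3_manifold (Q i) \<and> P i \<subseteq> Q i \<and> Q i \<subseteq> M \<inter> - B) \<and>
    (\<forall>i<n. triv (Q i) (Q (Suc i)))"
    by (rule triviality_manifold_chain[OF triv M \<open>open (- B)\<close>]) (use P(2,3) in \<open>simp_all add: Diff_eq\<close>)
  then obtain Q where Q: "\<forall>i\<le>n. compact (Q i) \<and> pl_3_manifold (Q i) \<and> P i \<subseteq> Q i \<and> Q i \<subseteq> M \<inter> - B"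
    and Qtriv: "\<forall>i<n. triv (Q i) (Q (Suc i))" by meson
  have fCP: "f ` C \<subseteq> P i" if "i \<le> n" for i
    using that
  proof (induction i)
    case (Suc i)
    then have "f ` C \<subseteq> P i" "P i \<subseteq> P (Suc i)"
      using P(3) triviality_subset[OF triv, of "P i" "P (Suc i)"] by simp_all
    then show ?case by (rule order_trans)
  qed (use P(1) in simp)
  have fCQ: "f ` C \<subseteq> Q i" if "i \<le> n" for i using fCP[OF that] Q that by blast
  define P' where "P' = case_nat {x} (\<lambda>j. Q (Suc j))"
  define J' where "J' = case_nat J (\<lambda>j::nat. C)"
  have fJ'C: "f ` J' i \<subseteq> f ` C" for i unfolding J'_def using JC by (cases i) auto
  have P'Q: "P' i \<subseteq> Q i" if "i \<le> n" for i
    using that fCQ[of 0] C(2) uvN(3) unfolding P'_def by (cases i) auto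
  have step: "triv (P' i \<union> f ` J' i) (P' (Suc i))" if i: "i < n" for i
  proof (cases i)
    case 0
    have "P' 0 \<union> f ` J' 0 \<subseteq> P 0" unfolding P'_def using fJ'C[of 0] P(1) xP0 by auto
    moreover have "P 1 \<subseteq> P' 1" using Q i 0 unfolding P'_def by simp
    moreover have "triv (P 0) (P 1)" using P(3) i 0 by simp
    ultimately show ?thesis using triviality_mono[OF triv] 0 by simp
  next
    case (Suc j)
    have "P' i \<union> f ` J' i \<subseteq> Q i" using P'Q[of i] fJ'C[of i] fCQ[of i] i by auto
    moreover have "triv (Q i) (Q (Suc i))" using Qtriv i by blast
    ultimately show ?thesis using triviality_mono[OF triv, of "Q i" "Q (Suc i)"] unfolding P'_def by simp
  qed
  show ?thesis
    unfolding gen_quasi_embedding_def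
  proof (intro conjI exI[of _ x] exI[of _ P'] exI[of _ J'] allI impI)
    show "pl_pair_map N M f" by fact
    show "single_double_point N f x" by fact
    show "pl_arc (J' 0)" unfolding J'_def using J(1) by simp
    show "bd1 (J' 0) = {u \<in> N. f u = x}" unfolding J'_def using J(2) uv(2) by simp
    show "P' 0 = {x}" unfolding P'_def by simp
    fix i
    show "polyhedral (J' i)" unfolding J'_def using pl_arc_imp(3)[OF J(1)] facts(4) by (cases i) simp_all
    show "J' i \<subseteq> N" unfolding J'_def using JC facts(2) by (cases i) auto
    show "polyhedral (P' i)" if "i \<le> n"
      using that Q polyhedron_imp_polyhedral[OF polytope_imp_polyhedron[OF polytope_sing]]
      unfolding P'_def pl_manifold_def by (cases i) simp_all
    show "P' i \<subseteq> M" if "i \<le> n" using P'Q[OF that] Q that by blast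
    show "{u \<in> N. f u \<in> P' i} \<subseteq> J' i" if i: "i \<le> n"
    proof (cases i)
      case 0
      then show ?thesis unfolding P'_def J'_def using uv(2) uvJ by simp
    next
      case (Suc j)
      have "w \<in> C" if "w \<in> N" "f w \<in> P' i" for w
        using that P'Q[OF i] Q i by (intro outside) auto
      then show ?thesis unfolding J'_def Suc by auto
    qed
  next
    fix i assume i: "i < n"
    show "triv (P' i \<union> f ` J' i) (P' (Suc i))" using step[OF i] .
    then show sub: "P' i \<union> f ` J' i \<subseteq> P' (Suc i)" by (rule triviality_subset[OF triv])
    then show "P' i \<subseteq> P' (Suc i)" by simp
    show "J' i \<subseteq> J' (Suc i)" unfolding J'_def using JC by (cases i) simp_all
    show "compact (P' (Suc i))" "pl_3_manifold (P' (Suc i))" unfolding P'_def using Q i by simp_all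
    show "pl_arc (J' (Suc i))" unfolding J'_def using facts(1) by simp
  qed
qed

lemma generic_pl_homotopy_level:
  assumes "polyhedral N" "generic_pl_homotopy N M h" "t \<in> {0..1}"
  shows "pl_pair_map N M (h t)"
proof -
  have h: "pl_on (N \<times> {0..1}) (\<lambda>(u, t). h t u)" "polyhedral M" "(\<lambda>(u, t). h t u) ` (N \<times> {0..1}) \<subseteq> M"
    "h t ` bd1 N \<subseteq> bd3 M"
    using assms(2,3) unfolding generic_pl_homotopy_def pl_map_iff by simp_all
  have "pl_on N (\<lambda>u. (u, t))" by (intro pl_on_Pair pl_on_id pl_on_const assms(1))
  moreover have "(\<lambda>u. (u, t)) ` N \<subseteq> N \<times> {0..1}" using assms(3) by auto
  ultimately have "pl_on N (\<lambda>u. (\<lambda>(u, t). h t u) (u, t))" using pl_on_compose[OF _ h(1)] by blast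
  moreover have "h t ` N \<subseteq> M" using h(3) assms(3) by force
  ultimately show ?thesis unfolding pl_pair_map_def pl_map_iff using h(2,4) by simp
qed

lemma link_trivial_chain:
  assumes triv: "triviality_condition triv" and N: "finite_union_of_arcs N" and L: "link N M f"
    and C: "C \<in> components N"
  shows "trivial_chain triv n (f ` C) (M - (\<Union>D\<in>components N - {C}. f ` D))"
proof -
  have f: "pl_on N f" "f ` N \<subseteq> M"
    using L unfolding link_def pl_pair_map_def pl_map_iff by simp_all
  obtain g where "homeomorphism N (f ` N) f g" using L unfolding link_def pl_embedding_def by blast
  then have "inj_on f N" by (metis homeomorphism_apply1 inj_onI)
  moreover have CN: "C \<subseteq> N" using C in_components_subset by blast
  ultimately have "inj_on f C" "f ` C \<inter> f ` (N - C) = {}"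
    using inj_on_subset inj_on_image_Int[of f N C "N - C"] by auto
  then show ?thesis by (rule trivial_chain_embedded_component[OF triv N f C])
qed

lemma quasi_embedding_levels_iff:
  assumes triv: "triviality_condition triv" and N: "finite_union_of_arcs N" "polyhedral N" and M: "pl_3_manifold M"
    and h: "generic_pl_homotopy N M h"
  shows "(\<forall>t\<in>{0..1}. \<not> link N M (h t) \<longrightarrow> gen_quasi_embedding triv n N M (h t)) \<longleftrightarrow>
    (\<forall>t\<in>{0..1}. \<forall>C\<in>components N. trivial_chain triv n (h t ` C) (M - (\<Union>D\<in>components N - {C}. h t ` D)))"
proof (intro iffI ballI impI)
  fix t :: real and C
  assume *: "\<forall>t\<in>{0..1}. \<not> link N M (h t) \<longrightarrow> gen_quasi_embedding triv n N M (h t)" and t: "t \<in> {0..1}"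
    and C: "C \<in> components N"
  show "trivial_chain triv n (h t ` C) (M - (\<Union>D\<in>components N - {C}. h t ` D))"
  proof (cases "link N M (h t)")
    case True
    show ?thesis by (rule link_trivial_chain[OF triv N(1) True C])
  next
    case False
    then have "gen_quasi_embedding triv n N M (h t)" using * t by blast
    then show ?thesis by (rule quasi_embedding_imp_trivial_chain[OF triv N(1) _ C])
  qed
next
  fix t :: real
  assume *: "\<forall>t\<in>{0..1}. \<forall>C\<in>components N. trivial_chain triv n (h t ` C) (M - (\<Union>D\<in>components N - {C}. h t ` D))"
    and t: "t \<in> {0..1}" and sing: "\<not> link N M (h t)"
  obtain x where x: "single_double_point N (h t) x"
    using h t sing unfolding generic_pl_homotopy_def by blast
  show "gen_quasi_embedding triv n N M (h t)"
    by (rule trivial_chain_imp_quasi_embedding[OF triv N(1) M generic_pl_homotopy_level[OF N(2) h t] x])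
      (use * t in blast)
qed

lemma compact_level_image:
  assumes N: "finite_union_of_arcs N" "polyhedral N" and h: "generic_pl_homotopy N M h" and t: "t \<in> {0..1}"
    and S: "S \<subseteq> components N"
  shows "compact (\<Union>D\<in>S. h t ` D)"
proof -
  have "continuous_on N (h t)"
    using generic_pl_homotopy_level[OF N(2) h t] unfolding pl_pair_map_def pl_map_def by simp
  then have "compact (h t ` D)" if "D \<in> S" for D
    using arc_component_facts[OF N(1) subsetD[OF S that]]
    by (intro compact_continuous_image) (auto elim: continuous_on_subset)
  moreover have "finite S" using N(1) S finite_subset unfolding finite_union_of_arcs_def by blast
  ultimately show ?thesis by (intro compact_UN)
qed

lemma ex_conj_cong: "(\<And>h. A h \<Longrightarrow> P h \<longleftrightarrow> Q h) \<Longrightarrow> (\<exists>h. A h \<and> B h \<and> P h) \<longleftrightarrow> (\<exists>h. A h \<and> B h \<and> Q h)"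
  by blast

theorem theorem1p2:
  fixes M :: "'a::euclidean_space set" and N :: "'b::euclidean_space set"
    and L1 L2 :: "'b \<Rightarrow> 'a" and n :: nat
  assumes "orientable_pl_3_manifold M"
    and "finite_union_of_arcs N"
    and "link N M L1" and "link N M L2"
  shows "(quasi_isotopic n N M L1 L2 \<longleftrightarrow>
            (\<exists>h. generic_pl_homotopy N M h \<and> joins N h L1 L2 \<and>
               (\<forall>t\<in>{0..1}. \<forall>C\<in>components N.
                  r_contractible (int n - 1) (h t ` C) (M - (\<Union>D\<in>components N - {C}. h t ` D))))) \<and>
         (weakly_quasi_isotopic n N M L1 L2 \<longleftrightarrow>
            (\<exists>h. generic_pl_homotopy N M h \<and> joins N h L1 L2 \<and>
               (\<forall>t\<in>{0..1}. \<forall>C\<in>components N.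
                  r_split (int n - 1) M (h t ` C) (\<Union>D\<in>components N - {C}. h t ` D))))"
proof -
  have M: "pl_3_manifold M" using assms(1) unfolding orientable_pl_3_manifold_def by simp
  have N: "polyhedral N" using assms(3) unfolding link_def pl_pair_map_def pl_map_def by simp
  have comp: "compact (h t ` C)" "compact (\<Union>D\<in>components N - {C}. h t ` D)"
    if "generic_pl_homotopy N M h" "t \<in> {0..1}" "C \<in> components N" for h t C
    using compact_level_image[OF assms(2) N that(1,2), of "{C}"]
      compact_level_image[OF assms(2) N that(1,2), of "components N - {C}"] that(3) by auto
  show ?thesis
  proof
    show "quasi_isotopic n N M L1 L2 \<longleftrightarrow>
            (\<exists>h. generic_pl_homotopy N M h \<and> joins N h L1 L2 \<and>
               (\<forall>t\<in>{0..1}. \<forall>C\<in>components N.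
                  r_contractible (int n - 1) (h t ` C) (M - (\<Union>D\<in>components N - {C}. h t ` D))))"
      unfolding quasi_isotopic_def quasi_embedding_def r_contractible_iff
    proof (rule ex_conj_cong)
      fix h assume h: "generic_pl_homotopy N M h"
      show "(\<forall>t\<in>{0..1}. \<not> link N M (h t) \<longrightarrow> gen_quasi_embedding null_homotopic_inclusion n N M (h t)) \<longleftrightarrow>
        (\<forall>t\<in>{0..1}. \<forall>C\<in>components N. compact (h t ` C) \<and>
          trivial_chain null_homotopic_inclusion n (h t ` C) (M - (\<Union>D\<in>components N - {C}. h t ` D)))"
        unfolding quasi_embedding_levels_iff[OF triviality_null_homotopic assms(2) N M h]
        by (intro ball_cong refl) (simp add: comp(1)[OF h])
    qed
    show "weakly_quasi_isotopic n N M L1 L2 \<longleftrightarrow>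
            (\<exists>h. generic_pl_homotopy N M h \<and> joins N h L1 L2 \<and>
               (\<forall>t\<in>{0..1}. \<forall>C\<in>components N.
                  r_split (int n - 1) M (h t ` C) (\<Union>D\<in>components N - {C}. h t ` D)))"
      unfolding weakly_quasi_isotopic_def weak_quasi_embedding_def r_split_iff
    proof (rule ex_conj_cong)
      fix h assume h: "generic_pl_homotopy N M h"
      show "(\<forall>t\<in>{0..1}. \<not> link N M (h t) \<longrightarrow> gen_quasi_embedding null_homologous_inclusion n N M (h t)) \<longleftrightarrow>
        (\<forall>t\<in>{0..1}. \<forall>C\<in>components N. compact (h t ` C) \<and> compact (\<Union>D\<in>components N - {C}. h t ` D) \<and>
          trivial_chain null_homologous_inclusion n (h t ` C) (M - (\<Union>D\<in>components N - {C}. h t ` D)))"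
        unfolding quasi_embedding_levels_iff[OF triviality_null_homologous assms(2) N M h]
        by (intro ball_cong refl) (simp add: comp[OF h])
    qed
  qed
qed

end
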